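(* If $G$ is a connected series-parallel multigraph (with any fixed ordering of $E(G)$), then $X(G)\subseteq L_{e(G)-v(G)+1,\,v(G)-1}$ is $p$-degenerate. If $(G,e)\in\mathcal{G}'$ (with any fixed ordering of $E(G)\setminus\{e\}$), then $Y(G,e)\subseteq L'_{e(G)-v(G),\,v(G)-2}$ is $p$-degenerate.
   Context: Multigraphs may have loops and parallel edges; $e(G)=|E(G)|$, $v(G) = |V(G)|$. A series-parallel graph is a multigraph with no $K_4$ minor. $\mathcal{G}'$ is the set of pairs $(G,e)$ with $G$ a connected series-parallel multigraph and $e\in E(G)$ neither a bridge nor a loop. $X(G)\subseteq\{0,1\}^{E(G)}$ is the set of indicator strings of spanning-tree edge sets of $G$. $Y(G,e)$ is the set of strings over $\{0,1,*\}$ indexed by $E(G)\setminus\{e\}$ with exactly one $*$, at position $e'$, ones exactly on a set $S$, such that both $S\cup\{e\}$ and $S\cup\{e'\}$ are spanning-tree edge sets of $G$ (equivalently, the hypercube edge $\{S,S\cup\{e'\}\}$). For nonnegative integers $a,b$: $L_{a,b}$ is the set of binary strings of length $a+b$ with $a$ zeros and $b$ ones; $L'_{a,b}$ is the set of strings of length $a+b+1$ over $\{0,1,*\}$ with $a$ zeros, $b$ ones and exactly one $*$. For $a\le a'$, $b\le b'$, $P_{a,b,a',b'}$ is the set of words of length $a'+b'$ over $\{s_1,\dots,s_{a+b},0,1\}$ with each $s_j$ appearing exactly once, $a'-a$ zeros and $b'-b$ ones; for such $p$, $\psi_p:L_{a,b}\to L_{a',b'}$ is given by $\psi_p(x)_i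 = x_j$ if $p_i=s_j$ and $\psi_p(x)_i=p_i$ if $p_i\in\{0,1\}$. $P'_{a,b,a',b'}$ and $\psi_p: L'_{a,b}\to L'_{a',b'}$ are defined analogously with symbols $s_1,\dots,s_{a+b+1}$. For $X\subseteq L_{a,b}$, $X'\subseteq L_{a',b'}$, $t(X,X') = |\{p\in P_{a,b,a',b'}:\psi_p(X)\subseteq X'\}|/|P_{a,b,a',b'}|$; analogously $t(Y,Y')$ via $P'$. A set $X\subseteq L_{a,b}$ (resp. $Y\subseteq L'_{a,b}$) is $p$-degenerate if there exist constants $c_1,c_2,c_3,c_4>0$ such that for all $a'\ge a$, $b'\ge b$ and all $X'\subseteq L_{a',b'}$ (resp. $\subseteq L'_{a',b'}$) with $|X'|=\delta|L_{a',b'}|$ (resp. $\delta |L'_{a',b'}|$) and $\delta\ge c_1\min(a',b')^{-c_2}$, one has $t(X,X')\ge c_3\delta^{c_4}$. *)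

theory Defs
  imports Complex_Main
begin

section \<open>Multigraphs\<close>

text \<open>The set \<open>ends G f\<close> of endpoints of an edge has two elements, or one if \<open>f\<close> is a loop.\<close>

record ('v, 'e) mgraph =
  verts :: "'v set"
  edges :: "'e set"
  ends :: "'e \<Rightarrow> 'v set"

definition multigraph :: "('v, 'e) mgraph \<Rightarrow> bool" where
  "multigraph G \<longleftrightarrow> finite (verts G) \<and> finite (edges G) \<and>
     (\<forall>f\<in>edges G. ends G f \<subseteq> verts G \<and> card (ends G f) \<in> {1, 2})"

definition num_verts :: "('v, 'e) mgraph \<Rightarrow> nat" where
  "num_verts G = card (verts G)"

definition num_edges :: "('v, 'e) mgraph \<Rightarrow> nat" where
  "num_edges G = card (edges G)"

definition adj :: "('v, 'e) mgraph \<Rightarrow> 'v rel" where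
  "adj G = {(u, v). \<exists>f\<in>edges G. ends G f = {u, v}}"

definition connected_graph :: "('v, 'e) mgraph \<Rightarrow> bool" where
  "connected_graph G \<longleftrightarrow> verts G \<noteq> {} \<and> (\<forall>u\<in>verts G. \<forall>v\<in>verts G. (u, v) \<in> (adj G)\<^sup>*)"

definition delete_edge :: "'e \<Rightarrow> ('v, 'e) mgraph \<Rightarrow> ('v, 'e) mgraph" where
  "delete_edge f G = G\<lparr>edges := edges G - {f}\<rparr>"

definition delete_vertex :: "'v \<Rightarrow> ('v, 'e) mgraph \<Rightarrow> ('v, 'e) mgraph" where
  "delete_vertex v G = G\<lparr>verts := verts G - {v}, edges := {f \<in> edges G. v \<notin> ends G f}\<rparr>"

text \<open>In \<open>contract_edge f u v G\<close> the edge \<open>f\<close> has endpoints \<open>u\<close> and \<open>v\<close>, and the vertex obtained by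
  merging them is called \<open>u\<close>. Edges parallel to \<open>f\<close> become loops.\<close>

definition contract_edge :: "'e \<Rightarrow> 'v \<Rightarrow> 'v \<Rightarrow> ('v, 'e) mgraph \<Rightarrow> ('v, 'e) mgraph" where
  "contract_edge f u v G =
     \<lparr>verts = verts G - {v}, edges = edges G - {f},
      ends = (\<lambda>g. (\<lambda>x. if x = v then u else x) ` ends G g)\<rparr>"

inductive minor_step :: "('v, 'e) mgraph \<Rightarrow> ('v, 'e) mgraph \<Rightarrow> bool" where
  del_edge: "f \<in> edges G \<Longrightarrow> minor_step G (delete_edge f G)"
| del_vertex: "v \<in> verts G \<Longrightarrow> minor_step G (delete_vertex v G)"
| contract: "f \<in> edges G \<Longrightarrow> ends G f = {u, v} \<Longrightarrow> u \<noteq> v \<Longrightarrow> minor_step G (contract_edge f u v G)"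

definition isomorphic :: "('v, 'e) mgraph \<Rightarrow> ('w, 'f) mgraph \<Rightarrow> bool" where
  "isomorphic G H \<longleftrightarrow> (\<exists>\<phi> \<eta>. bij_betw \<phi> (verts G) (verts H) \<and> bij_betw \<eta> (edges G) (edges H) \<and>
     (\<forall>f\<in>edges G. ends H (\<eta> f) = \<phi> ` ends G f))"

definition has_minor :: "('v, 'e) mgraph \<Rightarrow> ('w, 'f) mgraph \<Rightarrow> bool" where
  "has_minor G H \<longleftrightarrow> (\<exists>M. minor_step\<^sup>*\<^sup>* G M \<and> isomorphic M H)"

definition K4 :: "(nat, nat set) mgraph" where
  "K4 = \<lparr>verts = {..<4}, edges = {s. s \<subseteq> {..<4} \<and> card s = 2}, ends = (\<lambda>s. s)\<rparr>"

definition series_parallel :: "('v, 'e) mgraph \<Rightarrow> bool" where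
  "series_parallel G \<longleftrightarrow> multigraph G \<and> \<not> has_minor G K4"

definition is_loop :: "('v, 'e) mgraph \<Rightarrow> 'e \<Rightarrow> bool" where
  "is_loop G f \<longleftrightarrow> f \<in> edges G \<and> card (ends G f) = 1"

definition is_bridge :: "('v, 'e) mgraph \<Rightarrow> 'e \<Rightarrow> bool" where
  "is_bridge G f \<longleftrightarrow> f \<in> edges G \<and>
     (\<exists>u\<in>verts G. \<exists>v\<in>verts G. (u, v) \<in> (adj G)\<^sup>* \<and> (u, v) \<notin> (adj (delete_edge f G))\<^sup>*)"

text \<open>A cycle has vertices \<open>vs ! 0, vs ! 1, \<dots>\<close> in cyclic order, \<open>fs ! i\<close> joining \<open>vs ! i\<close> to the next
  one. A loop is a cycle of length one, and two parallel edges form a cycle of length two.\<close>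

definition is_cycle :: "('v, 'e) mgraph \<Rightarrow> 'v list \<Rightarrow> 'e list \<Rightarrow> bool" where
  "is_cycle G vs fs \<longleftrightarrow> fs \<noteq> [] \<and> length vs = length fs \<and> distinct vs \<and> distinct fs \<and>
     set vs \<subseteq> verts G \<and> set fs \<subseteq> edges G \<and>
     (\<forall>i<length fs. ends G (fs ! i) = {vs ! i, vs ! (Suc i mod length fs)})"

definition is_tree :: "('v, 'e) mgraph \<Rightarrow> bool" where
  "is_tree G \<longleftrightarrow> connected_graph G \<and> \<not> (\<exists>vs fs. is_cycle G vs fs)"

definition spanning_tree_edges :: "('v, 'e) mgraph \<Rightarrow> 'e set \<Rightarrow> bool" where
  "spanning_tree_edges G T \<longleftrightarrow> T \<subseteq> edges G \<and> is_tree (G\<lparr>edges := T\<rparr>)"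

text \<open>The class of pairs denoted \<open>\<G>'\<close>.\<close>

definition rooted_sp :: "(('v, 'e) mgraph \<times> 'e) set" where
  "rooted_sp = {(G, e). connected_graph G \<and> series_parallel G \<and> e \<in> edges G \<and>
     \<not> is_bridge G e \<and> \<not> is_loop G e}"

section \<open>Strings and patterns\<close>

text \<open>Binary strings are boolean lists. Strings over \<open>{0, 1, *}\<close> have entries \<open>Some False\<close>,
  \<open>Some True\<close> and \<open>None\<close>, respectively.\<close>

definition L :: "nat \<Rightarrow> nat \<Rightarrow> bool list set" where
  "L a b = {x. length x = a + b \<and> count_list x False = a \<and> count_list x True = b}"

definition L' :: "nat \<Rightarrow> nat \<Rightarrow> bool option list set" where
  "L' a b = {x. length x = a + b + 1 \<and> count_list x (Some False) = a \<and>
     count_list x (Some True) = b \<and> count_list x None = 1}"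

text \<open>An ordering of a finite set of edges is a list \<open>es\<close> enumerating it without repetition;
  position \<open>i\<close> of a string is indexed by \<open>es ! i\<close>.\<close>

definition ordering_of :: "'e list \<Rightarrow> 'e set \<Rightarrow> bool" where
  "ordering_of es E \<longleftrightarrow> distinct es \<and> set es = E"

definition X_strings :: "('v, 'e) mgraph \<Rightarrow> 'e list \<Rightarrow> bool list set" where
  "X_strings G es = {map (\<lambda>f. f \<in> T) es | T. spanning_tree_edges G T}"

definition Y_strings :: "('v, 'e) mgraph \<Rightarrow> 'e \<Rightarrow> 'e list \<Rightarrow> bool option list set" where
  "Y_strings G e es =
     {map (\<lambda>f. if f = e' then None else Some (f \<in> S)) es | e' S.
        e' \<in> edges G - {e} \<and> S \<subseteq> edges G - {e, e'} \<and>
        spanning_tree_edges G (insert e S) \<and> spanning_tree_edges G (insert e' S)}"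

text \<open>Letters of patterns; the symbols \<open>s\<^sub>1, s\<^sub>2, \<dots>\<close> are numbered from \<open>0\<close>.\<close>

datatype letter = Sym nat | Bit bool

definition P :: "nat \<Rightarrow> nat \<Rightarrow> nat \<Rightarrow> nat \<Rightarrow> letter list set" where
  "P a b a' b' = {p. length p = a' + b' \<and> set p \<subseteq> Sym ` {..<a + b} \<union> range Bit \<and>
     (\<forall>j<a + b. count_list p (Sym j) = 1) \<and>
     count_list p (Bit False) = a' - a \<and> count_list p (Bit True) = b' - b}"

definition P' :: "nat \<Rightarrow> nat \<Rightarrow> nat \<Rightarrow> nat \<Rightarrow> letter list set" where
  "P' a b a' b' = {p. length p = a' + b' + 1 \<and> set p \<subseteq> Sym ` {..<a + b + 1} \<union> range Bit \<and>
     (\<forall>j<a + b + 1. count_list p (Sym j) = 1) \<and>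
     count_list p (Bit False) = a' - a \<and> count_list p (Bit True) = b' - b}"

definition psi :: "letter list \<Rightarrow> bool list \<Rightarrow> bool list" where
  "psi p x = map (\<lambda>l. case l of Sym j \<Rightarrow> x ! j | Bit c \<Rightarrow> c) p"

definition psi' :: "letter list \<Rightarrow> bool option list \<Rightarrow> bool option list" where
  "psi' p x = map (\<lambda>l. case l of Sym j \<Rightarrow> x ! j | Bit c \<Rightarrow> Some c) p"

definition t :: "nat \<Rightarrow> nat \<Rightarrow> nat \<Rightarrow> nat \<Rightarrow> bool list set \<Rightarrow> bool list set \<Rightarrow> real" where
  "t a b a' b' X X' =
     real (card {p \<in> P a b a' b'. psi p ` X \<subseteq> X'}) / real (card (P a b a' b'))"

definition t' ::
  "nat \<Rightarrow> nat \<Rightarrow> nat \<Rightarrow> nat \<Rightarrow> bool option list set \<Rightarrow> bool option list set \<Rightarrow> real" where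
  "t' a b a' b' Y Y' =
     real (card {p \<in> P' a b a' b'. psi' p ` Y \<subseteq> Y'}) / real (card (P' a b a' b'))"

text \<open>When \<open>min a' b' = 0\<close>, the threshold \<open>c1 * (min a' b') powr - c2\<close> is infinite and nothing is
  required of \<open>X'\<close>. As \<open>0 powr - c2 = 0\<close> in HOL, this case has to be excluded explicitly.\<close>

definition p_degenerate :: "nat \<Rightarrow> nat \<Rightarrow> bool list set \<Rightarrow> bool" where
  "p_degenerate a b X \<longleftrightarrow>
     (\<exists>c1 c2 c3 c4 :: real. c1 > 0 \<and> c2 > 0 \<and> c3 > 0 \<and> c4 > 0 \<and>
       (\<forall>a' b' X' \<delta>. a \<le> a' \<longrightarrow> b \<le> b' \<longrightarrow> X' \<subseteq> L a' b' \<longrightarrow>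
          real (card X') = \<delta> * real (card (L a' b')) \<longrightarrow>
          min a' b' > 0 \<longrightarrow> \<delta> \<ge> c1 * real (min a' b') powr (- c2) \<longrightarrow>
          t a b a' b' X X' \<ge> c3 * \<delta> powr c4))"

definition p_degenerate' :: "nat \<Rightarrow> nat \<Rightarrow> bool option list set \<Rightarrow> bool" where
  "p_degenerate' a b Y \<longleftrightarrow>
     (\<exists>c1 c2 c3 c4 :: real. c1 > 0 \<and> c2 > 0 \<and> c3 > 0 \<and> c4 > 0 \<and>
       (\<forall>a' b' Y' \<delta>. a \<le> a' \<longrightarrow> b \<le> b' \<longrightarrow> Y' \<subseteq> L' a' b' \<longrightarrow>
          real (card Y') = \<delta> * real (card (L' a' b')) \<longrightarrow>
          min a' b' > 0 \<longrightarrow> \<delta> \<ge> c1 * real (min a' b') powr (- c2) \<longrightarrow>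
          t' a b a' b' Y Y' \<ge> c3 * \<delta> powr c4))"

end

theory Submission
  imports Defs "HOL-Library.Multiset"
begin

text \<open>A pattern of density \<open>t(X, X')\<close> is chosen at random. Adding a loop or a pendant edge to a graph only
  adds a constant coordinate to its strings, which does not change the density. If an edge \<open>f\<close> is
  replaced by two parallel edges, then, with everything but the position of \<open>f\<close> fixed, a pattern for
  the new graph is a pair of distinct positions for \<open>f\<close>, both good for the old graph, since a position
  carrying \<open>0\<close> is indistinguishable from the background. By Cauchy--Schwarz the density is at least
  about the square of the old one. Series extensions are dual, with \<open>0\<close> and \<open>1\<close> exchanged. For \<open>Y(G, e)\<close>
  the same works as long as \<open>e\<close> itself is never extended, starting from two parallel edges.

  That all series-parallel graphs arise in this way follows from the fact that a simple graph
  without \<open>K\<^sub>4\<close> minor has, for every edge \<open>e\<close> not covering all vertices, a vertex of degree at most two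
  off \<open>e\<close>. If two adjacent roots \<open>s\<close>, \<open>t\<close> are the only vertices of degree less than three, then in a
  component \<open>C\<close> of the remaining graph Menger's theorem gives either two disjoint paths between the
  neighbours of \<open>s\<close> and those of \<open>t\<close>, hence a \<open>K\<^sub>4\<close> minor, or a cut vertex, which is the new root of
  a smaller graph of the same kind.\<close>

section \<open>Connected sets and models of the complete graph on four vertices\<close>

text \<open>The rooted form of the degree lemma is forced by \<open>Y(G, e)\<close>: there
  \<open>e\<close> has to survive every reduction, so the vertex of degree at most two must avoid
  \<open>e\<close>. For \<open>X(G)\<close> any edge may be taken as \<open>e\<close>, so one
  induction over an \<open>'e option\<close> serves both statements. The quantitative obstacle is
  the diagonal in the second moment: the two positions must be distinct, which costs
  \<open>\<tau> / z\<close> out of \<open>\<tau>^2\<close>, with \<open>z\<close> counting the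
  available bits of the relevant kind. This is harmless once \<open>\<tau> * z\<close> is at least
  2, and that is what the lower bound on \<delta> in terms of \<open>min a' b'\<close> provides.
  Each doubling squares the density, hence the polynomial form of the conclusion. Orderings of edges
  are absent from the induction: strings are functions of the edge and pattern symbols are edges, so
  deletion and contraction need no renumbering. Connectivity and spanning trees are treated through
  cuts rather than walks or cycles, because cuts pull back along contractions and ignore loops and
  multiplicities.\<close>

definition rconn :: "'a rel \<Rightarrow> 'a set \<Rightarrow> bool" where
  "rconn R K \<longleftrightarrow> K \<noteq> {} \<and> (\<forall>U. U \<subset> K \<longrightarrow> U \<noteq> {} \<longrightarrow> (\<exists>u\<in>U. \<exists>w\<in>K - U. (u, w) \<in> R))"

lemma rconn_nonempty: "rconn R K \<Longrightarrow> K \<noteq> {}"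
  by (simp add: rconn_def)

lemma rconnD:
  assumes "rconn R K" "U \<subseteq> K" "U \<noteq> {}" "U \<noteq> K"
  obtains u w where "u \<in> U" "w \<in> K - U" "(u, w) \<in> R"
  using assms unfolding rconn_def by blast

lemma rconn_singleton: "rconn R {x}"
  by (auto simp: rconn_def)

lemma rconn_union:
  assumes "sym R" "rconn R K" "rconn R K'" and uw: "u \<in> K" "w \<in> K'" "(u, w) \<in> R"
  shows "rconn R (K \<union> K')"
  unfolding rconn_def
proof (intro conjI allI impI)
  show "K \<union> K' \<noteq> {}" using uw by blast
  fix U assume U: "U \<subset> K \<union> K'" "U \<noteq> {}"
  have wu: "(w, u) \<in> R" using assms(1) uw(3) by (rule symD)
  consider "U \<inter> K \<noteq> {}" "U \<inter> K \<noteq> K" | "U \<inter> K' \<noteq> {}" "U \<inter> K' \<noteq> K'"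
    | "K \<subseteq> U" "U \<inter> K' = {}" | "K' \<subseteq> U" "U \<inter> K = {}"
    using U by blast
  then show "\<exists>u\<in>U. \<exists>w\<in>K \<union> K' - U. (u, w) \<in> R"
  proof cases
    case 1
    then obtain a b where "a \<in> U \<inter> K" "b \<in> K - U \<inter> K" "(a, b) \<in> R"
      using rconnD[OF assms(2), of "U \<inter> K"] by blast
    then show ?thesis by blast
  next
    case 2
    then obtain a b where "a \<in> U \<inter> K'" "b \<in> K' - U \<inter> K'" "(a, b) \<in> R"
      using rconnD[OF assms(3), of "U \<inter> K'"] by blast
    then show ?thesis by blast
  next
    case 3
    then show ?thesis using uw by blast
  next
    case 4
    then show ?thesis using uw wu by blast
  qed
qed

lemma rconn_component:
  assumes "sym R" "finite C" "rconn R K" "K \<subseteq> C"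
  obtains D where "K \<subseteq> D" "D \<subseteq> C" "rconn R D" "\<And>u w. u \<in> D \<Longrightarrow> w \<in> C - D \<Longrightarrow> (u, w) \<notin> R"
proof -
  let ?S = "{D. K \<subseteq> D \<and> D \<subseteq> C \<and> rconn R D}"
  have "finite ?S" by (rule finite_subset[of _ "Pow C"]) (use assms in auto)
  moreover have "?S \<noteq> {}" using assms by blast
  ultimately obtain D where D: "D \<in> ?S" "\<And>D'. D' \<in> ?S \<Longrightarrow> D \<subseteq> D' \<Longrightarrow> D = D'"
    by (meson finite_has_maximal)
  have "(u, w) \<notin> R" if "u \<in> D" "w \<in> C - D" for u w
  proof
    assume "(u, w) \<in> R"
    then have "rconn R (D \<union> {w})"
      using rconn_union[OF assms(1) _ rconn_singleton] D(1) that by blast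
    moreover have "D \<union> {w} \<in> ?S" using calculation D(1) that by blast
    ultimately have "D = D \<union> {w}" using D(2)[of "D \<union> {w}"] by blast
    then show False using that by blast
  qed
  then show ?thesis using D(1) that by blast
qed

text \<open>Within \<open>C\<close>, the set \<open>D\<close> is attached to the rest only through
  \<open>a\<close>, so an edge leaving a part of \<open>C - D\<close> that avoids \<open>a\<close>
  cannot end in \<open>D\<close>. A part containing \<open>a\<close> is handled through its
  complement.\<close>

lemma rconn_diff_component:
  assumes "sym R" "rconn R C" "a \<in> C" "D \<subseteq> C - {a}"
    and D: "\<And>u w. u \<in> D \<Longrightarrow> w \<in> C - {a} - D \<Longrightarrow> (u, w) \<notin> R"
  shows "rconn R (C - D)"
  unfolding rconn_def
proof (intro conjI allI impI)
  show "C - D \<noteq> {}" using assms by blast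
  have *: "\<exists>u\<in>U. \<exists>w\<in>C - D - U. (u, w) \<in> R" if U: "U \<subseteq> C - D" "U \<noteq> {}" "a \<notin> U" for U
  proof -
    obtain u w where uw: "u \<in> U" "w \<in> C - U" "(u, w) \<in> R"
      using rconnD[OF assms(2), of U] U assms(3) by blast
    have "w \<notin> D" using D[of w u] symD[OF assms(1) uw(3)] uw U by blast
    then show ?thesis using uw by blast
  qed
  fix U assume U: "U \<subset> C - D" "U \<noteq> {}"
  show "\<exists>u\<in>U. \<exists>w\<in>C - D - U. (u, w) \<in> R"
  proof (cases "a \<in> U")
    case False
    then show ?thesis using * U by blast
  next
    case True
    then obtain u w where "u \<in> C - D - U" "w \<in> C - D - (C - D - U)" "(u, w) \<in> R"
      using *[of "C - D - U"] U by blast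
    then show ?thesis using symD[OF assms(1)] by blast
  qed
qed

text \<open>Menger's theorem for two disjoint paths, with the paths grown to a partition of \<open>C\<close>.\<close>

lemma two_linked_partition:
  assumes "sym R" "finite C" "rconn R C" "A \<subseteq> C" "B \<subseteq> C" "A \<noteq> {}"
    and "\<And>x. x \<in> C \<Longrightarrow> \<exists>K\<subseteq>C - {x}. rconn R K \<and> K \<inter> A \<noteq> {} \<and> K \<inter> B \<noteq> {}"
  shows "\<exists>C1 C2. C1 \<union> C2 = C \<and> C1 \<inter> C2 = {} \<and> rconn R C1 \<and> rconn R C2 \<and>
    C1 \<inter> A \<noteq> {} \<and> C1 \<inter> B \<noteq> {} \<and> C2 \<inter> A \<noteq> {} \<and> C2 \<inter> B \<noteq> {}"
  using assms(2-)
proof (induction "card C" arbitrary: C A rule: less_induct)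
  case less
  note symR = \<open>sym R\<close>
  obtain a where a: "a \<in> A" using less.prems(5) by blast
  then have aC: "a \<in> C" using less.prems(3) by blast
  obtain K where K: "K \<subseteq> C - {a}" "rconn R K" "K \<inter> A \<noteq> {}" "K \<inter> B \<noteq> {}"
    using less.prems(6)[OF aC] by blast
  obtain D where D: "K \<subseteq> D" "D \<subseteq> C - {a}" "rconn R D"
    "\<And>u w. u \<in> D \<Longrightarrow> w \<in> C - {a} - D \<Longrightarrow> (u, w) \<notin> R"
    by (rule rconn_component[OF symR _ K(2,1)]) (use less.prems(1) in auto)
  have C2: "rconn R (C - D)" by (rule rconn_diff_component[OF symR less.prems(2) aC D(2,4)])
  \<comment> \<open>\<open>a\<close> lies in \<open>C - D\<close>, so if \<open>C - D\<close> also
    meets \<open>B\<close>, then \<open>D\<close> and \<open>C - D\<close> are already the two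
    parts.\<close>
  show ?case
  proof (cases "(C - D) \<inter> B = {}")
    case False
    then show ?thesis
      using C2 D(1-3) a aC K(3,4) by - (rule exI[of _ D], rule exI[of _ "C - D"], blast)
  next
    case True
    then have BD: "B \<subseteq> D" using less.prems(4) by blast
    \<comment> \<open>\<open>D\<close> can be entered from the rest of \<open>C\<close> only through
      \<open>a\<close>, so a connection that starts in \<open>A\<close> outside \<open>D\<close>
      continues inside \<open>D\<close> from a neighbour of \<open>a\<close>; these neighbours
      become additional starting points.\<close>
    define A' where "A' = (A \<inter> D) \<union> {w \<in> D. (a, w) \<in> R}"
    have edge_a: "u = a" if "u \<in> C - D" "w \<in> D" "(u, w) \<in> R" for u w
      using D(4)[of w u] symD[OF symR that(3)] that by blast
    have "\<exists>C1 C2. C1 \<union> C2 = D \<and> C1 \<inter> C2 = {} \<and> rconn R C1 \<and> rconn R C2 \<and>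
      C1 \<inter> A' \<noteq> {} \<and> C1 \<inter> B \<noteq> {} \<and> C2 \<inter> A' \<noteq> {} \<and> C2 \<inter> B \<noteq> {}"
    proof (rule less.hyps)
      show "card D < card C" using D(2) aC less.prems(1) by (intro psubset_card_mono) auto
      show "finite D" using D(2) less.prems(1) finite_subset by blast
      show "rconn R D" "A' \<subseteq> D" "B \<subseteq> D" using D(3) BD unfolding A'_def by auto
      show "A' \<noteq> {}" using K(3) D(1) unfolding A'_def by blast
      fix x assume "x \<in> D"
      then obtain K1 where K1: "K1 \<subseteq> C - {x}" "rconn R K1" "K1 \<inter> A \<noteq> {}" "K1 \<inter> B \<noteq> {}"
        using less.prems(6)[of x] D(2) by blast
      show "\<exists>K\<subseteq>D - {x}. rconn R K \<and> K \<inter> A' \<noteq> {} \<and> K \<inter> B \<noteq> {}"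
      proof (cases "K1 \<subseteq> D")
        case True
        then show ?thesis using K1 unfolding A'_def by - (rule exI[of _ K1], blast)
      next
        case False
        \<comment> \<open>The piece of \<open>K1\<close> inside \<open>D\<close> around a point of
          \<open>B\<close> can be left only towards \<open>a\<close>, so it contains a neighbour of
          \<open>a\<close>, which is a point of \<open>A'\<close>.\<close>
        obtain b where b: "b \<in> K1" "b \<in> B" using K1 by blast
        obtain E where E: "{b} \<subseteq> E" "E \<subseteq> K1 \<inter> D" "rconn R E"
          "\<And>u w. u \<in> E \<Longrightarrow> w \<in> K1 \<inter> D - E \<Longrightarrow> (u, w) \<notin> R"
        proof (rule rconn_component[OF symR _ rconn_singleton, of "K1 \<inter> D" b])
          have "finite K1" using K1(1) less.prems(1) by (meson finite_Diff finite_subset)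
          then show "finite (K1 \<inter> D)" by simp
          show "{b} \<subseteq> K1 \<inter> D" using b BD by blast
        qed blast
        obtain u w where uw: "u \<in> E" "w \<in> K1 - E" "(u, w) \<in> R"
        proof (rule rconnD[OF K1(2), of E])
          show "E \<subseteq> K1" "E \<noteq> {}" "E \<noteq> K1" using E(1,2) False by blast+
        qed blast
        have wu: "(w, u) \<in> R" by (rule symD[OF symR uw(3)])
        have "w \<in> C - D" using E(4)[of u w] uw K1(1) by blast
        then have "w = a" using edge_a[of w u] wu uw(1) E(2) by blast
        then have "u \<in> A'" using uw(1) E(2) wu unfolding A'_def by blast
        then show ?thesis using E(1-3) uw(1) b K1(1) by - (rule exI[of _ E], blast)
      qed
    qed
    then obtain D1 D2 where D12: "D1 \<union> D2 = D" "D1 \<inter> D2 = {}" "rconn R D1" "rconn R D2"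
      "D1 \<inter> A' \<noteq> {}" "D1 \<inter> B \<noteq> {}" "D2 \<inter> A' \<noteq> {}" "D2 \<inter> B \<noteq> {}" by blast
    \<comment> \<open>The part that reaches \<open>a\<close> absorbs \<open>C - D\<close> and
      thereby \<open>a\<close> itself, a point of \<open>A\<close>; the other part has to bring its
      own point of \<open>A\<close>.\<close>
    have build: ?thesis if D12: "D1 \<union> D2 = D" "D1 \<inter> D2 = {}" "rconn R D1" "rconn R D2"
      "D1 \<inter> B \<noteq> {}" "D2 \<inter> B \<noteq> {}" "D1 \<inter> A \<noteq> {}" "w \<in> D2" "(a, w) \<in> R" for D1 D2 w
    proof -
      have "rconn R ((C - D) \<union> D2)"
        by (rule rconn_union[OF symR C2 D12(4) _ D12(8,9)]) (use D aC in blast)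
      moreover have "D \<subseteq> C" "a \<in> C - D" using D(2) aC by blast+
      ultimately show ?thesis
        using D12(1-3,5-7) a by - (rule exI[of _ D1], rule exI[of _ "(C - D) \<union> D2"], blast)
    qed
    obtain u w where "u \<in> C - D" "w \<in> C - (C - D)" "(u, w) \<in> R"
    proof (rule rconnD[OF less.prems(2), of "C - D"])
      show "C - D \<subseteq> C" "C - D \<noteq> {}" "C - D \<noteq> C"
        using rconn_nonempty[OF D(3)] D(2) aC by blast+
    qed blast
    then have w: "w \<in> D" "(a, w) \<in> R" using edge_a[of u w] by blast+
    \<comment> \<open>\<open>A\<close> meets \<open>D\<close> and \<open>a\<close> has a neighbour
      in \<open>D\<close>. As both parts meet \<open>A'\<close>, one can contribute a point of
      \<open>A\<close> and the other a neighbour of \<open>a\<close>.\<close>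
    consider "D1 \<inter> A \<noteq> {}" "\<exists>w\<in>D2. (a, w) \<in> R" | "D2 \<inter> A \<noteq> {}" "\<exists>w\<in>D1. (a, w) \<in> R"
      using D12(1,5,7) w K(3) D(1) unfolding A'_def by blast
    then show ?thesis
    proof cases
      case 1
      then show ?thesis using build[of D1 D2] D12(1-4,6,8) by blast
    next
      case 2
      moreover have "D2 \<union> D1 = D" "D2 \<inter> D1 = {}" using D12(1,2) by blast+
      ultimately show ?thesis using build[of D2 D1] D12(3,4,6,8) by blast
    qed
  qed
qed

text \<open>Branch sets of a \<open>K4\<close> minor, indexed by the vertices of \<open>K4\<close>.
  Working with a relation lets the combinatorial argument ignore edges and their
  multiplicities.\<close>

definition K4_model :: "'a rel \<Rightarrow> 'a set \<Rightarrow> (nat \<Rightarrow> 'a set) \<Rightarrow> bool" where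
  "K4_model R V B \<longleftrightarrow> (\<forall>i<4. B i \<subseteq> V \<and> rconn R (B i)) \<and>
     (\<forall>i<4. \<forall>j<4. i \<noteq> j \<longrightarrow> B i \<inter> B j = {} \<and> (\<exists>u\<in>B i. \<exists>w\<in>B j. (u, w) \<in> R))"

lemma K4_model_mono:
  assumes "K4_model R V B" "V \<subseteq> V'"
  shows "K4_model R V' B"
proof -
  have "B i \<subseteq> V'" if "i < 4" for i using assms that unfolding K4_model_def by blast
  then show ?thesis using assms(1) unfolding K4_model_def by simp
qed

definition joined :: "'a rel \<Rightarrow> 'a set \<Rightarrow> 'a set \<Rightarrow> bool" where
  "joined R S T \<longleftrightarrow> (\<exists>u\<in>S. \<exists>w\<in>T. (u, w) \<in> R)"

lemma joined_commute: "sym R \<Longrightarrow> joined R S T \<longleftrightarrow> joined R T S"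
  unfolding joined_def sym_def by blast

lemma K4_modelI:
  assumes "sym R" "rconn R S" "rconn R T" "rconn R C" "rconn R D"
    and "S \<subseteq> V" "T \<subseteq> V" "C \<subseteq> V" "D \<subseteq> V"
    and "S \<inter> T = {}" "S \<inter> C = {}" "S \<inter> D = {}" "T \<inter> C = {}" "T \<inter> D = {}" "C \<inter> D = {}"
    and "joined R S T" "joined R S C" "joined R S D" "joined R T C" "joined R T D" "joined R C D"
  shows "K4_model R V (\<lambda>i. [S, T, C, D] ! i)"
proof -
  have all4: "(\<forall>i<4. Q i) \<longleftrightarrow> Q 0 \<and> Q 1 \<and> Q 2 \<and> Q 3" for Q :: "nat \<Rightarrow> bool"
    by (auto simp: eval_nat_numeral less_Suc_eq)
  show ?thesis
    unfolding K4_model_def joined_def[symmetric] all4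
    using assms(2-) joined_commute[OF assms(1), of T S] joined_commute[OF assms(1), of C S]
      joined_commute[OF assms(1), of D S] joined_commute[OF assms(1), of C T]
      joined_commute[OF assms(1), of D T] joined_commute[OF assms(1), of D C]
    by (simp add: Int_commute)
qed

text \<open>\<open>S\<close> and \<open>T\<close> play the role of two adjacent vertices exempt from the degree condition; since the
  induction contracts, they have to be sets.\<close>

lemma rooted_degree_three_K4_model:
  assumes "sym R" "finite W" "W \<noteq> {}" "rconn R S" "rconn R T" "S \<inter> T = {}" "W \<inter> (S \<union> T) = {}"
    "joined R S T"
    "\<And>w. w \<in> W \<Longrightarrow> 3 \<le> card (R `` {w} \<inter> W) + of_bool (joined R {w} S) + of_bool (joined R {w} T)"
    "\<And>w. w \<in> W \<Longrightarrow> (w, w) \<notin> R"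
  shows "\<exists>B. K4_model R (W \<union> S \<union> T) B"
  using assms(2-)
proof (induction "card W" arbitrary: W S T rule: less_induct)
  case less
  note symR = \<open>sym R\<close>
  have mono: "\<exists>B. K4_model R (W \<union> S \<union> T) B" if "\<exists>B. K4_model R V B" "V \<subseteq> W \<union> S \<union> T" for V
    using that K4_model_mono by blast
  obtain c where c: "c \<in> W" using less.prems(2) by blast
  obtain C where C: "{c} \<subseteq> C" "C \<subseteq> W" "rconn R C" "\<And>u w. u \<in> C \<Longrightarrow> w \<in> W - C \<Longrightarrow> (u, w) \<notin> R"
    by (rule rconn_component[OF symR less.prems(1) rconn_singleton, of c]) (use c in auto)
  have finC: "finite C" by (rule finite_subset[OF C(2) less.prems(1)])
  have deg: "3 \<le> card (R `` {w} \<inter> C) + of_bool (joined R {w} S) + of_bool (joined R {w} T)"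
    if "w \<in> C" for w
  proof -
    have "R `` {w} \<inter> C = R `` {w} \<inter> W" using C(2) C(4)[OF that] by blast
    then show ?thesis using less.prems(8)[of w] C(2) that by auto
  qed
  have irr: "(w, w) \<notin> R" if "w \<in> C" for w using less.prems(9)[of w] C(2) that by blast
  have nbr: "\<exists>y\<in>C. (x, y) \<in> R \<and> y \<noteq> x" if "x \<in> C" for x
  proof -
    have "of_bool (joined R {x} S) + of_bool (joined R {x} T) \<le> (2::nat)" by simp
    then have "card (R `` {x} \<inter> C) \<noteq> 0" using deg[OF that] by linarith
    then have "R `` {x} \<inter> C \<noteq> {}" by auto
    then show ?thesis using irr[OF that] by blast
  qed
  \<comment> \<open>the induction hypothesis, for a part \<open>D\<close> of \<open>C\<close> meeting the rest of \<open>C\<close> in one new root\<close>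
  have step: ?case if D: "D \<subset> C" "D \<noteq> {}" and S': "rconn R S'" and T': "rconn R T'"
    and ST: "S' \<inter> T' = {}" "D \<inter> (S' \<union> T') = {}" "joined R S' T'" "S' \<union> T' \<subseteq> W \<union> S \<union> T"
    and degD: "\<And>w. w \<in> D \<Longrightarrow>
      3 \<le> card (R `` {w} \<inter> D) + of_bool (joined R {w} S') + of_bool (joined R {w} T')"
    for D S' T'
  proof -
    have 1: "card D < card W" using D(1) C(2) by (intro psubset_card_mono[OF less.prems(1)]) auto
    have 2: "finite D" using D(1) finC finite_subset by blast
    have 3: "(w, w) \<notin> R" if "w \<in> D" for w using irr[of w] that D(1) by blast
    have "\<exists>B. K4_model R (D \<union> S' \<union> T') B"
      by (rule less.hyps[OF 1 2 D(2) S' T' ST(1-3) degD 3])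
    moreover have "D \<union> S' \<union> T' \<subseteq> W \<union> S \<union> T" using D(1) ST(4) C(2) by blast
    ultimately show ?thesis by (rule mono)
  qed
  \<comment> \<open>A vertex that has at most one neighbour \<open>x\<close> in \<open>C\<close>
    outside \<open>D\<close> loses at most 1 in degree, and the loss is made up because
    \<open>x\<close> now belongs to the root \<open>S'\<close>.\<close>
  have drop: "card (R `` {w} \<inter> C) \<le> card (R `` {w} \<inter> D) + of_bool (joined R {w} S')"
    if "R `` {w} \<inter> C \<subseteq> insert x D" "D \<subseteq> C" "x \<in> S'" for w x D S'
  proof -
    have fin: "finite (R `` {w} \<inter> D)" using finite_subset[OF that(2) finC] by simp
    show ?thesis
    proof (cases "joined R {w} S'")
      case True
      have "card (R `` {w} \<inter> C) \<le> card (insert x (R `` {w} \<inter> D))"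
        using that fin by (intro card_mono) auto
      also have "\<dots> \<le> card (R `` {w} \<inter> D) + 1" using fin by (simp add: card_insert_if)
      finally show ?thesis using True by simp
    next
      case False
      then have "R `` {w} \<inter> C \<subseteq> R `` {w} \<inter> D" using that unfolding joined_def by blast
      then show ?thesis using fin by (simp add: card_mono trans_le_add1)
    qed
  qed
  define A where "A = {w \<in> C. joined R {w} S}"
  define B where "B = {w \<in> C. joined R {w} T}"
  \<comment> \<open>\<open>S\<close> and \<open>T\<close> are interchangeable\<close>
  define roots where "roots S1 T1 \<longleftrightarrow> (S1, T1) = (S, T) \<or> (S1, T1) = (T, S)" for S1 T1
  have roots: "rconn R S1" "rconn R T1" "S1 \<inter> T1 = {}" "W \<inter> S1 = {}" "W \<inter> T1 = {}" "joined R S1 T1"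
    "S1 \<subseteq> S \<union> T" "T1 \<subseteq> S \<union> T"
    "\<And>w. w \<in> C \<Longrightarrow> 3 \<le> card (R `` {w} \<inter> C) + of_bool (joined R {w} S1) + of_bool (joined R {w} T1)"
    if "roots S1 T1" for S1 T1
  proof -
    have c: "joined R T S" using less.prems(7) joined_commute[OF symR, of S T] by blast
    have d: "3 \<le> card (R `` {w} \<inter> C) + of_bool (joined R {w} T) + of_bool (joined R {w} S)"
      if "w \<in> C" for w using deg[OF that] by simp
    show "rconn R S1" "rconn R T1" using that less.prems(3,4) unfolding roots_def by blast+
    show "S1 \<inter> T1 = {}" "W \<inter> S1 = {}" "W \<inter> T1 = {}" "S1 \<subseteq> S \<union> T" "T1 \<subseteq> S \<union> T"
      using that less.prems(5,6) unfolding roots_def by blast+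
    show "joined R S1 T1" using that c less.prems(7) unfolding roots_def by blast
    show "3 \<le> card (R `` {w} \<inter> C) + of_bool (joined R {w} S1) + of_bool (joined R {w} T1)"
      if "w \<in> C" for w using \<open>roots S1 T1\<close> d[OF that] deg[OF that] unfolding roots_def by auto
  qed
  \<comment> \<open>A root \<open>S1\<close> without neighbours in \<open>C\<close> contributes to
    no degree and can be replaced: by a neighbour \<open>x\<close> of the other root or, if neither
    root has neighbours in \<open>C\<close>, the two roots together by the ends of an edge inside
    \<open>C\<close>.\<close>
  have missing: ?case if rt: "roots S1 T1" and no: "\<And>w. w \<in> C \<Longrightarrow> \<not> joined R {w} S1" for S1 T1
  proof (cases "\<exists>x\<in>C. joined R {x} T1")
    case True
    then obtain x where x: "x \<in> C" "joined R {x} T1" by blast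
    obtain y where y: "y \<in> C" "y \<noteq> x" using nbr[of x] x by blast
    have xW: "x \<in> W" using x C(2) by blast
    show ?thesis
    proof (rule step[of "C - {x}" "{x}" T1])
      fix w assume w: "w \<in> C - {x}"
      have "card (R `` {w} \<inter> C) \<le> card (R `` {w} \<inter> (C - {x})) + of_bool (joined R {w} {x})"
        by (rule drop[of w x]) auto
      then show "3 \<le> card (R `` {w} \<inter> (C - {x})) + of_bool (joined R {w} {x}) + of_bool (joined R {w} T1)"
        using roots(9)[OF rt, of w] no[of w] w by (simp del: of_bool_eq_1_iff)
    next
      show "C - {x} \<subset> C" "C - {x} \<noteq> {}" using x y by blast+
      show "rconn R T1" "joined R {x} T1" using roots(2)[OF rt] x(2) by blast+
      show "{x} \<inter> T1 = {}" "(C - {x}) \<inter> ({x} \<union> T1) = {}" "{x} \<union> T1 \<subseteq> W \<union> S \<union> T"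
        using roots(5,8)[OF rt] xW C(2) by blast+
    qed (rule rconn_singleton)
  next
    case False
    obtain y where y: "y \<in> C" "(c, y) \<in> R" "y \<noteq> c"
      using nbr[of c] C(1) by blast
    have deg': "3 \<le> card (R `` {w} \<inter> C)" if "w \<in> C" for w
      using roots(9)[OF rt, of w] no[of w] False that by auto
    show ?thesis
    proof (rule step[of "C - {c, y}" "{c}" "{y}"])
      show "joined R {c} {y}" using y by (simp add: joined_def)
      show "C - {c, y} \<noteq> {}"
      proof
        assume "C - {c, y} = {}"
        then have "R `` {c} \<inter> C \<subseteq> {c, y}" by blast
        then have "card (R `` {c} \<inter> C) \<le> card {c, y}" by (rule card_mono[rotated]) simp
        then show False using deg'[of c] C(1) y(3) by simp
      qed
      fix w assume w: "w \<in> C - {c, y}"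
      have dc: "card (R `` {w} \<inter> C) \<le> card (R `` {w} \<inter> (C - {c})) + of_bool (joined R {w} {c})"
        by (rule drop[of w c]) auto
      have "card (R `` {w} \<inter> (C - {c})) \<le> card (R `` {w} \<inter> (C - {c, y})) + of_bool (joined R {w} {y})"
      proof (cases "(w, y) \<in> R")
        case True
        have "R `` {w} \<inter> (C - {c}) \<subseteq> insert y (R `` {w} \<inter> (C - {c, y}))" by blast
        then have "card (R `` {w} \<inter> (C - {c})) \<le> card (insert y (R `` {w} \<inter> (C - {c, y})))"
          using finC by (intro card_mono) auto
        then show ?thesis using True finC by (simp add: joined_def card_insert_if split: if_splits)
      next
        case False
        then have "R `` {w} \<inter> (C - {c}) = R `` {w} \<inter> (C - {c, y})" by blast
        then show ?thesis by simp
      qed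
      then show "3 \<le> card (R `` {w} \<inter> (C - {c, y})) + of_bool (joined R {w} {c}) + of_bool (joined R {w} {y})"
        using dc deg'[of w] w by simp
    next
      show "C - {c, y} \<subset> C" "{c} \<inter> {y} = {}" "(C - {c, y}) \<inter> ({c} \<union> {y}) = {}"
        "{c} \<union> {y} \<subseteq> W \<union> S \<union> T" using y C(1,2) by blast+
    qed (rule rconn_singleton)+
  qed
  \<comment> \<open>\<open>x\<close> separates \<open>D\<close> from the rest of \<open>C\<close>,
    and \<open>S1\<close> has no neighbours in \<open>D\<close>. Merging \<open>C - D\<close> into
    \<open>S1\<close> gives a connected root that \<open>D\<close> sees only through
    \<open>x\<close>, so a degree loses at most the one neighbour \<open>x\<close> and regains it
    from the new root.\<close>
  have split: ?case if rt: "roots S1 T1" and x: "x \<in> C" and D: "D \<noteq> {}" "D \<subseteq> C - {x}"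
      "\<And>u w. u \<in> D \<Longrightarrow> w \<in> C - {x} - D \<Longrightarrow> (u, w) \<notin> R"
      and DS: "\<And>w. w \<in> D \<Longrightarrow> \<not> joined R {w} S1" and a: "a \<in> C" "joined R {a} S1"
    for S1 T1 x D a
  proof (rule step[of D "C - D \<union> S1" T1])
    obtain s where s: "s \<in> S1" "(a, s) \<in> R" using a unfolding joined_def by blast
    show "rconn R (C - D \<union> S1)"
      by (rule rconn_union[OF symR rconn_diff_component[OF symR C(3) x D(2,3)] roots(1)[OF rt] _ s])
        (use a DS in auto)
    show "joined R (C - D \<union> S1) T1" using roots(6)[OF rt] unfolding joined_def by blast
    fix w assume w: "w \<in> D"
    have "card (R `` {w} \<inter> C) \<le> card (R `` {w} \<inter> D) + of_bool (joined R {w} (C - D \<union> S1))"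
      by (rule drop[of w x]) (use D(2) D(3)[OF w] x in blast)+
    moreover have "w \<in> C" using w D(2) by blast
    ultimately
    show "3 \<le> card (R `` {w} \<inter> D) + of_bool (joined R {w} (C - D \<union> S1)) + of_bool (joined R {w} T1)"
      using roots(9)[OF rt, of w] DS[OF w] by simp
  next
    show "D \<subset> C" "D \<noteq> {}" using D(1,2) x by blast+
    show "rconn R T1" by (rule roots(2)[OF rt])
    show "(C - D \<union> S1) \<inter> T1 = {}" "D \<inter> (C - D \<union> S1 \<union> T1) = {}"
      "C - D \<union> S1 \<union> T1 \<subseteq> W \<union> S \<union> T"
      using roots(3-5,7,8)[OF rt] D(2) C(2) by blast+
  qed
  consider "A = {}" | "B = {}" | "A \<noteq> {}" "B \<noteq> {}" by blast
  then show ?case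
  proof cases
    case 1
    then show ?thesis using missing[of S T] unfolding A_def roots_def by blast
  next
    case 2
    then show ?thesis using missing[of T S] unfolding B_def roots_def by blast
  next
    case 3
    obtain a b where a: "a \<in> C" "joined R {a} S" and b: "b \<in> C" "joined R {b} T"
      using 3 unfolding A_def B_def by blast
    show ?thesis
    proof (cases "\<forall>x\<in>C. \<exists>K\<subseteq>C - {x}. rconn R K \<and> K \<inter> A \<noteq> {} \<and> K \<inter> B \<noteq> {}")
      case False
      then obtain x where x: "x \<in> C"
        "\<not> (\<exists>K\<subseteq>C - {x}. rconn R K \<and> K \<inter> A \<noteq> {} \<and> K \<inter> B \<noteq> {})" by auto
      \<comment> \<open>No connected set avoiding \<open>x\<close> meets both \<open>A\<close> and
        \<open>B\<close>, so a component of \<open>C - {x}\<close> misses the neighbours of one of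
        the roots; \<open>x\<close> is the cut vertex.\<close>
      obtain y where y: "y \<in> C - {x}" using nbr[OF x(1)] by blast
      obtain D where D: "{y} \<subseteq> D" "D \<subseteq> C - {x}" "rconn R D"
        "\<And>u w. u \<in> D \<Longrightarrow> w \<in> C - {x} - D \<Longrightarrow> (u, w) \<notin> R"
        by (rule rconn_component[OF symR _ rconn_singleton, of "C - {x}" y]) (use finC y in auto)
      have "D \<noteq> {}" using D(1) by blast
      consider "D \<inter> A = {}" | "D \<inter> B = {}" using x(2) D(2,3) by metis
      then show ?thesis
      proof cases
        case 1
        then have "\<not> joined R {w} S" if "w \<in> D" for w using that D(2) unfolding A_def by blast
        then show ?thesis
          by (intro split[of S T x D a] x(1) a D(2,4) \<open>D \<noteq> {}\<close>) (simp_all add: roots_def)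
      next
        case 2
        then have "\<not> joined R {w} T" if "w \<in> D" for w using that D(2) unfolding B_def by blast
        then show ?thesis
          by (intro split[of T S x D b] x(1) b D(2,4) \<open>D \<noteq> {}\<close>) (simp_all add: roots_def)
      qed
    next
      case True
      then obtain C1 C2 where P: "C1 \<union> C2 = C" "C1 \<inter> C2 = {}" "rconn R C1" "rconn R C2"
        "C1 \<inter> A \<noteq> {}" "C1 \<inter> B \<noteq> {}" "C2 \<inter> A \<noteq> {}" "C2 \<inter> B \<noteq> {}"
        using two_linked_partition[OF symR finC C(3), of A B] 3 unfolding A_def B_def by blast
      \<comment> \<open>The four branch sets are the two roots and the two parts. The parts are
        joined to each other because \<open>C\<close> is connected, and to the roots because each
        meets \<open>A\<close> and \<open>B\<close>.\<close>
      have "C - C1 = C2" using P by blast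
      moreover have "C1 \<subseteq> C" "C1 \<noteq> {}" "C1 \<noteq> C" using P by blast+
      ultimately have "joined R C1 C2"
        using rconnD[OF C(3), of C1] unfolding joined_def by metis
      moreover have "joined R S C'" "joined R T C'" if "C' = C1 \<or> C' = C2" for C'
      proof -
        have "joined R C' S" "joined R C' T"
          using that P(5-8) unfolding A_def B_def joined_def by blast+
        then show "joined R S C'" "joined R T C'"
          using joined_commute[OF symR] by blast+
      qed
      moreover have "S \<inter> C' = {}" "T \<inter> C' = {}" "C' \<subseteq> W \<union> S \<union> T" if "C' \<subseteq> C" for C'
        using that C(2) less.prems(6) by blast+
      moreover have "C1 \<subseteq> C" "C2 \<subseteq> C" using P(1) by blast+
      ultimately have "K4_model R (W \<union> S \<union> T) (\<lambda>i. [S, T, C1, C2] ! i)"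
        using P(2-4) less.prems(3-5,7) by (intro K4_modelI[OF symR]) auto
      then show ?thesis by blast
    qed
  qed
qed

section \<open>From models of \<open>K4\<close> to \<open>K4\<close> minors of multigraphs\<close>

lemma sym_adj: "sym (adj G)"
  by (auto simp: sym_def adj_def insert_commute)

lemma multigraphD:
  assumes "multigraph G" "f \<in> edges G"
  shows "ends G f \<subseteq> verts G" "card (ends G f) = 1 \<or> card (ends G f) = 2"
  using assms unfolding multigraph_def by auto

lemma multigraph_ends_cases:
  assumes "multigraph G" "f \<in> edges G"
  obtains x y where "ends G f = {x, y}" "x \<in> verts G" "y \<in> verts G"
proof -
  have "\<exists>x y. ends G f = {x, y}"
    using multigraphD(2)[OF assms] by (metis card_1_singletonE card_2_iff insert_absorb2)
  then show ?thesis using that multigraphD(1)[OF assms] by blast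
qed

lemma multigraph_delete_vertex: "multigraph G \<Longrightarrow> multigraph (delete_vertex v G)"
  by (auto simp: multigraph_def delete_vertex_def)

lemma multigraph_delete_edge: "multigraph G \<Longrightarrow> multigraph (delete_edge f G)"
  by (auto simp: multigraph_def delete_edge_def)

lemma multigraph_contract_edge:
  assumes "multigraph G" "u \<in> verts G" "u \<noteq> v"
  shows "multigraph (contract_edge f u v G)"
  unfolding multigraph_def
proof (intro conjI ballI)
  let ?\<sigma> = "\<lambda>x. if x = v then u else x"
  show "finite (verts (contract_edge f u v G))" "finite (edges (contract_edge f u v G))"
    using assms(1) by (auto simp: multigraph_def contract_edge_def)
  fix g assume "g \<in> edges (contract_edge f u v G)"
  then have g: "g \<in> edges G" by (simp add: contract_edge_def)
  obtain x y where xy: "ends G g = {x, y}" "x \<in> verts G" "y \<in> verts G"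
    using multigraph_ends_cases[OF assms(1) g] .
  show "ends (contract_edge f u v G) g \<subseteq> verts (contract_edge f u v G)"
    using xy assms by (auto simp: contract_edge_def)
  show "card (ends (contract_edge f u v G) g) \<in> {1, 2}"
  proof -
    have "ends (contract_edge f u v G) g = {?\<sigma> x, ?\<sigma> y}" by (simp add: contract_edge_def xy(1))
    then show ?thesis by (simp add: card_insert_if del: if_image_distrib)
  qed
qed

lemma adj_contract_edge:
  assumes "(x, y) \<in> adj G" "ends G f = {u, v}"
    "(if x = v then u else x) \<noteq> (if y = v then u else y)"
  shows "((if x = v then u else x), (if y = v then u else y)) \<in> adj (contract_edge f u v G)"
proof -
  obtain g where g: "g \<in> edges G" "ends G g = {x, y}" using assms(1) by (auto simp: adj_def)
  have gf: "g \<noteq> f"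
    using g(2) assms(2,3) by (auto simp: doubleton_eq_iff split: if_splits)
  have "ends (contract_edge f u v G) g = {if x = v then u else x, if y = v then u else y}"
    by (simp add: contract_edge_def g(2))
  moreover have "g \<in> edges (contract_edge f u v G)" using g(1) gf by (simp add: contract_edge_def)
  ultimately show ?thesis unfolding adj_def by blast
qed

lemma rconn_mono:
  assumes "rconn R K" "\<And>x y. x \<in> K \<Longrightarrow> y \<in> K \<Longrightarrow> (x, y) \<in> R \<Longrightarrow> (x, y) \<in> R'"
  shows "rconn R' K"
  unfolding rconn_def
proof (intro conjI allI impI)
  show "K \<noteq> {}" using assms(1) rconn_nonempty by blast
  fix U assume U: "U \<subset> K" "U \<noteq> {}"
  obtain x y where "x \<in> U" "y \<in> K - U" "(x, y) \<in> R"
    by (rule rconnD[OF assms(1), of U]) (use U in auto)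
  then show "\<exists>u\<in>U. \<exists>w\<in>K - U. (u, w) \<in> R'" using assms(2)[of x y] U by blast
qed

lemma rconn_image:
  assumes "rconn R K"
    and "\<And>x y. x \<in> K \<Longrightarrow> y \<in> K \<Longrightarrow> (x, y) \<in> R \<Longrightarrow> \<sigma> x \<noteq> \<sigma> y \<Longrightarrow> (\<sigma> x, \<sigma> y) \<in> R'"
  shows "rconn R' (\<sigma> ` K)"
  unfolding rconn_def
proof (intro conjI allI impI)
  show "\<sigma> ` K \<noteq> {}" using assms(1) rconn_nonempty by blast
  fix U assume U: "U \<subset> \<sigma> ` K" "U \<noteq> {}"
  obtain x y where xy: "x \<in> K \<inter> \<sigma> -` U" "y \<in> K - K \<inter> \<sigma> -` U" "(x, y) \<in> R"
  proof (rule rconnD[OF assms(1), of "K \<inter> \<sigma> -` U"])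
    show "K \<inter> \<sigma> -` U \<noteq> {}" "K \<inter> \<sigma> -` U \<noteq> K" using U by blast+
  qed auto
  then have "\<sigma> x \<noteq> \<sigma> y" by auto
  then have "(\<sigma> x, \<sigma> y) \<in> R'" using assms(2)[of x y] xy by blast
  then show "\<exists>u\<in>U. \<exists>w\<in>\<sigma> ` K - U. (u, w) \<in> R'" using xy by blast
qed

lemma minor_steps_delete_edges:
  assumes "finite D" "D \<subseteq> edges G"
  shows "minor_step\<^sup>*\<^sup>* G (G\<lparr>edges := edges G - D\<rparr>)"
  using assms
proof (induction D)
  case empty
  then show ?case by simp
next
  case (insert f D)
  let ?H = "G\<lparr>edges := edges G - D\<rparr>"
  have "minor_step\<^sup>*\<^sup>* G ?H" using insert.IH insert.prems by blast
  moreover have "minor_step ?H (delete_edge f ?H)" by (rule del_edge) (use insert.hyps insert.prems in simp)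
  moreover have "delete_edge f ?H = G\<lparr>edges := edges G - insert f D\<rparr>"
    by (simp add: delete_edge_def Diff_insert[of "edges G" f D])
  ultimately show ?case by (metis rtranclp.rtrancl_into_rtrancl)
qed

lemma has_minor_step: "minor_step G G' \<Longrightarrow> has_minor G' H \<Longrightarrow> has_minor G H"
  unfolding has_minor_def by (meson converse_rtranclp_into_rtranclp)

text \<open>Each vertex outside the branch sets is deleted, and an edge inside a branch set with two
  or more vertices is contracted; both lower the number of vertices. When the branch sets are four
  single vertices covering the graph, only edges remain to be deleted.\<close>

lemma K4_model_has_minor:
  assumes "multigraph G" "K4_model (adj G) (verts G) B"
  shows "has_minor G K4"
  using assms
proof (induction "card (verts G)" arbitrary: G B rule: less_induct)
  case less
  have fin: "finite (verts G)" using less.prems(1) by (simp add: multigraph_def)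
  have Bv: "B i \<subseteq> verts G" and Bc: "rconn (adj G) (B i)" if "i < 4" for i
    using less.prems(2) that unfolding K4_model_def by auto
  have Bd: "B i \<inter> B j = {}" and Ba: "\<exists>u\<in>B i. \<exists>w\<in>B j. (u, w) \<in> adj G"
    if "i < 4" "j < 4" "i \<noteq> j" for i j
    using less.prems(2) that unfolding K4_model_def by auto
  consider (outside) "\<exists>v\<in>verts G. \<forall>i<4. v \<notin> B i" | (big) "\<exists>i<4. \<exists>x\<in>B i. \<exists>y\<in>B i. x \<noteq> y"
    | (spanning) "\<forall>v\<in>verts G. \<exists>i<4. v \<in> B i" "\<forall>i<4. \<forall>x\<in>B i. \<forall>y\<in>B i. x = y"
    by meson
  then show ?case
  proof cases
    case outside
    then obtain v where 1: "v \<in> verts G" "\<And>i. i < 4 \<Longrightarrow> v \<notin> B i" by auto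
    let ?H = "delete_vertex v G"
    have adj: "(x, y) \<in> adj ?H" if "(x, y) \<in> adj G" "x \<noteq> v" "y \<noteq> v" for x y
      using that by (auto simp: adj_def delete_vertex_def)
    have "K4_model (adj ?H) (verts ?H) B"
      unfolding K4_model_def
    proof (intro conjI allI impI)
      fix i :: nat assume i: "i < 4"
      show "B i \<subseteq> verts ?H" using Bv[OF i] 1(2)[OF i] by (auto simp: delete_vertex_def)
      show "rconn (adj ?H) (B i)"
        by (rule rconn_mono[OF Bc[OF i]]) (use adj 1(2)[OF i] in blast)
      fix j :: nat assume j: "j < 4" "i \<noteq> j"
      show "B i \<inter> B j = {}" using Bd i j by blast
      show "\<exists>u\<in>B i. \<exists>w\<in>B j. (u, w) \<in> adj ?H"
        using Ba[OF i j] adj 1(2)[OF i] 1(2)[OF j(1)] by blast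
    qed
    moreover have "card (verts ?H) < card (verts G)"
      using card_Diff1_less[OF fin 1(1)] by (simp add: delete_vertex_def)
    ultimately have "has_minor ?H K4"
      using less.hyps multigraph_delete_vertex[OF less.prems(1)] by blast
    then show ?thesis by (rule has_minor_step[OF del_vertex[OF 1(1)]])
  next
    case big
    then obtain i x y where 2: "i < 4" "x \<in> B i" "y \<in> B i" "x \<noteq> y" by auto
    have s: "{x} \<subseteq> B i" "{x} \<noteq> {}" "{x} \<noteq> B i" using 2 by auto
    obtain u v where uv: "u \<in> {x}" "v \<in> B i - {x}" "(u, v) \<in> adj G"
      using rconnD[OF Bc[OF 2(1)] s] by blast
    obtain f where f: "f \<in> edges G" "ends G f = {u, v}" using uv(3) by (auto simp: adj_def)
    have uvB: "u \<in> B i" "v \<in> B i" "u \<noteq> v" using uv(1,2) 2(2) by auto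
    let ?H = "contract_edge f u v G"
    let ?\<sigma> = "\<lambda>x. if x = v then u else x"
    have model: "K4_model (adj ?H) (verts ?H) (\<lambda>j. ?\<sigma> ` B j)"
      unfolding K4_model_def
    proof (intro conjI allI impI)
      fix j :: nat assume j: "j < 4"
      show "?\<sigma> ` B j \<subseteq> verts ?H"
        using Bv[OF j] Bv[OF 2(1)] uvB by (auto simp: contract_edge_def)
      show "rconn (adj ?H) (?\<sigma> ` B j)"
        by (rule rconn_image[OF Bc[OF j]]) (use adj_contract_edge[OF _ f(2)] in blast)
      fix k :: nat assume k: "k < 4" "j \<noteq> k"
      \<comment> \<open>Both merged vertices belong to \<open>B i\<close> alone, so the contraction
        keeps the branch sets disjoint.\<close>
      have *: "l = i" if "l < 4" "u \<in> B l \<or> v \<in> B l" for l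
        using Bd[OF that(1) 2(1)] that(2) uvB by blast
      show d: "?\<sigma> ` B j \<inter> ?\<sigma> ` B k = {}"
      proof (rule ccontr)
        assume "\<not> ?thesis"
        then obtain a b where "a \<in> B j" "b \<in> B k" "?\<sigma> a = ?\<sigma> b" by blast
        then show False using Bd[OF j k] *[OF j] *[OF k(1)] k(2) by (auto split: if_splits)
      qed
      obtain a b where ab: "a \<in> B j" "b \<in> B k" "(a, b) \<in> adj G" using Ba[OF j k] by blast
      have "?\<sigma> a \<noteq> ?\<sigma> b" using d ab by blast
      then have "(?\<sigma> a, ?\<sigma> b) \<in> adj ?H" by (rule adj_contract_edge[OF ab(3) f(2)])
      then show "\<exists>u\<in>?\<sigma> ` B j. \<exists>w\<in>?\<sigma> ` B k. (u, w) \<in> adj ?H" using ab by blast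
    qed
    have "v \<in> verts G" using Bv[OF 2(1)] uvB by blast
    then have c: "card (verts ?H) < card (verts G)"
      using card_Diff1_less[OF fin, of v] by (simp add: contract_edge_def)
    have u: "u \<in> verts G" using Bv[OF 2(1)] uvB by blast
    have "has_minor ?H K4"
      by (rule less.hyps[OF c multigraph_contract_edge[OF less.prems(1) u uvB(3)] model])
    then show ?thesis by (rule has_minor_step[OF contract[OF f uvB(3)]])
  next
    case spanning
    have "\<exists>b. \<forall>i<4. B i = {b i}"
    proof -
      have "\<exists>x. B i = {x}" if "i < 4" for i
        using rconn_nonempty[OF Bc[OF that]] spanning(2) that by blast
      then show ?thesis by metis
    qed
    then obtain b where b: "\<And>i. i < 4 \<Longrightarrow> B i = {b i}" by blast
    have inj: "inj_on b {..<4}" using Bd b by (fastforce simp: inj_on_def)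
    have vb: "verts G = b ` {..<4}" using spanning(1) Bv b by fastforce
    have "\<exists>f\<in>edges G. ends G f = b ` s" if s: "s \<in> edges K4" for s
    proof -
      obtain i j where ij: "s = {i, j}" "i \<noteq> j" "i < 4" "j < 4"
        using s by (auto simp: K4_def card_2_iff)
      then show ?thesis using Ba[of i j] b by (auto simp: adj_def)
    qed
    then have "\<forall>s\<in>edges K4. \<exists>f. f \<in> edges G \<and> ends G f = b ` s" by blast
    \<comment> \<open>One edge per pair of vertices is kept; everything else, loops and further
      parallel edges included, is deleted.\<close>
    then obtain h where h: "\<And>s. s \<in> edges K4 \<Longrightarrow> h s \<in> edges G \<and> ends G (h s) = b ` s"
      by (metis (no_types))
    let ?F = "h ` edges K4"
    let ?H = "G\<lparr>edges := ?F\<rparr>"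
    let ?\<phi> = "the_inv_into {..<4} b"
    have \<phi>b: "?\<phi> ` b ` s = s" if "s \<in> edges K4" for s
    proof -
      have "s \<subseteq> {..<4}" using that by (simp add: K4_def)
      then have "?\<phi> (b i) = i" if "i \<in> s" for i using that the_inv_into_f_f[OF inj] by blast
      then show ?thesis by (auto simp: image_image)
    qed
    have "minor_step\<^sup>*\<^sup>* G (G\<lparr>edges := edges G - (edges G - ?F)\<rparr>)"
      using less.prems(1) by (intro minor_steps_delete_edges) (auto simp: multigraph_def)
    moreover have "edges G - (edges G - ?F) = ?F" using h by blast
    ultimately have "minor_step\<^sup>*\<^sup>* G ?H" by simp
    moreover have "isomorphic ?H K4"
      unfolding isomorphic_def
    proof (intro exI conjI ballI)
      show "bij_betw ?\<phi> (verts ?H) (verts K4)"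
        using bij_betw_the_inv_into[of b "{..<4}" "verts G"] inj vb by (auto simp: bij_betw_def K4_def)
      show "bij_betw (\<lambda>g. ?\<phi> ` ends G g) (edges ?H) (edges K4)"
        by (rule bij_betw_byWitness[of _ h]) (use h \<phi>b in auto)
      show "ends K4 (?\<phi> ` ends G f) = ?\<phi> ` ends ?H f" for f by (simp add: K4_def)
    qed
    ultimately show ?thesis unfolding has_minor_def by blast
  qed
qed

section \<open>Densities of patterns\<close>

text \<open>Sets of strings and sets of patterns are both of this form, so one counting lemma covers
  them.\<close>

definition words :: "'a multiset \<Rightarrow> 'a list set" where
  "words M = {p. mset p = M}"

definition slots :: "'a \<Rightarrow> 'a list \<Rightarrow> nat set" where
  "slots l q = {i. i < length q \<and> q ! i = l}"

lemma finite_words [simp]: "finite (words M)"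
  unfolding words_def by (metis ex_mset mset_eq_finite)

lemma words_nonempty [simp]: "words M \<noteq> {}"
  unfolding words_def using ex_mset by blast

lemma card_words_pos: "0 < card (words M)"
  by (simp add: card_gt_0_iff)

lemma finite_slots [simp]: "finite (slots l q)"
  by (simp add: slots_def)

lemma card_slots: "card (slots l q) = count (mset q) l"
  by (simp add: slots_def count_mset count_list_eq_length_filter length_filter_conv_card eq_commute)

lemma slots_update:
  assumes "i \<in> slots l q" "g \<noteq> l"
  shows "slots l (q[i := g]) = slots l q - {i}"
  using assms by (auto simp: slots_def nth_list_update)

text \<open>The letter \<open>g\<close> occurs exactly once in the result and so marks the position
  at which an \<open>l\<close> was overwritten; word and position can be read off from it.\<close>

lemma bij_betw_slots:
  assumes "g \<noteq> l" "g \<notin># N"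
  shows "bij_betw (\<lambda>(q, i). q[i := g]) (SIGMA q:words (add_mset l N). slots l q)
    (words (add_mset g N))"
  unfolding bij_betw_def
proof
  show "inj_on (\<lambda>(q, i). q[i := g]) (SIGMA q:words (add_mset l N). slots l q)"
  proof (rule inj_onI, clarify)
    fix q i q' j
    assume q: "q \<in> words (add_mset l N)" "i \<in> slots l q"
      and q': "q' \<in> words (add_mset l N)" "j \<in> slots l q'"
      and eq: "q[i := g] = q'[j := g]"
    have "g \<notin># mset q" using q assms by (simp add: words_def)
    then have gq: "q ! j \<noteq> g" if "j < length q" for j using that by (metis nth_mem set_mset_mset)
    have len: "length q = length q'" using eq by (metis length_list_update)
    have "i = j"
      using gq[of j] arg_cong[OF eq, of "\<lambda>p. p ! j"] q q' len
      by (auto simp: slots_def nth_list_update split: if_splits)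
    moreover have "q = q[i := g, i := l]" using q by (auto simp: slots_def)
    moreover have "q' = q'[j := g, j := l]" using q' by (auto simp: slots_def)
    ultimately show "q = q' \<and> i = j" using eq by metis
  qed
  show "(\<lambda>(q, i). q[i := g]) ` (SIGMA q:words (add_mset l N). slots l q) = words (add_mset g N)"
  proof
    show "(\<lambda>(q, i). q[i := g]) ` (SIGMA q:words (add_mset l N). slots l q) \<subseteq> words (add_mset g N)"
      by (auto simp: words_def slots_def mset_update)
    show "words (add_mset g N) \<subseteq> (\<lambda>(q, i). q[i := g]) ` (SIGMA q:words (add_mset l N). slots l q)"
    proof
      fix p assume p: "p \<in> words (add_mset g N)"
      then have "g \<in> set p" unfolding words_def by (metis mem_Collect_eq set_mset_mset union_single_eq_member)
      then obtain i where i: "i < length p" "p ! i = g" by (metis in_set_conv_nth)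
      then have "p[i := l] \<in> words (add_mset l N)" "i \<in> slots l (p[i := l])"
        using p by (auto simp: words_def slots_def mset_update)
      moreover have "p = p[i := l, i := g]" using i by auto
      ultimately show "p \<in> (\<lambda>(q, i). q[i := g]) ` (SIGMA q:words (add_mset l N). slots l q)"
        by (intro image_eqI[of _ _ "(p[i := l], i)"]) auto
    qed
  qed
qed

lemma sum_words_slots:
  fixes h :: "'a list \<Rightarrow> real"
  assumes "g \<noteq> l" "g \<notin># N"
  shows "(\<Sum>p\<in>words (add_mset g N). h p) = (\<Sum>q\<in>words (add_mset l N). \<Sum>i\<in>slots l q. h (q[i := g]))"
proof -
  have "(\<Sum>p\<in>words (add_mset g N). h p) =
    (\<Sum>x\<in>(SIGMA q:words (add_mset l N). slots l q). h (case x of (q, i) \<Rightarrow> q[i := g]))"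
    by (rule sum.reindex_bij_betw[OF bij_betw_slots[OF assms], symmetric])
  also have "\<dots> = (\<Sum>(q, i)\<in>(SIGMA q:words (add_mset l N). slots l q). h (q[i := g]))"
    by (intro sum.cong) auto
  also have "\<dots> = (\<Sum>q\<in>words (add_mset l N). \<Sum>i\<in>slots l q. h (q[i := g]))"
    by (rule sum.Sigma[symmetric]) (auto simp: finite_words finite_slots)
  finally show ?thesis .
qed

lemma bij_betw_map_words:
  assumes "\<And>l. l \<in># M \<Longrightarrow> h (g l) = l"
  shows "bij_betw (map g) (words M) (words (image_mset g M))"
proof (rule bij_betw_byWitness[of _ "map h"])
  have hg: "map h (map g p) = p" if "p \<in> words M" for p
  proof -
    have "set p = set_mset M" using that unfolding words_def by (metis mem_Collect_eq set_mset_mset)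
    then show ?thesis using assms by (auto intro!: map_idI)
  qed
  then show "\<forall>p\<in>words M. map h (map g p) = p" by blast
  show "\<forall>p\<in>words (image_mset g M). map g (map h p) = p"
  proof
    fix p assume "p \<in> words (image_mset g M)"
    then have "set p = set_mset (image_mset g M)" unfolding words_def by (metis mem_Collect_eq set_mset_mset)
    then show "map g (map h p) = p" using assms by (auto intro!: map_idI)
  qed
  show "map g ` words M \<subseteq> words (image_mset g M)" by (auto simp: words_def)
  have "image_mset h (image_mset g M) = M"
    using assms by (simp add: multiset.map_comp comp_def cong: image_mset_cong)
  then show "map h ` words (image_mset g M) \<subseteq> words M" by (auto simp: words_def)
qed

text \<open>Patterns are words over \<open>'e + bool\<close>, with the elements of \<open>E\<close> themselves as symbols, and strings
  are functions of the edge. A vector \<open>n :: bool \<Rightarrow> nat\<close> holds the numbers \<open>n False\<close> of zeros and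
  \<open>n True\<close> of ones.\<close>

definition bag :: "'e set \<Rightarrow> (bool \<Rightarrow> nat) \<Rightarrow> ('e + bool) multiset" where
  "bag E n = image_mset Inl (mset_set E) + (\<Sum>c\<in>UNIV. replicate_mset (n c) (Inr c))"

definition fill :: "('e \<Rightarrow> bool option) \<Rightarrow> ('e + bool) list \<Rightarrow> bool option list" where
  "fill x p = map (case_sum x Some) p"

definition dens :: "'e set \<Rightarrow> ('e \<Rightarrow> bool option) set \<Rightarrow> (bool \<Rightarrow> nat) \<Rightarrow> bool option list set \<Rightarrow> real" where
  "dens E F n X' = card {p \<in> words (bag E n). \<forall>x\<in>F. fill x p \<in> X'} / card (words (bag E n))"

definition ext :: "bool \<Rightarrow> 'e \<Rightarrow> ('e \<Rightarrow> bool option) set \<Rightarrow> ('e \<Rightarrow> bool option) set" where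
  "ext c f F = (\<lambda>x. x(f := Some c)) ` F"

definition dbl :: "bool \<Rightarrow> 'e \<Rightarrow> 'e \<Rightarrow> ('e \<Rightarrow> bool option) set \<Rightarrow> ('e \<Rightarrow> bool option) set" where
  "dbl c f g F = (\<lambda>x. x(g := Some c)) ` F \<union> (\<lambda>x. x(f := Some c, g := x f)) ` F"

lemma bag_insert: "finite E \<Longrightarrow> f \<notin> E \<Longrightarrow> bag (insert f E) n = add_mset (Inl f) (bag E n)"
  by (simp add: bag_def)

lemma bag_Suc: "bag E (n(c := Suc (n c))) = add_mset (Inr c) (bag E n)"
  by (cases c) (simp_all add: bag_def UNIV_bool)

lemma count_bag_Inr: "count (bag E n) (Inr c) = n c"
proof -
  have "count (image_mset Inl M) (Inr c :: 'a + bool) = 0" for M :: "'a multiset"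
    by (induction M) auto
  then show ?thesis by (cases c) (simp_all add: bag_def UNIV_bool)
qed

lemma Inl_in_bag: "finite E \<Longrightarrow> Inl f \<in># bag E n \<longleftrightarrow> f \<in> E"
  by (auto simp: bag_def UNIV_bool split: if_splits)

lemma fill_upd: "Inl f \<notin> set p \<Longrightarrow> fill (x(f := y)) p = fill x p"
  by (auto simp: fill_def split: sum.split)

text \<open>The new symbol is always filled with \<open>c\<close>, so it may stand for any of the
  \<open>Suc (n c)\<close> occurrences of \<open>c\<close>. This factor multiplies numerator and
  denominator alike.\<close>

lemma dens_ext:
  assumes "finite E" "f \<notin> E"
  shows "dens (insert f E) (ext c f F) n X' = dens E F (n(c := Suc (n c))) X'"
proof -
  let ?N = "bag E n"
  let ?W = "words (add_mset (Inr c) ?N)" and ?W' = "words (add_mset (Inl f) ?N)"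
  have nf: "Inl f \<notin># ?N" using assms by (simp add: Inl_in_bag)
  have sum: "(\<Sum>p\<in>?W'. of_bool (Q p)) = real (Suc (n c)) * (\<Sum>q\<in>?W. of_bool (Q' q))"
    if "\<And>q i. q \<in> ?W \<Longrightarrow> i \<in> slots (Inr c) q \<Longrightarrow> Q (q[i := Inl f]) = Q' q" for Q Q'
  proof -
    have "(\<Sum>p\<in>?W'. of_bool (Q p) :: real) = (\<Sum>q\<in>?W. \<Sum>i\<in>slots (Inr c) q. of_bool (Q (q[i := Inl f])))"
      by (rule sum_words_slots) (use nf in auto)
    also have "\<dots> = (\<Sum>q\<in>?W. \<Sum>i\<in>slots (Inr c) q. of_bool (Q' q))"
      by (intro sum.cong) (auto simp: that)
    also have "\<dots> = (\<Sum>q\<in>?W. real (Suc (n c)) * of_bool (Q' q))"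
      by (intro sum.cong) (auto simp: card_slots words_def count_bag_Inr)
    finally show ?thesis by (simp add: sum_distrib_left)
  qed
  have good: "(\<forall>x\<in>ext c f F. fill x (q[i := Inl f]) \<in> X') \<longleftrightarrow> (\<forall>x\<in>F. fill x q \<in> X')"
    if "q \<in> ?W" "i \<in> slots (Inr c) q" for q i
  proof -
    have "Inl f \<notin># mset q" using that(1) nf by (simp add: words_def)
    then have "Inl f \<notin> set q" by simp
    then have "fill (x(f := Some c)) q = fill x q" for x by (rule fill_upd)
    moreover have "fill (x(f := Some c)) (q[i := Inl f]) = (fill (x(f := Some c)) q)[i := Some c]" for x
      by (simp add: fill_def map_update)
    moreover have "(fill x q)[i := Some c] = fill x q" for x
    proof -
      have "fill x q ! i = Some c" using that(2) by (simp add: fill_def slots_def)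
      then show ?thesis by (metis list_update_id)
    qed
    ultimately show ?thesis by (simp add: ext_def)
  qed
  have "real (card {p \<in> ?W'. \<forall>x\<in>ext c f F. fill x p \<in> X'}) =
      real (Suc (n c)) * card {q \<in> ?W. \<forall>x\<in>F. fill x q \<in> X'}"
    using sum[of "\<lambda>p. \<forall>x\<in>ext c f F. fill x p \<in> X'" "\<lambda>p. \<forall>x\<in>F. fill x p \<in> X'"] good
    by (simp add: Int_def del: of_nat_Suc)
  moreover have "real (card ?W') = real (Suc (n c)) * card ?W"
    using sum[of "\<lambda>_. True" "\<lambda>_. True"] by (simp del: of_nat_Suc)
  ultimately show ?thesis
    unfolding dens_def bag_insert[OF assms] bag_Suc by (simp del: of_nat_Suc)
qed

text \<open>Cauchy--Schwarz in the form that the variance around the mean \<open>m\<close> is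
  nonnegative.\<close>

lemma sum_square_ge:
  fixes d :: "'a \<Rightarrow> real"
  assumes "finite A" "card A > 0"
  shows "(\<Sum>x\<in>A. d x)\<^sup>2 / card A \<le> (\<Sum>x\<in>A. (d x)\<^sup>2)"
proof -
  define m where "m = (\<Sum>x\<in>A. d x) / card A"
  have "0 \<le> (\<Sum>x\<in>A. (d x - m)\<^sup>2)" by (simp add: sum_nonneg)
  also have "\<dots> = (\<Sum>x\<in>A. (d x)\<^sup>2 - 2 * m * d x + m\<^sup>2)"
    by (simp add: power2_diff algebra_simps)
  also have "\<dots> = (\<Sum>x\<in>A. (d x)\<^sup>2) - 2 * m * (\<Sum>x\<in>A. d x) + card A * m\<^sup>2"
    by (simp add: sum.distrib sum_subtractf sum_distrib_left)
  also have "card A * m\<^sup>2 = m * (\<Sum>x\<in>A. d x)"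
    using assms by (simp add: m_def power2_eq_square)
  finally show ?thesis by (simp add: m_def power2_eq_square)
qed

text \<open>Cauchy--Schwarz over the words \<open>q\<close> obtained by replacing the symbol \<open>f\<close> by the bit \<open>c\<close>.\<close>

lemma dens_dbl:
  fixes E :: "'e set" and F X' c and n :: "bool \<Rightarrow> nat"
  assumes "finite E" "f \<in> E" "g \<notin> E"
  defines "\<tau> \<equiv> dens E F (n(c := Suc (n c))) X'"
  shows "\<tau>\<^sup>2 - \<tau> / real (Suc (n c)) \<le> dens (insert g E) (dbl c f g F) n X'"
proof -
  define E0 where "E0 = E - {f}"
  have E: "E = insert f E0" "f \<notin> E0" "finite E0" "g \<notin> E0" "g \<noteq> f"
    using assms by (auto simp: E0_def)
  define N where "N = bag E0 n"
  have nf: "Inl f \<notin># N" and ng: "Inl g \<notin># N" using E by (auto simp: N_def Inl_in_bag)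
  let ?l = "Inr c :: 'e + bool"
  let ?Q = "words (add_mset ?l (add_mset ?l N))"
  let ?W1 = "words (add_mset (Inl f) (add_mset ?l N))"
  let ?W2 = "words (add_mset (Inl g) (add_mset (Inl f) N))"
  have W1: "words (bag E (n(c := Suc (n c)))) = ?W1"
    using E by (simp add: bag_insert bag_Suc N_def add_mset_commute)
  have W2: "words (bag (insert g E) n) = ?W2"
    using E by (simp add: bag_insert N_def)
  define A where "A p \<longleftrightarrow> (\<forall>x\<in>F. fill x p \<in> X')" for p
  define B where "B p \<longleftrightarrow> (\<forall>x\<in>dbl c f g F. fill x p \<in> X')" for p
  \<comment> \<open>A word \<open>q\<close> has \<open>r + 1\<close> positions carrying
    \<open>c\<close>; once \<open>f\<close> occupies one of them, \<open>r\<close> are left for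
    \<open>g\<close>.\<close>
  define r where "r = real (Suc (n c))"
  define d where "d q = real (card {i \<in> slots ?l q. A (q[i := Inl f])})" for q
  have slots_Q: "real (card (slots ?l q)) = r + 1" if "q \<in> ?Q" for q
    using that by (simp add: card_slots words_def N_def count_bag_Inr r_def)
  have sum1: "(\<Sum>p\<in>?W1. h p) = (\<Sum>q\<in>?Q. \<Sum>i\<in>slots ?l q. h (q[i := Inl f]))"
    for h :: "_ \<Rightarrow> real"
    by (rule sum_words_slots) (use nf in auto)
  have sum2: "(\<Sum>p\<in>?W2. h p) =
      (\<Sum>q\<in>?Q. \<Sum>i\<in>slots ?l q. \<Sum>j\<in>slots ?l q - {i}. h (q[i := Inl f, j := Inl g]))"
    for h :: "_ \<Rightarrow> real"
  proof -
    have "(\<Sum>p\<in>?W2. h p) =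
        (\<Sum>q\<in>words (add_mset ?l (add_mset (Inl f) N)). \<Sum>j\<in>slots ?l q. h (q[j := Inl g]))"
      by (rule sum_words_slots) (use ng E in auto)
    also have "words (add_mset ?l (add_mset (Inl f) N)) = ?W1" by (simp add: add_mset_commute)
    also have "(\<Sum>q\<in>?W1. \<Sum>j\<in>slots ?l q. h (q[j := Inl g])) =
        (\<Sum>q\<in>?Q. \<Sum>i\<in>slots ?l q. \<Sum>j\<in>slots ?l (q[i := Inl f]). h (q[i := Inl f, j := Inl g]))"
      by (rule sum1)
    also have "\<dots> = (\<Sum>q\<in>?Q. \<Sum>i\<in>slots ?l q. \<Sum>j\<in>slots ?l q - {i}. h (q[i := Inl f, j := Inl g]))"
      by (intro sum.cong) (auto simp: slots_update)
    finally show ?thesis .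
  qed
  \<comment> \<open>The two halves of \<open>dbl\<close> read the placed symbols as \<open>f\<close>
    and \<open>c\<close> in either order. A symbol read as \<open>c\<close> is invisible against the
    background \<open>q\<close>, so the condition splits into one on \<open>i\<close> and one on
    \<open>j\<close>.\<close>
  have AB: "B (q[i := Inl f, j := Inl g]) \<longleftrightarrow> A (q[i := Inl f]) \<and> A (q[j := Inl f])"
    if q: "q \<in> ?Q" and i: "i \<in> slots ?l q" and j: "j \<in> slots ?l q - {i}" for q i j
  proof -
    have "Inl f \<notin># mset q" "Inl g \<notin># mset q" using q nf ng by (auto simp: words_def)
    then have fq: "Inl f \<notin> set q" and gq: "Inl g \<notin> set q" by simp_all
    have q1: "fill (x(g := y)) q = fill x q" "fill (x(f := y)) q = fill x q" for x y
      using fill_upd[OF gq] fill_upd[OF fq] by auto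
    have *: "(fill x q)[k := Some c] = fill x q" if "k \<in> slots ?l q" for x k
    proof -
      have "fill x q ! k = Some c" using that by (simp add: fill_def slots_def)
      then show ?thesis by (metis list_update_id)
    qed
    have upd: "fill x (q[k := l]) = (fill x q)[k := case_sum x Some l]" for x k l
      by (simp add: fill_def map_update)
    have upd2: "fill x (q[i := Inl f, j := Inl g]) = (fill x q)[i := x f, j := x g]" for x
      by (simp add: fill_def map_update)
    have "fill (x(g := Some c)) (q[i := Inl f, j := Inl g]) = fill x (q[i := Inl f])" for x
    proof -
      have "(fill x q)[i := x f, j := Some c] = (fill x q)[j := Some c, i := x f]"
        using j by (intro list_update_swap) auto
      then show ?thesis using * i j E(5) by (simp add: upd upd2 q1)
    qed
    moreover have "fill (x(f := Some c, g := x f)) (q[i := Inl f, j := Inl g]) = fill x (q[j := Inl f])" for x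
      using * i j E(5) by (simp add: upd upd2 q1)
    ultimately show ?thesis unfolding A_def B_def dbl_def ball_Un ball_simps by simp
  qed
  have "card ?W1 = (\<Sum>q\<in>?Q. r + 1)" using sum1[of "\<lambda>_. 1"] by (simp add: slots_Q)
  then have cW1: "card ?W1 = card ?Q * (r + 1)" by simp
  have cW2: "card ?W2 = card ?Q * (r + 1) * r"
  proof -
    have "card ?W2 = (\<Sum>q\<in>?Q. \<Sum>i\<in>slots ?l q. real (card (slots ?l q - {i})))"
      using sum2[of "\<lambda>_. 1"] by simp
    also have "\<dots> = (\<Sum>q\<in>?Q. \<Sum>i\<in>slots ?l q. r)"
    proof (intro sum.cong refl)
      fix q i assume "q \<in> ?Q" "i \<in> slots ?l q"
      then show "real (card (slots ?l q - {i})) = r"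
        using slots_Q[of q] by (simp add: of_nat_diff r_def)
    qed
    also have "\<dots> = (\<Sum>q\<in>?Q. (r + 1) * r)" by (intro sum.cong) (auto simp: slots_Q)
    finally show ?thesis by simp
  qed
  have c1: "card {p \<in> ?W1. A p} = (\<Sum>q\<in>?Q. d q)"
    using sum1[of "\<lambda>p. of_bool (A p)"] by (simp add: Int_def d_def)
  \<comment> \<open>Ordered pairs of distinct good positions: the subtracted \<open>d q\<close> is
    the diagonal.\<close>
  have c2: "card {p \<in> ?W2. B p} = (\<Sum>q\<in>?Q. (d q)\<^sup>2 - d q)"
  proof -
    have "card {p \<in> ?W2. B p} = (\<Sum>p\<in>?W2. of_bool (B p) :: real)"
      by (simp add: Int_def)
    also have "\<dots> = (\<Sum>q\<in>?Q. \<Sum>i\<in>slots ?l q. \<Sum>j\<in>slots ?l q - {i}.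
        of_bool (B (q[i := Inl f, j := Inl g])))"
      by (rule sum2)
    also have "\<dots> = (\<Sum>q\<in>?Q. \<Sum>i\<in>slots ?l q. \<Sum>j\<in>slots ?l q - {i}.
        of_bool (A (q[i := Inl f])) * of_bool (A (q[j := Inl f])))"
      by (intro sum.cong refl) (simp only: AB of_bool_conj)
    also have "\<dots> = (\<Sum>q\<in>?Q. (d q)\<^sup>2 - d q)"
    proof (rule sum.cong[OF refl])
      fix q
      define a where "a i = (of_bool (A (q[i := Inl f])) :: real)" for i
      have d: "d q = (\<Sum>i\<in>slots ?l q. a i)"
        by (simp add: a_def d_def Int_def)
      have "(\<Sum>i\<in>slots ?l q. \<Sum>j\<in>slots ?l q - {i}. a i * a j) =
          (\<Sum>i\<in>slots ?l q. a i * d q - a i)"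
      proof (rule sum.cong[OF refl])
        fix i assume i: "i \<in> slots ?l q"
        have "(\<Sum>j\<in>slots ?l q - {i}. a i * a j) = a i * (d q - a i)"
          using i by (simp add: d sum_distrib_left[symmetric] sum_diff1)
        also have "\<dots> = a i * d q - a i" by (simp add: a_def algebra_simps)
        finally show "(\<Sum>j\<in>slots ?l q - {i}. a i * a j) = a i * d q - a i" .
      qed
      also have "\<dots> = (d q)\<^sup>2 - d q"
        by (simp add: sum_subtractf sum_distrib_right[symmetric] d[symmetric] power2_eq_square)
      finally show "(\<Sum>i\<in>slots ?l q. \<Sum>j\<in>slots ?l q - {i}.
          of_bool (A (q[i := Inl f])) * of_bool (A (q[j := Inl f]))) = (d q)\<^sup>2 - d q"
        by (simp add: a_def)
    qed
    finally show ?thesis .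
  qed
  define Q where "Q = real (card ?Q)"
  define s where "s = (\<Sum>q\<in>?Q. d q)"
  have Q0: "Q > 0" using card_words_pos by (simp add: Q_def)
  have r0: "r > 0" by (simp add: r_def)
  have t: "\<tau> = s / (Q * (r + 1))"
    unfolding \<tau>_def dens_def W1 A_def[symmetric] c1 cW1 s_def Q_def ..
  have t2: "dens (insert g E) (dbl c f g F) n X' = ((\<Sum>q\<in>?Q. (d q)\<^sup>2) - s) / (Q * (r + 1) * r)"
    unfolding dens_def W2 B_def[symmetric] c2 cW2 s_def Q_def by (simp add: sum_subtractf)
  have sq: "s\<^sup>2 / Q \<le> (\<Sum>q\<in>?Q. (d q)\<^sup>2)"
    unfolding s_def Q_def by (rule sum_square_ge) (simp_all add: card_words_pos)
  \<comment> \<open>Choosing the second position among \<open>r\<close> instead of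
    \<open>r + 1\<close> places yields an extra term \<open>\<tau>^2 / r\<close>, which is given
    away.\<close>
  have "\<tau>\<^sup>2 - \<tau> / r \<le> \<tau>\<^sup>2 - \<tau> / r + \<tau>\<^sup>2 / r" using r0 by simp
  also have "\<dots> = (s\<^sup>2 / Q - s) / (Q * (r + 1) * r)"
  proof -
    have s: "s = \<tau> * (Q * (r + 1))" using Q0 r0 by (simp add: t)
    have "s\<^sup>2 / Q = \<tau>\<^sup>2 * (r + 1) * (Q * (r + 1))"
      using Q0 by (simp add: s power2_eq_square)
    then have "s\<^sup>2 / Q - s = (\<tau>\<^sup>2 * (r + 1) - \<tau>) * (Q * (r + 1))"
      by (simp add: s left_diff_distrib)
    then have "(s\<^sup>2 / Q - s) / (Q * (r + 1) * r) = (\<tau>\<^sup>2 * (r + 1) - \<tau>) / r"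
      using Q0 r0 by simp
    also have "\<dots> = \<tau>\<^sup>2 - \<tau> / r + \<tau>\<^sup>2 / r" using r0 by (simp add: field_simps)
    finally show ?thesis ..
  qed
  also have "\<dots> \<le> ((\<Sum>q\<in>?Q. (d q)\<^sup>2) - s) / (Q * (r + 1) * r)"
    using sq Q0 r0 by (intro divide_right_mono) auto
  finally show ?thesis unfolding t2 r_def .
qed

section \<open>Degeneracy and its closure under the extension steps\<close>

definition layer :: "nat \<Rightarrow> (bool \<Rightarrow> nat) \<Rightarrow> bool option list set" where
  "layer k m = words (replicate_mset k None + (\<Sum>c\<in>UNIV. replicate_mset (m c) (Some c)))"

definition rel_dens :: "nat \<Rightarrow> (bool \<Rightarrow> nat) \<Rightarrow> bool option list set \<Rightarrow> real" where
  "rel_dens k m X' = card X' / card (layer k m)"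

lemma rel_dens_nonneg: "0 \<le> rel_dens k m X'"
  by (simp add: rel_dens_def)

lemma rel_dens_le_1: "X' \<subseteq> layer k m \<Longrightarrow> rel_dens k m X' \<le> 1"
  using card_words_pos by (auto simp: rel_dens_def layer_def intro!: divide_le_eq_1_pos[THEN iffD2] card_mono)

text \<open>A one-parameter form of degeneracy, stable under the two extension steps.\<close>

definition degen :: "nat \<Rightarrow> (bool \<Rightarrow> nat) \<Rightarrow> 'e set \<Rightarrow> ('e \<Rightarrow> bool option) set \<Rightarrow> bool" where
  "degen k s E F \<longleftrightarrow> (\<exists>K M. 1 \<le> K \<and> 1 \<le> M \<and>
     (\<forall>m X'. (\<forall>c. s c \<le> m c) \<longrightarrow> X' \<subseteq> layer k m \<longrightarrow>
        M \<le> rel_dens k m X' ^ K * real (min (m False) (m True)) \<longrightarrow>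
        rel_dens k m X' ^ K \<le> M * dens E F (\<lambda>c. m c - s c) X'))"

text \<open>For spanning trees, \<open>ext False\<close> is the addition of a loop, \<open>ext True\<close> of a pendant edge, and \<open>dbl False\<close>
  and \<open>dbl True\<close> are parallel and series extension of \<open>f\<close>; \<open>k\<close> is the number of stars.\<close>

inductive fam :: "nat \<Rightarrow> (bool \<Rightarrow> nat) \<Rightarrow> 'e set \<Rightarrow> ('e \<Rightarrow> bool option) set \<Rightarrow> bool" for k where
  fam_base: "finite E \<Longrightarrow> card E = k \<Longrightarrow> k \<le> 1 \<Longrightarrow> \<forall>f\<in>E. x f = None \<Longrightarrow> fam k (\<lambda>_. 0) E {x}"
| fam_ext: "fam k s E F \<Longrightarrow> f \<notin> E \<Longrightarrow> fam k (s(c := Suc (s c))) (insert f E) (ext c f F)"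
| fam_dbl: "fam k s E F \<Longrightarrow> f \<in> E \<Longrightarrow> g \<notin> E \<Longrightarrow>
    fam k (s(c := Suc (s c))) (insert g E) (dbl c f g F)"

lemma fam_finite: "fam k s E F \<Longrightarrow> finite E"
  by (induction rule: fam.induct) auto

lemma fam_card: "fam k s E F \<Longrightarrow> card E = k + s False + s True"
proof (induction rule: fam.induct)
  case (fam_ext s E F f c)
  then show ?case using fam_finite[OF fam_ext(1)] by (cases c) auto
next
  case (fam_dbl s E F f g c)
  then show ?case using fam_finite[OF fam_dbl(1)] by (cases c) auto
qed simp

text \<open>Every extension step puts exactly one further bit \<open>c\<close> into each string, so
  all strings of a family lie in one layer and \<open>s\<close> is its vector of bit counts.\<close>

lemma fam_strings: "fam k s E F \<Longrightarrow> x \<in> F \<Longrightarrow>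
  image_mset x (mset_set E) = replicate_mset k None + (\<Sum>c\<in>UNIV. replicate_mset (s c) (Some c))"
proof (induction arbitrary: x rule: fam.induct)
  case (fam_base E x)
  have "image_mset x (mset_set E) = image_mset (\<lambda>_. None) (mset_set E)"
    using fam_base by (intro image_mset_cong) auto
  then show ?case using fam_base by (simp add: image_mset_const_eq)
next
  case (fam_ext s E F f c)
  then obtain y where y: "y \<in> F" "x = y(f := Some c)" by (auto simp: ext_def)
  have "image_mset x (mset_set E) = image_mset y (mset_set E)"
    using y(2) fam_ext.hyps(2) fam_finite[OF fam_ext.hyps(1)] by (intro image_mset_cong) auto
  moreover have "x f = Some c" using y(2) by simp
  ultimately have "image_mset x (mset_set (insert f E)) = add_mset (Some c) (image_mset y (mset_set E))"
    using fam_ext.hyps(2) fam_finite[OF fam_ext.hyps(1)] by simp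
  then show ?case using fam_ext.IH[OF y(1)] by (cases c) (simp_all add: UNIV_bool)
next
  case (fam_dbl s E F f g c)
  have fin: "finite E" using fam_finite fam_dbl.hyps by blast
  have fg: "f \<noteq> g" using fam_dbl.hyps by blast
  obtain y where y: "y \<in> F" "x = y(g := Some c) \<or> x = y(f := Some c, g := y f)"
    using fam_dbl.prems by (auto simp: dbl_def)
  define E0 where "E0 = E - {f}"
  have E: "E = insert f E0" "f \<notin> E0" "finite E0" "g \<notin> E0"
    using fam_dbl.hyps fin by (auto simp: E0_def)
  have "image_mset x (mset_set E0) = image_mset y (mset_set E0)"
    using y(2) E fg by (intro image_mset_cong) auto
  moreover have "{#x f, x g#} = {#y f, Some c#}" using y(2) fg by auto
  ultimately have "image_mset x (mset_set (insert g E)) = add_mset (Some c) (image_mset y (mset_set E))"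
    using E fg by (simp add: add_mset_commute)
  then show ?case
    using fam_dbl.IH[OF y(1)] by (cases c) (simp_all add: UNIV_bool)
qed

text \<open>There is at most one symbol, and it is always filled with the star, so a pattern is
  recovered from its filling. Patterns and strings are in bijection, the density equals the relative
  density, and both constants are 1.\<close>

lemma degen_base:
  assumes "finite E" "card E = k" "k \<le> 1" "\<forall>f\<in>E. x f = None"
  shows "degen k (\<lambda>_. 0) E {x}"
proof -
  have eq: "dens E {x} m X' = rel_dens k m X'" if X': "X' \<subseteq> layer k m" for m X'
  proof -
    have "\<exists>f. E \<subseteq> {f}"
      using assms(1-3) by (metis card_le_Suc0_iff_eq card_0_eq le_Suc_eq One_nat_def subsetI singletonI singleton_iff)
    then obtain f where f: "E \<subseteq> {f}" ..
    define h where "h y = (case y of None \<Rightarrow> Inl f | Some c \<Rightarrow> Inr c)" for y :: "bool option"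
    have set_bag: "l = Inl f \<and> x f = None \<or> (\<exists>c. l = Inr c)" if "l \<in># bag E m" for l
      using that f assms by (auto simp: bag_def UNIV_bool split: if_splits)
    have hl: "h (case_sum x Some l) = l" if "l \<in># bag E m" for l
      using set_bag[OF that] by (auto simp: h_def)
    have im: "image_mset (case_sum x Some) (bag E m) = replicate_mset k None + (\<Sum>c\<in>UNIV. replicate_mset (m c) (Some c))"
    proof -
      have "image_mset x (mset_set E) = image_mset (\<lambda>_. None) (mset_set E)"
        using assms by (intro image_mset_cong) auto
      then show ?thesis using assms by (simp add: bag_def UNIV_bool image_mset_const_eq multiset.map_comp comp_def)
    qed
    have bij: "bij_betw (fill x) (words (bag E m)) (layer k m)"
      using bij_betw_map_words[of "bag E m" h "case_sum x Some"] hl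
      by (simp add: im layer_def fill_def[abs_def])
    have "bij_betw (fill x) {p \<in> words (bag E m). fill x p \<in> X'} X'"
      using bij X' unfolding bij_betw_def by (auto simp: inj_on_def)
    then have "card {p \<in> words (bag E m). fill x p \<in> X'} = card X'" by (rule bij_betw_same_card)
    then show ?thesis using bij_betw_same_card[OF bij] by (simp add: dens_def rel_dens_def)
  qed
  show ?thesis unfolding degen_def by (rule exI[of _ 1], rule exI[of _ 1]) (simp add: eq)
qed

lemma degen_ext:
  assumes "degen k s E F" "finite E" "f \<notin> E"
  shows "degen k (s(c := Suc (s c))) (insert f E) (ext c f F)"
proof -
  obtain K M where KM: "1 \<le> K" "1 \<le> M"
    "\<And>m X'. (\<forall>c. s c \<le> m c) \<Longrightarrow> X' \<subseteq> layer k m \<Longrightarrow>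
        M \<le> rel_dens k m X' ^ K * real (min (m False) (m True)) \<Longrightarrow>
        rel_dens k m X' ^ K \<le> M * dens E F (\<lambda>c. m c - s c) X'"
    using assms(1) unfolding degen_def by blast
  have "rel_dens k m X' ^ K \<le> M * dens (insert f E) (ext c f F) (\<lambda>d. m d - (s(c := Suc (s c))) d) X'"
    if m: "\<forall>d. (s(c := Suc (s c))) d \<le> m d" and X': "X' \<subseteq> layer k m"
      "M \<le> rel_dens k m X' ^ K * real (min (m False) (m True))" for m X'
  proof -
    let ?n = "\<lambda>d. m d - (s(c := Suc (s c))) d"
    have "s d \<le> m d" for d using m[rule_format, of d] by (auto split: if_splits)
    moreover have "?n(c := Suc (?n c)) = (\<lambda>d. m d - s d)"
      using m[rule_format, of c] by (auto simp: fun_eq_iff)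
    ultimately show ?thesis using KM(3)[of m X'] X' by (simp add: dens_ext[OF assms(2,3)])
  qed
  then show ?thesis unfolding degen_def using KM(1,2) by blast
qed

text \<open>The error \<open>\<tau> / z\<close> in \<open>dens_dbl\<close> is at most half of the
  main term once \<open>\<tau> * z\<close> is at least 2. The size condition is used twice: weakened
  to the exponent \<open>K\<close> it makes the assumption on \<open>F\<close> applicable, and then
  it bounds \<open>\<tau> * z\<close> from below.\<close>

lemma degen_dbl:
  assumes "degen k s E F" "finite E" "f \<in> E" "g \<notin> E"
  shows "degen k (s(c := Suc (s c))) (insert g E) (dbl c f g F)"
proof -
  obtain K and M :: real where KM: "1 \<le> K" "1 \<le> M"
    "\<And>m X'. (\<forall>c. s c \<le> m c) \<Longrightarrow> X' \<subseteq> layer k m \<Longrightarrow>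
        M \<le> rel_dens k m X' ^ K * real (min (m False) (m True)) \<Longrightarrow>
        rel_dens k m X' ^ K \<le> M * dens E F (\<lambda>c. m c - s c) X'"
    using assms(1) unfolding degen_def by blast
  \<comment> \<open>\<open>2 * M^2\<close> yields \<open>\<tau> * z \<ge> 2\<close> in spite of the
    factor \<open>M\<close> lost between \<epsilon> and \<tau>, and \<open>s c\<close> pays for the
    difference between \<open>m c\<close> and \<open>z\<close>. At the end \<open>2 * M^2\<close> is
    also the factor between \<open>(M * \<tau>)^2\<close> and \<open>\<tau>^2 / 2\<close>.\<close>
  define M' where "M' = 2 * M\<^sup>2 + s c"
  have MM: "M \<le> M\<^sup>2" using KM(2) by (simp add: power2_eq_square)
  have "rel_dens k m X' ^ (2 * K) \<le>
      M' * dens (insert g E) (dbl c f g F) (\<lambda>d. m d - (s(c := Suc (s c))) d) X'"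
    if m: "\<forall>d. (s(c := Suc (s c))) d \<le> m d" and X': "X' \<subseteq> layer k m"
      and large: "M' \<le> rel_dens k m X' ^ (2 * K) * real (min (m False) (m True))" for m X'
  proof -
    let ?n = "\<lambda>d. m d - (s(c := Suc (s c))) d"
    define \<epsilon> where "\<epsilon> = rel_dens k m X' ^ K"
    define \<mu> where "\<mu> = real (min (m False) (m True))"
    define \<tau> where "\<tau> = dens E F (\<lambda>d. m d - s d) X'"
    define z where "z = real (Suc (?n c))"
    have \<epsilon>: "0 \<le> \<epsilon>" "\<epsilon> \<le> 1"
      using rel_dens_nonneg rel_dens_le_1[OF X'] by (auto simp: \<epsilon>_def power_le_one)
    have "\<epsilon>\<^sup>2 \<le> \<epsilon>" using \<epsilon> by (simp add: power2_eq_square mult_left_le)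
    then have "\<epsilon>\<^sup>2 * \<mu> \<le> \<epsilon> * \<mu>" by (simp add: \<mu>_def mult_right_mono)
    then have \<epsilon>\<mu>: "M' \<le> \<epsilon> * \<mu>" using large by (simp add: \<epsilon>_def \<mu>_def power_mult[symmetric] mult.commute)
    have sm: "s d \<le> m d" for d using m[rule_format, of d] by (auto split: if_splits)
    have n: "?n(c := Suc (?n c)) = (\<lambda>d. m d - s d)"
      using m[rule_format, of c] by (auto simp: fun_eq_iff)
    have "M \<le> \<epsilon> * \<mu>" using \<epsilon>\<mu> MM KM(2) unfolding M'_def by linarith
    then have \<tau>: "\<epsilon> \<le> M * \<tau>" using KM(3)[of m X'] sm X' by (simp add: \<epsilon>_def \<mu>_def \<tau>_def)
    have "\<mu> \<le> m c" unfolding \<mu>_def by (cases c) auto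
    moreover have "z = real (m c) - s c" using m[rule_format, of c] by (simp add: z_def of_nat_diff)
    ultimately have "\<mu> - s c \<le> z" by simp
    then have "\<epsilon> * (\<mu> - s c) \<le> \<epsilon> * z" using \<epsilon> by (simp add: mult_left_mono)
    moreover have "\<epsilon> * s c \<le> s c" using \<epsilon> by (simp add: mult_left_le_one_le)
    ultimately have "2 * M\<^sup>2 \<le> \<epsilon> * z" using \<epsilon>\<mu> by (simp add: M'_def right_diff_distrib)
    also have "\<dots> \<le> M * \<tau> * z" using \<tau> by (simp add: z_def mult_right_mono)
    finally have "M * (2 * M) \<le> M * (\<tau> * z)" by (simp add: power2_eq_square mult_ac)
    then have "2 * M \<le> \<tau> * z" using KM(2) by (simp add: mult_le_cancel_left)
    then have "2 \<le> \<tau> * z" using KM(2) by linarith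
    then have "1 / z \<le> \<tau> / 2" by (simp add: z_def field_simps)
    moreover have \<tau>0: "0 \<le> \<tau>" by (simp add: \<tau>_def dens_def)
    ultimately have "\<tau> * (1 / z) \<le> \<tau> * (\<tau> / 2)" by (rule mult_left_mono)
    then have "\<tau>\<^sup>2 / 2 \<le> \<tau>\<^sup>2 - \<tau> / z" by (simp add: power2_eq_square)
    also have "\<dots> \<le> dens (insert g E) (dbl c f g F) ?n X'"
      using dens_dbl[OF assms(2-4), of F ?n c X'] unfolding n \<tau>_def[symmetric] z_def .
    finally have d: "\<tau>\<^sup>2 / 2 \<le> dens (insert g E) (dbl c f g F) ?n X'" .
    have "\<epsilon>\<^sup>2 \<le> (M * \<tau>)\<^sup>2" using \<tau> \<epsilon> by (intro power_mono) auto
    also have "\<dots> = (2 * M\<^sup>2) * (\<tau>\<^sup>2 / 2)" by (simp add: power_mult_distrib)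
    also have "\<dots> \<le> M' * (\<tau>\<^sup>2 / 2)" by (intro mult_right_mono) (auto simp: M'_def)
    also have "\<dots> \<le> M' * dens (insert g E) (dbl c f g F) ?n X'"
      using d by (intro mult_left_mono) (auto simp: M'_def)
    finally show ?thesis by (simp add: \<epsilon>_def power_mult[symmetric] mult.commute)
  qed
  moreover have "1 \<le> M'" using KM(2) MM by (simp add: M'_def)
  moreover have "1 \<le> 2 * K" using KM(1) by simp
  ultimately show ?thesis unfolding degen_def by blast
qed

lemma fam_degen: "fam k s E F \<Longrightarrow> degen k s E F"
proof (induction rule: fam.induct)
  case (fam_base E x)
  then show ?case by (rule degen_base)
next
  case (fam_ext s E F f c)
  then show ?case by (intro degen_ext fam_finite)
next
  case (fam_dbl s E F f g c)
  then show ?case by (intro degen_dbl fam_finite)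
qed

section \<open>Translation to the strings and patterns of the statement\<close>

definition bits :: "nat \<Rightarrow> nat \<Rightarrow> bool \<Rightarrow> nat" where
  "bits a b c = (if c then b else a)"

lemma card_restrict_bij:
  assumes "bij_betw f A B" "\<And>x. x \<in> A \<Longrightarrow> Q (f x) \<longleftrightarrow> R x"
  shows "card {y \<in> B. Q y} = card {x \<in> A. R x}"
proof -
  have "{y \<in> B. Q y} = f ` {x \<in> A. R x}" using assms by (auto simp: bij_betw_def)
  moreover have "inj_on f {x \<in> A. R x}" using assms(1) by (auto simp: bij_betw_def inj_on_def)
  ultimately show ?thesis by (simp add: card_image)
qed

text \<open>The constants are \<open>c1 = M\<close>, \<open>c2 = 1 / K\<close>,
  \<open>c3 = 1 / M\<close> and \<open>c4 = K\<close>: with \<mu> the minimum of the two counts,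
  \<open>\<delta> \<ge> M * \<mu> powr (- (1 / K))\<close> gives
  \<open>\<delta> ^ K * \<mu> \<ge> M ^ K \<ge> M\<close>.\<close>

lemma degen_powr:
  assumes "degen k s E F"
  shows "\<exists>c1 c2 c3 c4 :: real. c1 > 0 \<and> c2 > 0 \<and> c3 > 0 \<and> c4 > 0 \<and>
    (\<forall>m X' \<delta>. (\<forall>c. s c \<le> m c) \<longrightarrow> X' \<subseteq> layer k m \<longrightarrow>
      real (card X') = \<delta> * real (card (layer k m)) \<longrightarrow> min (m False) (m True) > 0 \<longrightarrow>
      \<delta> \<ge> c1 * real (min (m False) (m True)) powr (- c2) \<longrightarrow>
      c3 * \<delta> powr c4 \<le> dens E F (\<lambda>c. m c - s c) X')"
proof -
  obtain K and M :: real where KM: "1 \<le> K" "1 \<le> M"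
    "\<And>m X'. (\<forall>c. s c \<le> m c) \<Longrightarrow> X' \<subseteq> layer k m \<Longrightarrow>
        M \<le> rel_dens k m X' ^ K * real (min (m False) (m True)) \<Longrightarrow>
        rel_dens k m X' ^ K \<le> M * dens E F (\<lambda>c. m c - s c) X'"
    using assms unfolding degen_def by blast
  have "1 / M * \<delta> powr real K \<le> dens E F (\<lambda>c. m c - s c) X'"
    if m: "\<forall>c. s c \<le> m c" and X': "X' \<subseteq> layer k m"
      and card: "real (card X') = \<delta> * real (card (layer k m))" and pos: "min (m False) (m True) > 0"
      and \<delta>: "\<delta> \<ge> M * real (min (m False) (m True)) powr (- (1 / K))" for m X' \<delta>
  proof -
    define \<mu> where "\<mu> = real (min (m False) (m True))"
    have \<mu>: "\<mu> > 0" using pos by (simp add: \<mu>_def)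
    have rel: "rel_dens k m X' = \<delta>"
      using card card_words_pos by (simp add: rel_dens_def layer_def)
    have "0 < M * \<mu> powr (- (1 / K))" using KM(2) \<mu> by simp
    then have \<delta>0: "\<delta> > 0" using \<delta> unfolding \<mu>_def by linarith
    have "(\<mu> powr (- (1 / K))) ^ K = \<mu> powr (-1)"
      using KM(1) \<mu> by (simp add: powr_power)
    then have e: "(\<mu> powr (- (1 / K))) ^ K * \<mu> = 1" using \<mu> by (simp add: powr_minus_divide)
    have "M \<le> M ^ K" using KM(1,2) by (simp add: self_le_power)
    also have "\<dots> = (M * \<mu> powr (- (1 / K))) ^ K * \<mu>" using e by (simp add: power_mult_distrib)
    also have "\<dots> \<le> \<delta> ^ K * \<mu>"
      using \<delta> KM(2) \<mu> unfolding \<mu>_def by (intro mult_right_mono power_mono) auto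
    finally have "\<delta> ^ K \<le> M * dens E F (\<lambda>c. m c - s c) X'"
      using KM(3)[of m X'] m X' by (simp add: rel \<mu>_def)
    then show ?thesis using \<delta>0 KM(2) by (simp add: powr_realpow field_simps)
  qed
  moreover have "0 < M" "0 < 1 / real K" "0 < 1 / M" "0 < real K" using KM(1,2) by auto
  ultimately show ?thesis by blast
qed

text \<open>\<open>P\<close> and \<open>P'\<close> differ only in the number \<open>N\<close> of
  symbols, so both are instances.\<close>

definition patterns :: "nat \<Rightarrow> nat \<Rightarrow> nat \<Rightarrow> letter list set" where
  "patterns N z o1 = words (mset (map Sym [0..<N]) + replicate_mset z (Bit False) + replicate_mset o1 (Bit True))"

lemma count_Sym: "count (mset (map Sym [0..<N])) l = (case l of Sym j \<Rightarrow> if j < N then 1 else 0 | Bit c \<Rightarrow> 0)"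
  by (induction N) (auto split: letter.split)

lemma patterns_eq:
  "patterns N z o1 = {p. length p = N + z + o1 \<and> set p \<subseteq> Sym ` {..<N} \<union> range Bit \<and>
     (\<forall>j<N. count_list p (Sym j) = 1) \<and> count_list p (Bit False) = z \<and> count_list p (Bit True) = o1}"
  (is "_ = ?R")
proof
  let ?M = "mset (map Sym [0..<N]) + replicate_mset z (Bit False) + replicate_mset o1 (Bit True)"
  have counts: "count ?M (Sym j) = (if j < N then 1 else 0)" "count ?M (Bit c) = (if c then o1 else z)" for j c
    by (simp_all add: count_Sym del: mset_map)
  show "patterns N z o1 \<subseteq> ?R"
  proof
    fix p assume "p \<in> patterns N z o1"
    then have p: "mset p = ?M" by (simp only: patterns_def words_def mem_Collect_eq)
    have c: "count_list p l = count ?M l" for l by (simp only: p[symmetric] count_mset)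
    have "size ?M = N + z + o1" by simp
    then have "length p = N + z + o1" by (metis p size_mset)
    moreover have "set_mset ?M \<subseteq> Sym ` {..<N} \<union> range Bit" by auto
    then have "set p \<subseteq> Sym ` {..<N} \<union> range Bit" by (metis p set_mset_mset)
    ultimately show "p \<in> ?R" unfolding mem_Collect_eq c counts by simp
  qed
  show "?R \<subseteq> patterns N z o1"
  proof
    fix p assume p: "p \<in> ?R"
    have "mset p = ?M"
    proof (rule multiset_eqI)
      fix l
      show "count (mset p) l = count ?M l"
      proof (cases l)
        case (Sym j)
        have "count_list p (Sym j) = 0" if "\<not> j < N"
          using p that by (intro count_notin) auto
        then show ?thesis using p unfolding Sym counts count_mset by simp
      next
        case (Bit c)
        then show ?thesis using p unfolding Bit counts count_mset by simp
      qed
    qed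
    then show "p \<in> patterns N z o1" by (simp only: patterns_def words_def mem_Collect_eq)
  qed
qed

lemma P_eq_patterns: "a \<le> a' \<Longrightarrow> b \<le> b' \<Longrightarrow> P a b a' b' = patterns (a + b) (a' - a) (b' - b)"
  unfolding P_def patterns_eq by auto

lemma P'_eq_patterns: "a \<le> a' \<Longrightarrow> b \<le> b' \<Longrightarrow> P' a b a' b' = patterns (a + b + 1) (a' - a) (b' - b)"
  unfolding P'_def patterns_eq by auto

lemma L_eq: "L a b = words (\<Sum>c\<in>UNIV. replicate_mset (bits a b c) c)"
proof -
  have "x \<in> L a b \<longleftrightarrow> mset x = (\<Sum>c\<in>UNIV. replicate_mset (bits a b c) c)" for x
  proof
    assume "x \<in> L a b"
    then show "mset x = (\<Sum>c\<in>UNIV. replicate_mset (bits a b c) c)"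
      by (intro multiset_eqI) (auto simp: L_def UNIV_bool bits_def count_mset)
  next
    assume x: "mset x = (\<Sum>c\<in>UNIV. replicate_mset (bits a b c) c)"
    have "length x = a + b" using arg_cong[OF x, of size] by (simp add: UNIV_bool bits_def)
    then show "x \<in> L a b"
      by (simp add: L_def x flip: count_mset) (simp add: UNIV_bool bits_def)
  qed
  then show ?thesis by (auto simp: words_def)
qed

lemma L'_eq_layer: "L' a b = layer 1 (bits a b)"
proof -
  have "x \<in> L' a b \<longleftrightarrow> mset x = replicate_mset 1 None + (\<Sum>c\<in>UNIV. replicate_mset (bits a b c) (Some c))" for x
  proof
    assume x: "x \<in> L' a b"
    show "mset x = replicate_mset 1 None + (\<Sum>c\<in>UNIV. replicate_mset (bits a b c) (Some c))"
    proof (rule multiset_eqI)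
      fix y show "count (mset x) y = count (replicate_mset 1 None + (\<Sum>c\<in>UNIV. replicate_mset (bits a b c) (Some c))) y"
        using x by (cases y) (auto simp: L'_def UNIV_bool bits_def count_mset)
    qed
  next
    assume x: "mset x = replicate_mset 1 None + (\<Sum>c\<in>UNIV. replicate_mset (bits a b c) (Some c))"
    have "length x = a + b + 1" using arg_cong[OF x, of size] by (simp add: UNIV_bool bits_def)
    then show "x \<in> L' a b"
      by (simp add: L'_def x flip: count_mset) (simp add: UNIV_bool bits_def)
  qed
  then show ?thesis by (auto simp: words_def layer_def)
qed

lemma bij_betw_L_layer: "bij_betw (map Some) (L a b) (layer 0 (bits a b))"
proof -
  have "image_mset Some (\<Sum>c\<in>UNIV. replicate_mset (bits a b c) c) =
      replicate_mset 0 None + (\<Sum>c\<in>UNIV. replicate_mset (bits a b c) (Some c))"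
    by (simp add: UNIV_bool)
  then show ?thesis
    using bij_betw_map_words[of "\<Sum>c\<in>UNIV. replicate_mset (bits a b c) c" the Some]
    unfolding L_eq layer_def by simp
qed

text \<open>Renaming each edge symbol to its position in \<open>es\<close> is a bijection of
  patterns that respects filling. It is the only place where the ordering enters the density, which
  therefore does not depend on it.\<close>

lemma dens_eq_patterns:
  assumes "ordering_of es E"
  shows "dens E F n Y' = real (card {p \<in> patterns (card E) (n False) (n True).
      psi' p ` (\<lambda>x. map x es) ` F \<subseteq> Y'}) / real (card (patterns (card E) (n False) (n True)))"
proof -
  have es: "distinct es" "set es = E" "length es = card E"
    using assms by (auto simp: ordering_of_def distinct_card)
  then have fin: "finite E" by auto
  define idx where "idx = the_inv_into {..<card E} ((!) es)"
  define g where "g = case_sum (\<lambda>e. Sym (idx e)) Bit"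
  define h where "h l = (case l of Sym j \<Rightarrow> Inl (es ! j) | Bit c \<Rightarrow> Inr c)" for l
  have inj: "inj_on ((!) es) {..<card E}" using es by (auto simp: inj_on_def nth_eq_iff_index_eq)
  have range: "(!) es ` {..<card E} = E" using es by (metis list.set_map map_nth set_upt atLeast_upt)
  have idx: "es ! idx e = e" if "e \<in> E" for e
    unfolding idx_def using that range by (intro f_the_inv_into_f[OF inj]) auto
  have idx2: "idx (es ! j) = j" if "j < card E" for j
    unfolding idx_def using that by (intro the_inv_into_f_f[OF inj]) auto
  have set_bag: "(\<exists>e\<in>E. l = Inl e) \<or> (\<exists>c. l = Inr c)" if "l \<in># bag E n" for l
    using that fin by (auto simp: bag_def UNIV_bool split: if_splits)
  have hg: "h (g l) = l" if "l \<in># bag E n" for l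
    using set_bag[OF that] by (auto simp: h_def g_def idx)
  have "mset_set E = mset es" using es by (metis mset_set_set)
  moreover have "map idx es = [0..<card E]"
    using es idx2 by (intro nth_equalityI) auto
  then have "map (\<lambda>e. Sym (idx e)) es = map Sym [0..<card E]" by (metis (no_types, lifting) comp_apply map_eq_conv map_map)
  ultimately have im: "image_mset g (bag E n) = mset (map Sym [0..<card E]) + replicate_mset (n False) (Bit False) + replicate_mset (n True) (Bit True)"
    by (simp add: bag_def UNIV_bool g_def multiset.map_comp comp_def flip: mset_map)
  have bij: "bij_betw (map g) (words (bag E n)) (patterns (card E) (n False) (n True))"
    using bij_betw_map_words[of "bag E n" h g] hg unfolding patterns_def im by blast
  have fill: "psi' (map g p) (map x es) = fill x p" if "p \<in> words (bag E n)" for p x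
  proof -
    have "set p = set_mset (bag E n)" using that unfolding words_def by (metis mem_Collect_eq set_mset_mset)
    moreover have "idx e < length es" if "e \<in> E" for e
      using the_inv_into_into[OF inj, of e "{..<card E}"] range that es(3) by (simp add: idx_def)
    then have "(case g l of Sym j \<Rightarrow> map x es ! j | Bit c \<Rightarrow> Some c) = case_sum x Some l"
      if "l \<in># bag E n" for l
      using set_bag[OF that] by (auto simp: g_def idx)
    ultimately show ?thesis by (simp add: psi'_def fill_def)
  qed
  have "card {p \<in> patterns (card E) (n False) (n True). psi' p ` (\<lambda>x. map x es) ` F \<subseteq> Y'} =
      card {p \<in> words (bag E n). \<forall>x\<in>F. fill x p \<in> Y'}"
    by (rule card_restrict_bij[OF bij]) (simp add: image_subset_iff fill)
  then show ?thesis using bij_betw_same_card[OF bij] by (simp add: dens_def)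
qed

lemma mset_map_ordering: "ordering_of es E \<Longrightarrow> mset (map x es) = image_mset x (mset_set E)"
  unfolding ordering_of_def by (metis mset_map mset_set_set)

lemma fam_strings_layer:
  assumes "fam k s E F" "ordering_of es E"
  shows "(\<lambda>x. map x es) ` F \<subseteq> layer k s"
  using fam_strings[OF assms(1)]
  by (auto simp: layer_def words_def mset_map_ordering[OF assms(2)] simp del: mset_map)

lemma fam_p_degenerate':
  assumes "fam 1 s E F" "ordering_of es E"
  shows "(\<lambda>x. map x es) ` F \<subseteq> L' (s False) (s True) \<and>
    p_degenerate' (s False) (s True) ((\<lambda>x. map x es) ` F)"
proof
  have s: "bits (s False) (s True) = s" by (auto simp: bits_def)
  show "(\<lambda>x. map x es) ` F \<subseteq> L' (s False) (s True)"
    using fam_strings_layer[OF assms] by (simp add: L'_eq_layer s)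
  obtain c1 c2 c3 c4 :: real where c: "c1 > 0" "c2 > 0" "c3 > 0" "c4 > 0"
    "\<forall>m X' \<delta>. (\<forall>c. s c \<le> m c) \<longrightarrow> X' \<subseteq> layer 1 m \<longrightarrow>
      real (card X') = \<delta> * real (card (layer 1 m)) \<longrightarrow> min (m False) (m True) > 0 \<longrightarrow>
      \<delta> \<ge> c1 * real (min (m False) (m True)) powr (- c2) \<longrightarrow>
      c3 * \<delta> powr c4 \<le> dens E F (\<lambda>c. m c - s c) X'"
    using degen_powr[OF fam_degen[OF assms(1)]] by blast
  have cardE: "card E = s False + s True + 1" using fam_card[OF assms(1)] by simp
  have "t' (s False) (s True) a' b' ((\<lambda>x. map x es) ` F) Y' \<ge> c3 * \<delta> powr c4"
    if a: "s False \<le> a'" "s True \<le> b'" and Y': "Y' \<subseteq> L' a' b'"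
      "real (card Y') = \<delta> * real (card (L' a' b'))" "min a' b' > 0"
      "\<delta> \<ge> c1 * real (min a' b') powr (- c2)" for a' b' Y' \<delta>
  proof -
    have "\<forall>c. s c \<le> bits a' b' c" using a by (auto simp: bits_def split: if_splits)
    then have "c3 * \<delta> powr c4 \<le> dens E F (\<lambda>c. bits a' b' c - s c) Y'"
      using c(5)[THEN spec, THEN spec, THEN spec, of "bits a' b'" Y' \<delta>] Y' by (simp add: L'_eq_layer bits_def)
    also have "\<dots> = t' (s False) (s True) a' b' ((\<lambda>x. map x es) ` F) Y'"
      using a by (simp add: dens_eq_patterns[OF assms(2)] t'_def P'_eq_patterns cardE bits_def)
    finally show ?thesis .
  qed
  then show "p_degenerate' (s False) (s True) ((\<lambda>x. map x es) ` F)"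
    unfolding p_degenerate'_def using c(1-4) by blast
qed

text \<open>Binary strings are treated as strings without a star, through the injection
  \<open>map Some\<close>; it carries \<open>L\<close> onto the layer with \<open>k = 0\<close> and
  commutes with filling.\<close>

lemma fam_p_degenerate:
  assumes "fam 0 s E F" "ordering_of es E" and X: "map Some ` X = (\<lambda>x. map x es) ` F"
  shows "X \<subseteq> L (s False) (s True) \<and> p_degenerate (s False) (s True) X"
proof
  have s: "bits (s False) (s True) = s" by (auto simp: bits_def)
  have inj: "inj (map (Some :: bool \<Rightarrow> _))" by simp
  have L_iff: "map Some x \<in> layer 0 (bits a b) \<longleftrightarrow> x \<in> L a b" for x a b
    using bij_betw_L_layer[of a b] inj unfolding bij_betw_def by (metis inj_image_mem_iff)
  show "X \<subseteq> L (s False) (s True)"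
  proof
    fix x assume "x \<in> X"
    then have "map Some x \<in> layer 0 s" using fam_strings_layer[OF assms(1,2)] X by blast
    then show "x \<in> L (s False) (s True)" using L_iff[of x "s False" "s True"] by (simp add: s)
  qed
  obtain c1 c2 c3 c4 :: real where c: "c1 > 0" "c2 > 0" "c3 > 0" "c4 > 0"
    "\<forall>m X' \<delta>. (\<forall>c. s c \<le> m c) \<longrightarrow> X' \<subseteq> layer 0 m \<longrightarrow>
      real (card X') = \<delta> * real (card (layer 0 m)) \<longrightarrow> min (m False) (m True) > 0 \<longrightarrow>
      \<delta> \<ge> c1 * real (min (m False) (m True)) powr (- c2) \<longrightarrow>
      c3 * \<delta> powr c4 \<le> dens E F (\<lambda>c. m c - s c) X'"
    using degen_powr[OF fam_degen[OF assms(1)]] by blast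
  have cardE: "card E = s False + s True" using fam_card[OF assms(1)] by simp
  have "t (s False) (s True) a' b' X X' \<ge> c3 * \<delta> powr c4"
    if a: "s False \<le> a'" "s True \<le> b'" and X': "X' \<subseteq> L a' b'"
      "real (card X') = \<delta> * real (card (L a' b'))" "min a' b' > 0"
      "\<delta> \<ge> c1 * real (min a' b') powr (- c2)" for a' b' X' \<delta>
  proof -
    have "\<forall>c. s c \<le> bits a' b' c" using a by (auto simp: bits_def split: if_splits)
    moreover have "map Some ` X' \<subseteq> layer 0 (bits a' b')"
      using X'(1) L_iff by blast
    moreover have "card (map Some ` X') = card X'" using inj by (meson card_image inj_on_subset subset_UNIV)
    ultimately have "c3 * \<delta> powr c4 \<le> dens E F (\<lambda>c. bits a' b' c - s c) (map Some ` X')"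
      using c(5)[THEN spec, THEN spec, THEN spec, of "bits a' b'" "map Some ` X'" \<delta>] X' bij_betw_same_card[OF bij_betw_L_layer[of a' b']]
      by (simp add: bits_def)
    also have "\<dots> = t (s False) (s True) a' b' X X'"
    proof -
      let ?\<Pi> = "patterns (s False + s True) (a' - s False) (b' - s True)"
      have psi: "psi' p (map Some x) = map Some (psi p x)" if "p \<in> ?\<Pi>" "x \<in> X" for p x
      proof -
        have "length x = s False + s True"
          using that(2) \<open>X \<subseteq> L (s False) (s True)\<close> by (auto simp: L_def)
        moreover have "set p \<subseteq> Sym ` {..<s False + s True} \<union> range Bit"
          using that(1) by (simp add: patterns_eq)
        ultimately show ?thesis by (auto simp: psi_def psi'_def)
      qed
      have "psi' p ` map Some ` X \<subseteq> map Some ` X' \<longleftrightarrow> psi p ` X \<subseteq> X'" if "p \<in> ?\<Pi>" for p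
      proof -
        have "psi' p ` map Some ` X = map Some ` psi p ` X"
          using psi[OF that] by (auto simp: image_image cong: image_cong)
        then show ?thesis using inj by (metis inj_image_subset_iff)
      qed
      then have "{p \<in> ?\<Pi>. psi' p ` map Some ` X \<subseteq> map Some ` X'} = {p \<in> ?\<Pi>. psi p ` X \<subseteq> X'}"
        by blast
      then show ?thesis
        using a by (simp add: dens_eq_patterns[OF assms(2)] t_def P_eq_patterns cardE bits_def X)
    qed
    finally show ?thesis .
  qed
  then show "p_degenerate (s False) (s True) X"
    unfolding p_degenerate_def using c(1-4) by blast
qed

section \<open>Spanning trees and cuts\<close>

definition crosses :: "('e \<Rightarrow> 'v set) \<Rightarrow> 'e \<Rightarrow> 'v set \<Rightarrow> bool" where
  "crosses ed f U \<longleftrightarrow> ed f \<inter> U \<noteq> {} \<and> ed f - U \<noteq> {}"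

text \<open>Connectivity of \<open>V\<close> by the edges \<open>T\<close>, in cut form. Loops cross
  no cut and parallel edges cross the same ones, which makes their removal immediate.\<close>

definition spans :: "('e \<Rightarrow> 'v set) \<Rightarrow> 'v set \<Rightarrow> 'e set \<Rightarrow> bool" where
  "spans ed V T \<longleftrightarrow> V \<noteq> {} \<and> (\<forall>U. U \<subset> V \<longrightarrow> U \<noteq> {} \<longrightarrow> (\<exists>f\<in>T. crosses ed f U))"

text \<open>An edge count replaces acyclicity, which is easier to follow under deletion and
  contraction; agreement with the original notion is \<open>spanning_tree_edges_iff\<close>.\<close>

definition trees :: "('v, 'e) mgraph \<Rightarrow> 'e set set" where
  "trees G = {T. T \<subseteq> edges G \<and> spans (ends G) (verts G) T \<and> card T + 1 = card (verts G)}"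

lemma spansD:
  assumes "spans ed V T" "U \<subset> V" "U \<noteq> {}"
  obtains f where "f \<in> T" "crosses ed f U"
  using assms unfolding spans_def by blast

lemma spansI:
  assumes "V \<noteq> {}" "\<And>U. U \<subset> V \<Longrightarrow> U \<noteq> {} \<Longrightarrow> \<exists>f\<in>T. crosses ed f U"
  shows "spans ed V T"
  using assms unfolding spans_def by blast

lemma spans_transfer:
  assumes "spans ed V T" "\<And>f U. f \<in> T \<Longrightarrow> crosses ed f U \<Longrightarrow> \<exists>g\<in>T'. crosses ed' g U"
  shows "spans ed' V T'"
proof (rule spansI)
  show "V \<noteq> {}" using assms(1) by (simp add: spans_def)
  fix U assume "U \<subset> V" "U \<noteq> {}"
  then obtain f where "f \<in> T" "crosses ed f U" by (rule spansD[OF assms(1)])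
  then show "\<exists>f\<in>T'. crosses ed' f U" by (rule assms(2))
qed

lemma spans_cong: "(\<And>f. f \<in> T \<Longrightarrow> ed f = ed' f) \<Longrightarrow> spans ed V T \<longleftrightarrow> spans ed' V T"
  unfolding spans_def crosses_def by simp

lemma spans_remove_loop:
  assumes "card (ed f) = 1" "spans ed V T"
  shows "spans ed V (T - {f})"
proof (rule spans_transfer[OF assms(2)])
  fix g U assume g: "g \<in> T" "crosses ed g U"
  obtain x where "ed f = {x}" using assms(1) card_1_singletonE by blast
  then have "g \<noteq> f" using g(2) by (auto simp: crosses_def)
  then show "\<exists>g\<in>T - {f}. crosses ed g U" using g by blast
qed

lemma spans_remove_parallel:
  assumes "f \<in> T" "f \<noteq> g" "ed f = ed g" "spans ed V T"
  shows "spans ed V (T - {g})"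
proof (rule spans_transfer[OF assms(4)])
  fix h U assume h: "h \<in> T" "crosses ed h U"
  show "\<exists>h\<in>T - {g}. crosses ed h U"
  proof (cases "h = g")
    case True
    then have "crosses ed f U" using h(2) assms(3) by (simp add: crosses_def)
    then show ?thesis using assms(1,2) by blast
  qed (use h in blast)
qed

lemma spans_swap_parallel:
  assumes "ed f = ed g" "spans ed V (insert g T)"
  shows "spans ed V (insert f T)"
  by (rule spans_transfer[OF assms(2)]) (use assms(1) in \<open>auto simp: crosses_def\<close>)

lemma spans_touch:
  assumes "spans ed V T" "v \<in> V" "V \<noteq> {v}"
  obtains f where "f \<in> T" "v \<in> ed f"
proof -
  have "{v} \<subset> V" using assms by blast
  then obtain f where "f \<in> T" "crosses ed f {v}" using spansD[OF assms(1)] by blast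
  then show ?thesis using that by (auto simp: crosses_def)
qed

text \<open>The cuts of the contraction correspond to the cuts that do not separate \<open>u\<close>
  from \<open>v\<close>; all other cuts are crossed by \<open>g\<close>.\<close>

lemma spans_contract:
  assumes "ed g = {u, v}" "u \<noteq> v" "u \<in> V" "v \<in> V"
  shows "spans ed V (insert g T) \<longleftrightarrow> spans (\<lambda>h. (\<lambda>x. if x = v then u else x) ` ed h) (V - {v}) T"
    (is "_ \<longleftrightarrow> spans ?ed _ _")
proof
  let ?\<sigma> = "\<lambda>x. if x = v then u else x"
  have cr: "crosses ?ed h U \<longleftrightarrow> crosses ed h (?\<sigma> -` U)" for h U
    unfolding crosses_def by blast
  {
    assume l: "spans ed V (insert g T)"
    show "spans ?ed (V - {v}) T"
    proof (rule spansI)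
      show "V - {v} \<noteq> {}" using assms by blast
      fix U assume U: "U \<subset> V - {v}" "U \<noteq> {}"
      \<comment> \<open>The preimage of \<open>U\<close> under the contraction: \<open>u\<close> and
        \<open>v\<close> lie on the same side, so \<open>g\<close> does not cross it.\<close>
      define U' where "U' = (if u \<in> U then insert v U else U)"
      have "U' \<subset> V" "U' \<noteq> {}" using U assms(4) by (auto simp: U'_def)
      then obtain h where h: "h \<in> insert g T" "crosses ed h U'" by (rule spansD[OF l])
      have "U' = ?\<sigma> -` U" using U by (auto simp: U'_def split: if_splits)
      moreover have "\<not> crosses ed g U'" using U assms(1,2) by (auto simp: crosses_def U'_def)
      ultimately show "\<exists>f\<in>T. crosses ?ed f U" using h cr by blast
    qed
  }
  {
    assume r: "spans ?ed (V - {v}) T"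
    show "spans ed V (insert g T)"
    proof (rule spansI)
      show "V \<noteq> {}" using assms by blast
      fix U assume U: "U \<subset> V" "U \<noteq> {}"
      show "\<exists>f\<in>insert g T. crosses ed f U"
      proof (cases "u \<in> U \<longleftrightarrow> v \<in> U")
        case False
        then have "crosses ed g U" using assms(1) by (auto simp: crosses_def)
        then show ?thesis by blast
      next
        case True
        have "U - {v} \<subset> V - {v}" "U - {v} \<noteq> {}" using U True assms by auto
        then obtain h where h: "h \<in> T" "crosses ?ed h (U - {v})" by (rule spansD[OF r])
        have "?\<sigma> -` (U - {v}) = U" using True assms(2) by (auto split: if_splits)
        then have "crosses ed h U" using iffD1[OF cr h(2)] by simp
        then show ?thesis using h(1) by blast
      qed
    qed
  }
qed

text \<open>This is the contraction of \<open>f\<close> when no other edge meets \<open>v\<close>,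
  so that the relabelling of ends is vacuous.\<close>

lemma spans_pendant:
  assumes "ed f = {u, v}" "u \<noteq> v" "u \<in> V" "v \<in> V" "\<And>h. h \<in> T \<Longrightarrow> v \<notin> ed h"
  shows "spans ed V (insert f T) \<longleftrightarrow> spans ed (V - {v}) T"
proof -
  have "(\<lambda>x. if x = v then u else x) ` ed h = ed h" if "h \<in> T" for h
    using assms(5)[OF that] by force
  then show ?thesis unfolding spans_contract[of ed f u v V T, OF assms(1-4)] by (rule spans_cong)
qed

lemma connected_graph_iff_spans:
  assumes "multigraph G"
  shows "connected_graph G \<longleftrightarrow> spans (ends G) (verts G) (edges G)"
proof
  assume conn: "connected_graph G"
  show "spans (ends G) (verts G) (edges G)"
  proof (rule spansI)
    show "verts G \<noteq> {}" using conn by (simp add: connected_graph_def)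
    fix U assume U: "U \<subset> verts G" "U \<noteq> {}"
    then obtain u w where uw: "u \<in> U" "w \<in> verts G" "w \<notin> U" by blast
    have "(u, w) \<in> (adj G)\<^sup>*" using conn uw U unfolding connected_graph_def by blast
    then have "w \<in> U \<or> (\<exists>f\<in>edges G. crosses (ends G) f U)"
    proof (induction rule: rtrancl_induct)
      case base
      then show ?case using uw by blast
    next
      case (step y z)
      obtain f where "f \<in> edges G" "ends G f = {y, z}" using step.hyps(2) by (auto simp: adj_def)
      then show ?case using step.IH by (auto simp: crosses_def)
    qed
    then show "\<exists>f\<in>edges G. crosses (ends G) f U" using uw by blast
  qed
next
  assume sp: "spans (ends G) (verts G) (edges G)"
  have "(u, w) \<in> (adj G)\<^sup>*" if u: "u \<in> verts G" and w: "w \<in> verts G" for u w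
  proof (rule ccontr)
    assume no: "(u, w) \<notin> (adj G)\<^sup>*"
    define U where "U = {x \<in> verts G. (u, x) \<in> (adj G)\<^sup>*}"
    have "U \<subset> verts G" "U \<noteq> {}" using u w no by (auto simp: U_def)
    then obtain f where f: "f \<in> edges G" "crosses (ends G) f U" by (rule spansD[OF sp])
    obtain x y where xy: "ends G f = {x, y}" "x \<in> verts G" "y \<in> verts G"
      using multigraph_ends_cases[OF assms f(1)] .
    have "(x, y) \<in> adj G" "(y, x) \<in> adj G" using xy f(1) by (auto simp: adj_def insert_commute)
    then have "x \<in> U \<longleftrightarrow> y \<in> U" using xy by (auto simp: U_def intro: rtrancl_into_rtrancl)
    then show False using f(2) xy by (auto simp: crosses_def)
  qed
  then show "connected_graph G" using sp by (auto simp: connected_graph_def spans_def)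
qed

lemma multigraph_edges_subset: "multigraph G \<Longrightarrow> T \<subseteq> edges G \<Longrightarrow> multigraph (G\<lparr>edges := T\<rparr>)"
  by (auto simp: multigraph_def finite_subset)

text \<open>A tree is grown from a single vertex: an edge of \<open>T\<close> crossing the current
  vertex set attaches a new vertex as a pendant one, which keeps the vertices one ahead of the
  edges.\<close>

lemma spans_grow:
  assumes "multigraph G" "T \<subseteq> edges G" "spans (ends G) (verts G) T"
  shows "Suc k \<le> card (verts G) \<Longrightarrow> \<exists>U F. U \<subseteq> verts G \<and> F \<subseteq> T \<and> card U = Suc k \<and> card F = k \<and>
    (\<forall>f\<in>F. ends G f \<subseteq> U) \<and> spans (ends G) U F"
proof (induction k)
  case 0
  obtain u where "u \<in> verts G" using assms(3) by (auto simp: spans_def)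
  then show ?case by (intro exI[of _ "{u}"] exI[of _ "{}"]) (auto simp: spans_def)
next
  case (Suc k)
  obtain U F where UF: "U \<subseteq> verts G" "F \<subseteq> T" "card U = Suc k" "card F = k"
    "\<forall>f\<in>F. ends G f \<subseteq> U" "spans (ends G) U F" using Suc.IH Suc.prems by auto
  have fin: "finite (verts G)" "finite (edges G)" using assms(1) by (auto simp: multigraph_def)
  have finU: "finite U" by (rule finite_subset[OF UF(1) fin(1)])
  have finF: "finite F" by (rule finite_subset[OF UF(2) finite_subset[OF assms(2) fin(2)]])
  have "U \<noteq> verts G" using UF(3) Suc.prems by auto
  then have "U \<subset> verts G" "U \<noteq> {}" using UF by auto
  then obtain f where f: "f \<in> T" "crosses (ends G) f U" by (rule spansD[OF assms(3)])
  have "f \<in> edges G" using f(1) assms(2) by blast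
  then obtain a b where ab: "ends G f = {a, b}" "a \<in> verts G" "b \<in> verts G"
    using multigraph_ends_cases[OF assms(1)] by metis
  obtain x y where xy: "ends G f = {x, y}" "x \<in> U" "y \<notin> U" "y \<in> verts G"
  proof (cases "a \<in> U")
    case True
    then have "b \<notin> U" using f(2) ab(1) by (auto simp: crosses_def)
    then show ?thesis using that[of a b] True ab by blast
  next
    case False
    then have "b \<in> U" using f(2) ab(1) by (auto simp: crosses_def)
    then show ?thesis using that[of b a] False ab by (simp add: insert_commute)
  qed
  have nf: "f \<notin> F" using UF(5) xy by auto
  have "spans (ends G) (insert y U) (insert f F)"
  proof (subst spans_pendant[of "ends G", OF xy(1)])
    show "spans (ends G) (insert y U - {y}) F" using UF(6) xy(3) by simp
    show "y \<notin> ends G h" if "h \<in> F" for h using UF(5) that xy(3) by blast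
  qed (use xy in auto)
  moreover have "insert y U \<subseteq> verts G" "insert f F \<subseteq> T" "\<forall>g\<in>insert f F. ends G g \<subseteq> insert y U"
    using UF(1,2,5) f(1) xy by auto
  moreover have "card (insert y U) = Suc (Suc k)" "card (insert f F) = Suc k"
    using UF(3,4) nf xy(3) finU finF by simp_all
  ultimately show ?case by blast
qed

lemma spans_subtree:
  assumes "multigraph G" "T \<subseteq> edges G" "spans (ends G) (verts G) T"
  obtains F where "F \<subseteq> T" "spans (ends G) (verts G) F" "card F + 1 = card (verts G)"
proof -
  have fin: "finite (verts G)" using assms(1) by (simp add: multigraph_def)
  have "verts G \<noteq> {}" using assms(3) by (simp add: spans_def)
  then have "Suc (card (verts G) - 1) = card (verts G)" using fin by (simp add: card_gt_0_iff)
  then obtain U F where "U \<subseteq> verts G" "F \<subseteq> T" "card U = card (verts G)" "card F = card (verts G) - 1"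
    "spans (ends G) U F"
    using spans_grow[OF assms, of "card (verts G) - 1"] by auto
  moreover from this have "U = verts G" using card_subset_eq[OF fin] by metis
  ultimately show ?thesis using that \<open>Suc _ = _\<close> by auto
qed

lemma spans_card_le:
  assumes "multigraph G" "T \<subseteq> edges G" "spans (ends G) (verts G) T"
  shows "card (verts G) \<le> card T + 1"
proof -
  obtain F where F: "F \<subseteq> T" "card F + 1 = card (verts G)" using spans_subtree[OF assms] .
  have "finite T" using assms(1,2) by (auto simp: multigraph_def finite_subset)
  then show ?thesis using F card_mono[of T F] by simp
qed

text \<open>If the first edge of the cycle crosses a cut, the rest of the cycle has to return to the
  starting side and crosses it as well.\<close>

lemma cycle_edge_redundant:
  assumes cyc: "is_cycle (G\<lparr>edges := T\<rparr>) vs fs" and sp: "spans (ends G) (verts G) T"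
  shows "spans (ends G) (verts G) (T - {fs ! 0})"
proof (rule spans_transfer[OF sp])
  let ?n = "length fs"
  have n: "0 < ?n" and dist: "distinct fs" and fsT: "set fs \<subseteq> T"
    and ends: "\<And>i. i < ?n \<Longrightarrow> ends G (fs ! i) = {vs ! i, vs ! (Suc i mod ?n)}"
    using cyc by (auto simp: is_cycle_def)
  fix g U assume g: "g \<in> T" "crosses (ends G) g U"
  show "\<exists>g\<in>T - {fs ! 0}. crosses (ends G) g U"
  proof (cases "g = fs ! 0")
    case False
    then show ?thesis using g by blast
  next
    case True
    show ?thesis
    proof (rule ccontr)
      assume no: "\<not> ?thesis"
      have same: "vs ! i \<in> U \<longleftrightarrow> vs ! (Suc i mod ?n) \<in> U" if i: "1 \<le> i" "i < ?n" for i
      proof -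
        have "fs ! i \<noteq> fs ! 0" using i n dist by (simp add: nth_eq_iff_index_eq)
        moreover have "fs ! i \<in> T" using i fsT by auto
        ultimately have "\<not> crosses (ends G) (fs ! i) U" using no by blast
        then show ?thesis using ends[OF i(2)] by (auto simp: crosses_def)
      qed
      \<comment> \<open>Followed from its second vertex, the cycle stays on one side of
        \<open>U\<close>; for \<open>j = ?n - 1\<close> the index wraps around to 0. For a loop
        \<open>?n = 1\<close>, and both indices are 0 from the start.\<close>
      have "vs ! (Suc j mod ?n) \<in> U \<longleftrightarrow> vs ! (1 mod ?n) \<in> U" if "Suc j \<le> ?n" for j
        using that
      proof (induction j)
        case (Suc j)
        then show ?case using same[of "Suc j"] by simp
      qed simp
      from this[of "?n - 1"] have iff: "vs ! 0 \<in> U \<longleftrightarrow> vs ! (1 mod ?n) \<in> U" using n by simp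
      have "ends G g = {vs ! 0, vs ! (1 mod ?n)}" using ends[OF n] True by simp
      then have "ends G g \<subseteq> U \<or> ends G g \<inter> U = {}"
        using iff by (cases "vs ! 0 \<in> U") simp_all
      then show False using g(2) unfolding crosses_def by blast
    qed
  qed
qed

definition is_path :: "('v, 'e) mgraph \<Rightarrow> 'v list \<Rightarrow> 'e list \<Rightarrow> bool" where
  "is_path G vs fs \<longleftrightarrow> length vs = Suc (length fs) \<and> distinct vs \<and> set vs \<subseteq> verts G \<and>
     set fs \<subseteq> edges G \<and> (\<forall>i<length fs. ends G (fs ! i) = {vs ! i, vs ! Suc i})"

lemma is_path_distinct:
  assumes "is_path G vs fs"
  shows "distinct fs"
  unfolding distinct_conv_nth
proof (intro allI impI)
  fix i j assume ij: "i < length fs" "j < length fs" "i \<noteq> j"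
  show "fs ! i \<noteq> fs ! j"
  proof
    assume "fs ! i = fs ! j"
    then have "{vs ! i, vs ! Suc i} = {vs ! j, vs ! Suc j}"
      using assms ij unfolding is_path_def by metis
    then show False
      using assms ij unfolding is_path_def doubleton_eq_iff by (auto simp: nth_eq_iff_index_eq)
  qed
qed

lemma path_exists:
  assumes "multigraph G" "x \<in> verts G" "(x, y) \<in> (adj G)\<^sup>*"
  shows "\<exists>vs fs. is_path G vs fs \<and> vs ! 0 = x \<and> vs ! length fs = y"
  using assms(3)
proof (induction rule: rtrancl_induct)
  case base
  show ?case using assms(2) by (intro exI[of _ "[x]"] exI[of _ "[]"]) (simp add: is_path_def)
next
  case (step y z)
  obtain vs fs where p: "is_path G vs fs" "vs ! 0 = x" "vs ! length fs = y" using step.IH by blast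
  obtain g where g: "g \<in> edges G" "ends G g = {y, z}" using step.hyps(2) by (auto simp: adj_def)
  have z: "z \<in> verts G" using multigraphD(1)[OF assms(1) g(1)] g(2) by blast
  show ?case
  proof (cases "z \<in> set vs")
    case True
    \<comment> \<open>A vertex already visited: the path is cut back to it instead of being
      prolonged.\<close>
    then obtain k where k: "k < length vs" "vs ! k = z" by (metis in_set_conv_nth)
    have "is_path G (take (Suc k) vs) (take k fs)"
      using p(1) k set_take_subset[of "Suc k" vs] set_take_subset[of k fs]
      by (auto simp: is_path_def)
    then show ?thesis
      using p k by (intro exI[of _ "take (Suc k) vs"] exI[of _ "take k fs"]) (auto simp: is_path_def)
  next
    case False
    have "is_path G (vs @ [z]) (fs @ [g])"
      using p g z False by (auto simp: is_path_def nth_append less_Suc_eq)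
    then show ?thesis
      using p by (intro exI[of _ "vs @ [z]"] exI[of _ "fs @ [g]"]) (auto simp: is_path_def nth_append)
  qed
qed

text \<open>A path in \<open>F\<close> between the ends of \<open>f\<close> is closed by
  \<open>f\<close>. If \<open>f\<close> is a loop, the path is trivial and the cycle has length
  one.\<close>

lemma spans_extra_edge_cycle:
  assumes "multigraph G" "F \<subseteq> edges G" "spans (ends G) (verts G) F" "f \<in> edges G" "f \<notin> F"
  shows "\<exists>vs fs. is_cycle (G\<lparr>edges := insert f F\<rparr>) vs fs"
proof -
  obtain x y where xy: "ends G f = {x, y}" "x \<in> verts G" "y \<in> verts G"
    using multigraph_ends_cases[OF assms(1,4)] .
  let ?H = "G\<lparr>edges := F\<rparr>"
  have mH: "multigraph ?H" by (rule multigraph_edges_subset[OF assms(1,2)])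
  have "connected_graph ?H" using connected_graph_iff_spans[OF mH] assms(3) by simp
  then have "(x, y) \<in> (adj ?H)\<^sup>*" using xy by (simp add: connected_graph_def)
  then obtain vs fs where p: "is_path ?H vs fs" "vs ! 0 = x" "vs ! length fs = y"
    using path_exists[OF mH, of x y] xy by auto
  have "is_cycle (G\<lparr>edges := insert f F\<rparr>) vs (fs @ [f])"
    unfolding is_cycle_def
  proof (intro conjI allI impI)
    show "distinct (fs @ [f])" using is_path_distinct[OF p(1)] p(1) assms(5) by (auto simp: is_path_def)
    fix i assume i: "i < length (fs @ [f])"
    show "ends (G\<lparr>edges := insert f F\<rparr>) ((fs @ [f]) ! i) = {vs ! i, vs ! (Suc i mod length (fs @ [f]))}"
      using p i xy by (cases "i = length fs") (auto simp: is_path_def nth_append)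
  qed (use p(1) in \<open>auto simp: is_path_def\<close>)
  then show ?thesis by blast
qed

text \<open>An acyclic connecting set equals any connecting subset with the right number of edges,
  since an extra edge would close a cycle. Conversely, an edge on a cycle could be dropped, leaving
  too few edges to connect all vertices.\<close>

lemma spanning_tree_edges_iff:
  assumes "multigraph G"
  shows "spanning_tree_edges G T \<longleftrightarrow> T \<in> trees G"
proof (cases "T \<subseteq> edges G")
  case True
  let ?H = "G\<lparr>edges := T\<rparr>"
  have fin: "finite T" using True assms by (auto simp: multigraph_def finite_subset)
  have conn: "connected_graph ?H \<longleftrightarrow> spans (ends G) (verts G) T"
    using connected_graph_iff_spans[OF multigraph_edges_subset[OF assms True]] by simp
  have "(\<nexists>vs fs. is_cycle ?H vs fs) \<longleftrightarrow> card T + 1 = card (verts G)"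
    if sp: "spans (ends G) (verts G) T"
  proof
    assume acyclic: "\<nexists>vs fs. is_cycle ?H vs fs"
    obtain F where F: "F \<subseteq> T" "spans (ends G) (verts G) F" "card F + 1 = card (verts G)"
      using spans_subtree[OF assms True sp] .
    have "F = T"
    proof (rule ccontr)
      assume "F \<noteq> T"
      then obtain f where f: "f \<in> T" "f \<notin> F" using F(1) by blast
      have "F \<subseteq> edges G" "f \<in> edges G" using F(1) f(1) True by blast+
      then obtain vs fs where cyc: "is_cycle (G\<lparr>edges := insert f F\<rparr>) vs fs"
        using spans_extra_edge_cycle[OF assms _ F(2) _ f(2)] by blast
      have "insert f F \<subseteq> T" using F(1) f(1) by blast
      then have "is_cycle ?H vs fs" using cyc by (auto simp: is_cycle_def)
      then show False using acyclic by blast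
    qed
    then show "card T + 1 = card (verts G)" using F(3) by simp
  next
    assume c: "card T + 1 = card (verts G)"
    show "\<nexists>vs fs. is_cycle ?H vs fs"
    proof clarify
      fix vs fs assume cyc: "is_cycle ?H vs fs"
      then have "fs ! 0 \<in> T" by (auto simp: is_cycle_def)
      moreover have "T - {fs ! 0} \<subseteq> edges G" using True by blast
      then have "card (verts G) \<le> card (T - {fs ! 0}) + 1"
        using spans_card_le[OF assms] cycle_edge_redundant[OF cyc sp] by blast
      ultimately show False using c fin card_Diff1_less[of T "fs ! 0"] by linarith
    qed
  qed
  then show ?thesis using True conn by (auto simp: spanning_tree_edges_def is_tree_def trees_def)
qed (auto simp: spanning_tree_edges_def trees_def)

section \<open>Series-parallel extensions of spanning trees\<close>

lemma finite_edges: "multigraph G \<Longrightarrow> finite (edges G)"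
  by (simp add: multigraph_def)

lemma finite_verts: "multigraph G \<Longrightarrow> finite (verts G)"
  by (simp add: multigraph_def)

lemma delete_edge_simps [simp]:
  "verts (delete_edge f G) = verts G" "edges (delete_edge f G) = edges G - {f}"
  "ends (delete_edge f G) = ends G"
  by (simp_all add: delete_edge_def)

lemma delete_vertex_simps [simp]:
  "verts (delete_vertex v G) = verts G - {v}" "edges (delete_vertex v G) = {f \<in> edges G. v \<notin> ends G f}"
  "ends (delete_vertex v G) = ends G"
  by (simp_all add: delete_vertex_def)

lemma contract_edge_simps [simp]:
  "verts (contract_edge f u v G) = verts G - {v}" "edges (contract_edge f u v G) = edges G - {f}"
  "ends (contract_edge f u v G) = (\<lambda>g. (\<lambda>x. if x = v then u else x) ` ends G g)"
  by (simp_all add: contract_edge_def)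

lemma trees_not_redundant:
  assumes "multigraph G" "T \<in> trees G" "f \<in> T"
  shows "\<not> spans (ends G) (verts G) (T - {f})"
proof
  assume sp: "spans (ends G) (verts G) (T - {f})"
  have T: "T \<subseteq> edges G" "card T + 1 = card (verts G)" using assms(2) by (auto simp: trees_def)
  then have fin: "finite T" using finite_edges[OF assms(1)] finite_subset by blast
  have "card (verts G) \<le> card (T - {f}) + 1" by (rule spans_card_le[OF assms(1) _ sp]) (use T in blast)
  then show False using T(2) card_Diff1_less[OF fin assms(3)] by linarith
qed

lemma trees_loop:
  assumes "multigraph G" "card (ends G f) = 1"
  shows "trees (delete_edge f G) = trees G"
proof -
  have "f \<notin> T" if T: "T \<in> trees G" for T
    using trees_not_redundant[OF assms(1) T, of f] spans_remove_loop[of "ends G" f "verts G" T] assms(2) T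
    by (auto simp: trees_def)
  then show ?thesis by (auto simp: trees_def)
qed

text \<open>A tree cannot contain both edges, as one would be redundant, and otherwise they are
  interchangeable. The statement has the shape that \<open>strings_dbl_False\<close>
  expects.\<close>

lemma trees_parallel:
  assumes "multigraph G" "f \<in> edges G" "g \<in> edges G" "f \<noteq> g" "ends G f = ends G g"
  shows "T \<in> trees G \<longleftrightarrow> \<not> (f \<in> T \<and> g \<in> T) \<and>
    (if g \<in> T then insert f (T - {g}) \<in> trees (delete_edge g G) else T \<in> trees (delete_edge g G))"
proof (cases "f \<in> T \<and> g \<in> T")
  case True
  have "T \<notin> trees G"
  proof
    assume T: "T \<in> trees G"
    then have "spans (ends G) (verts G) (T - {g})"
      using True assms(4,5) by (intro spans_remove_parallel[of f]) (auto simp: trees_def)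
    then show False using trees_not_redundant[OF assms(1) T] True by blast
  qed
  then show ?thesis using True by blast
next
  case no: False
  show ?thesis
  proof (cases "g \<in> T")
    case True
    define S where "S = T - {g}"
    have S: "T = insert g S" "g \<notin> S" "f \<notin> S" using True no by (auto simp: S_def)
    have "spans (ends G) (verts G) (insert g S) \<longleftrightarrow> spans (ends G) (verts G) (insert f S)"
      using spans_swap_parallel assms(5) by metis
    moreover have "card (insert g S) = card (insert f S)"
    proof (cases "finite S")
      case True
      then show ?thesis using S by simp
    next
      case False
      then show ?thesis by simp
    qed
    ultimately show ?thesis using True no S assms(2-4) by (auto simp: trees_def)
  next
    case False
    then show ?thesis by (auto simp: trees_def)
  qed
qed

lemma trees_pendant:
  assumes "multigraph G" "f \<in> edges G" "ends G f = {u, v}" "u \<noteq> v"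
    and only: "\<And>h. h \<in> edges G \<Longrightarrow> v \<in> ends G h \<Longrightarrow> h = f"
  shows "T \<in> trees G \<longleftrightarrow> f \<in> T \<and> T - {f} \<in> trees (delete_vertex v G)"
proof (cases "T \<subseteq> edges G")
  case True
  have uv: "u \<in> verts G" "v \<in> verts G" using multigraphD(1)[OF assms(1,2)] assms(3) by auto
  have fin: "finite T" using True finite_edges[OF assms(1)] finite_subset by blast
  show ?thesis
  proof (cases "f \<in> T")
    case f: True
    have "spans (ends G) (verts G) (insert f (T - {f})) \<longleftrightarrow> spans (ends G) (verts G - {v}) (T - {f})"
      by (rule spans_pendant[of "ends G", OF assms(3,4) uv]) (use True only in blast)
    moreover have "insert f (T - {f}) = T" using f by blast
    moreover have "card T = Suc (card (T - {f}))" using f fin by (metis card_Suc_Diff1)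
    moreover have "card (verts G) = Suc (card (verts G - {v}))"
      using uv finite_verts[OF assms(1)] by (metis card_Suc_Diff1)
    moreover have "T - {f} \<subseteq> {h \<in> edges G. v \<notin> ends G h}" using True only by blast
    ultimately show ?thesis using True f by (simp add: trees_def)
  next
    case False
    have "\<not> spans (ends G) (verts G) T"
    proof
      assume "spans (ends G) (verts G) T"
      moreover have "verts G \<noteq> {v}" using uv assms(4) by blast
      ultimately obtain h where "h \<in> T" "v \<in> ends G h" using spans_touch uv(2) by metis
      then show False using only True False by blast
    qed
    then show ?thesis using False by (auto simp: trees_def)
  qed
next
  case False
  then show ?thesis using assms(2) by (auto simp: trees_def)
qed

text \<open>A tree has to use \<open>f\<close> or \<open>g\<close> to reach \<open>v\<close>. If it
  uses both, contracting \<open>g\<close> leaves a tree through \<open>f\<close>; if it uses one,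
  that edge is pendant, and dropping it leaves a tree of the contraction that avoids
  \<open>f\<close>.\<close>

lemma trees_series:
  assumes "multigraph G" "f \<in> edges G" "g \<in> edges G" "f \<noteq> g"
    and f: "ends G f = {u', v}" "u' \<noteq> v" and g: "ends G g = {u, v}" "u \<noteq> v"
    and only: "\<And>h. h \<in> edges G \<Longrightarrow> v \<in> ends G h \<Longrightarrow> h = f \<or> h = g"
  shows "T \<in> trees G \<longleftrightarrow> (f \<in> T \<or> g \<in> T) \<and>
    (if f \<in> T \<and> g \<in> T then T - {g} \<in> trees (contract_edge g u v G)
     else T - {f, g} \<in> trees (contract_edge g u v G))"
proof (cases "T \<subseteq> edges G")
  case True
  let ?ed = "ends (contract_edge g u v G)"
  have uv: "u \<in> verts G" "v \<in> verts G" "u' \<in> verts G"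
    using multigraphD(1)[OF assms(1,3)] multigraphD(1)[OF assms(1,2)] f g by auto
  have fin: "finite T" using True finite_edges[OF assms(1)] finite_subset by blast
  have cV: "card (verts G) = Suc (card (verts G - {v}))"
    using uv finite_verts[OF assms(1)] by (metis card_Suc_Diff1)
  \<comment> \<open>If \<open>T\<close> uses a single edge \<open>k\<close> at \<open>v\<close>,
    this edge is pendant in \<open>T\<close>, and the other edges of \<open>T\<close> have the same
    ends before and after the contraction.\<close>
  have one: "T \<in> trees G \<longleftrightarrow> T - {f, g} \<in> trees (contract_edge g u v G)"
    if k: "k \<in> T" "T - {f, g} = T - {k}" "ends G k = {w, v}" "w \<noteq> v" "w \<in> verts G" for k w
  proof -
    have nv: "v \<notin> ends G h" if "h \<in> T - {k}" for h
      using that only[of h] True k(2) by blast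
    have "spans (ends G) (verts G) (insert k (T - {k})) \<longleftrightarrow> spans (ends G) (verts G - {v}) (T - {k})"
      by (rule spans_pendant[of "ends G", OF k(3-5) uv(2) nv])
    also have "\<dots> \<longleftrightarrow> spans ?ed (verts G - {v}) (T - {k})"
    proof (rule spans_cong)
      fix h assume "h \<in> T - {k}"
      then have "v \<notin> ends G h" by (rule nv)
      then show "ends G h = ?ed h" by force
    qed
    also have "insert k (T - {k}) = T" using k(1) by blast
    finally have "spans (ends G) (verts G) T \<longleftrightarrow> spans ?ed (verts G - {v}) (T - {k})" .
    moreover have "card T = Suc (card (T - {k}))" using k(1) fin by (metis card_Suc_Diff1)
    moreover have "T - {k} \<subseteq> edges G - {g}" using True k(2) by blast
    ultimately show ?thesis using True cV k(2) by (auto simp: trees_def)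
  qed
  consider "f \<in> T" "g \<in> T" | "f \<in> T" "g \<notin> T" | "f \<notin> T" "g \<in> T" | "f \<notin> T" "g \<notin> T" by blast
  then show ?thesis
  proof cases
    case 1
    have "spans (ends G) (verts G) (insert g (T - {g})) \<longleftrightarrow> spans ?ed (verts G - {v}) (T - {g})"
      using spans_contract[of "ends G" g u v "verts G" "T - {g}", OF g uv(1,2)] by simp
    moreover have "insert g (T - {g}) = T" using 1 by blast
    moreover have "card T = Suc (card (T - {g}))" using 1 fin by (metis card_Suc_Diff1)
    ultimately show ?thesis using True cV 1 by (auto simp: trees_def)
  next
    case 2
    then have "T - {f, g} = T - {f}" by blast
    then show ?thesis using one[of f u'] f uv 2 by simp
  next
    case 3
    then have "T - {f, g} = T - {g}" by blast
    then show ?thesis using one[of g u] g uv 3 by simp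
  next
    case 4
    have "\<not> spans (ends G) (verts G) T"
    proof
      assume "spans (ends G) (verts G) T"
      moreover have "verts G \<noteq> {v}" using uv g(2) by blast
      ultimately obtain h where "h \<in> T" "v \<in> ends G h" using spans_touch uv(2) by metis
      then show False using only True 4 by blast
    qed
    then show ?thesis using 4 by (auto simp: trees_def)
  qed
next
  case False
  then show ?thesis using assms(2,3) by (auto simp: trees_def)
qed

text \<open>For \<open>r = None\<close> the strings of \<open>X(G)\<close>, for \<open>r = Some e\<close> those of \<open>Y(G, e)\<close>, as functions of the
  edge and for an arbitrary set \<open>B\<close> of bases.\<close>

definition mark :: "'e \<Rightarrow> 'e set \<Rightarrow> 'e \<Rightarrow> bool option" where
  "mark e' S f = (if f = e' then None else Some (f \<in> S))"

primrec strings :: "'e set set \<Rightarrow> 'e option \<Rightarrow> ('e \<Rightarrow> bool option) set" where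
  "strings B None = (\<lambda>T f. Some (f \<in> T)) ` B"
| "strings B (Some e) = {mark e' S | e' S.
     e' \<noteq> e \<and> e \<notin> S \<and> e' \<notin> S \<and> insert e S \<in> B \<and> insert e' S \<in> B}"

lemma strings_markI:
  assumes "e' \<noteq> e" "e \<notin> S" "e' \<notin> S" "insert e S \<in> B" "insert e' S \<in> B" "x = mark e' S"
  shows "x \<in> strings B (Some e)"
  using assms by auto

lemma strings_NoneI: "T \<in> B \<Longrightarrow> x = (\<lambda>f. Some (f \<in> T)) \<Longrightarrow> x \<in> strings B None"
  by simp

section \<open>Effect of the extensions of a graph on its strings\<close>

lemma strings_ext_False:
  assumes "\<And>T. T \<in> B \<Longrightarrow> f \<notin> T"
  shows "ext False f (strings B r) = strings B r"
proof -
  have "x(f := Some False) = x" if "x \<in> strings B r" for x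
    using that assms by (cases r) (fastforce simp: mark_def)+
  then show ?thesis by (simp add: ext_def)
qed

text \<open>Every member of \<open>B'\<close> contains \<open>f\<close>; as \<open>f\<close> is not
  the root, it lies in \<open>S\<close> and never carries the star.\<close>

lemma strings_ext_True:
  assumes B': "\<And>T. T \<in> B' \<longleftrightarrow> f \<in> T \<and> T - {f} \<in> B" and B: "\<And>T. T \<in> B \<Longrightarrow> f \<notin> T"
    and "f \<notin> set_option r"
  shows "strings B' r = ext True f (strings B r)"
proof (cases r)
  case None
  show ?thesis
  proof
    show "strings B' r \<subseteq> ext True f (strings B r)"
    proof
      fix x assume "x \<in> strings B' r"
      then obtain T where T: "T \<in> B'" "x = (\<lambda>g. Some (g \<in> T))" using None by auto
      then have "x = (\<lambda>g. Some (g \<in> T - {f}))(f := Some True)" using B'[of T] by auto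
      moreover have "(\<lambda>g. Some (g \<in> T - {f})) \<in> strings B r"
        unfolding None strings.simps using T(1) B'[of T] by (intro imageI) simp
      ultimately show "x \<in> ext True f (strings B r)" unfolding ext_def by (rule image_eqI)
    qed
    show "ext True f (strings B r) \<subseteq> strings B' r"
    proof
      fix x assume "x \<in> ext True f (strings B r)"
      then obtain T where T: "T \<in> B" "x = (\<lambda>g. Some (g \<in> T))(f := Some True)"
        using None by (auto simp: ext_def)
      then have "x = (\<lambda>g. Some (g \<in> insert f T))" by auto
      moreover have "insert f T \<in> B'" using B'[of "insert f T"] B[OF T(1)] T(1) by simp
      ultimately show "x \<in> strings B' r" unfolding None by (intro strings_NoneI)
    qed
  qed
next
  case (Some e)
  then have fe: "f \<noteq> e" using assms(3) by auto
  show ?thesis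
  proof
    show "strings B' r \<subseteq> ext True f (strings B r)"
    proof
      fix x assume "x \<in> strings B' r"
      then obtain e' S where S: "e' \<noteq> e" "e \<notin> S" "e' \<notin> S" "insert e S \<in> B'" "insert e' S \<in> B'"
        "x = mark e' S" using Some by auto
      have f: "f \<in> S" "f \<noteq> e'" using S(3,4) B' fe by auto
      have "insert e (S - {f}) \<in> B" "insert e' (S - {f}) \<in> B"
        using S(4,5) B' f fe by (simp_all add: insert_Diff_if)
      then have "mark e' (S - {f}) \<in> strings B (Some e)" using S(1-3) by (intro strings_markI) auto
      moreover have "x = (mark e' (S - {f}))(f := Some True)" using S(6) f by (auto simp: mark_def)
      ultimately show "x \<in> ext True f (strings B r)" unfolding ext_def Some by blast
    qed
    show "ext True f (strings B r) \<subseteq> strings B' r"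
    proof
      fix x assume "x \<in> ext True f (strings B r)"
      then obtain e' S where S: "e' \<noteq> e" "e \<notin> S" "e' \<notin> S" "insert e S \<in> B" "insert e' S \<in> B"
        "x = (mark e' S)(f := Some True)" using Some by (auto simp: ext_def)
      have f: "f \<notin> S" "f \<noteq> e'" using B[OF S(5)] by auto
      have "insert e (insert f S) \<in> B'" "insert e' (insert f S) \<in> B'"
        using S(4,5) B' f fe by (simp_all add: insert_Diff_if)
      then show "x \<in> strings B' r"
        unfolding Some using S(1-3,6) f fe by (intro strings_markI[of e' _ "insert f S"]) (auto simp: mark_def)
    qed
  qed
qed

text \<open>A member of \<open>B'\<close> is a member of \<open>B\<close> with \<open>f\<close>
  possibly renamed to \<open>g\<close>. The renaming moves the value of \<open>f\<close>, which may
  also be the star, to \<open>g\<close> and leaves a 0 at \<open>f\<close>.\<close>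

lemma strings_dbl_False:
  assumes B': "\<And>T. T \<in> B' \<longleftrightarrow> \<not> (f \<in> T \<and> g \<in> T) \<and> (if g \<in> T then insert f (T - {g}) \<in> B else T \<in> B)"
    and B: "\<And>T. T \<in> B \<Longrightarrow> g \<notin> T" and "f \<noteq> g" "f \<notin> set_option r" "g \<notin> set_option r"
  shows "strings B' r = dbl False f g (strings B r)"
proof (cases r)
  case None
  show ?thesis
  proof
    show "strings B' r \<subseteq> dbl False f g (strings B r)"
    proof
      fix x assume "x \<in> strings B' r"
      then obtain T where T: "T \<in> B'" "x = (\<lambda>h. Some (h \<in> T))" using None by auto
      show "x \<in> dbl False f g (strings B r)"
      proof (cases "g \<in> T")
        case True
        define y where "y = (\<lambda>h. Some (h \<in> insert f (T - {g})))"
        have "y \<in> strings B r"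
          unfolding None strings.simps y_def using T(1) B'[of T] True by (intro imageI) simp
        moreover have "x = y(f := Some False, g := y f)" using T B'[of T] True by (auto simp: y_def)
        ultimately show ?thesis unfolding dbl_def by blast
      next
        case False
        then have "x \<in> strings B r" using T B'[of T] None by auto
        moreover have "x = x(g := Some False)" using T(2) False by auto
        ultimately show ?thesis unfolding dbl_def by blast
      qed
    qed
    show "dbl False f g (strings B r) \<subseteq> strings B' r"
    proof
      fix x assume "x \<in> dbl False f g (strings B r)"
      then obtain T y where T: "T \<in> B" "y = (\<lambda>h. Some (h \<in> T))"
        "x = y(g := Some False) \<or> x = y(f := Some False, g := y f)"
        using None by (auto simp: dbl_def)
      have g: "g \<notin> T" by (rule B[OF T(1)])
      have TB: "T \<in> B'" using B'[of T] T(1) g by simp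
      show "x \<in> strings B' r"
      proof (cases "x = y \<or> f \<notin> T")
        case True
        then have "x = (\<lambda>h. Some (h \<in> T))" using T(2,3) g by auto
        then show ?thesis using TB None by auto
      next
        case False
        then have "x = (\<lambda>h. Some (h \<in> insert g (T - {f})))" using T(2,3) g assms(3) by auto
        moreover have "insert f (insert g (T - {f}) - {g}) = T" using False g by auto
        then have "insert g (T - {f}) \<in> B'" using B'[of "insert g (T - {f})"] T(1) assms(3) by simp
        ultimately show ?thesis unfolding None by (intro strings_NoneI)
      qed
    qed
  qed
next
  case (Some e)
  then have fe: "f \<noteq> e" and ge: "g \<noteq> e" using assms(4,5) by auto
  show ?thesis
  proof
    show "strings B' r \<subseteq> dbl False f g (strings B r)"
    proof
      fix x assume "x \<in> strings B' r"
      then obtain e' S where S: "e' \<noteq> e" "e \<notin> S" "e' \<notin> S" "insert e S \<in> B'" "insert e' S \<in> B'"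
        "x = mark e' S" using Some by auto
      \<comment> \<open>If \<open>g\<close> lies in \<open>S\<close> or carries the star, it has
        inherited the value of \<open>f\<close>; otherwise \<open>g\<close> carries the constant
        0.\<close>
      consider "g \<in> S" | "g \<notin> S" "e' = g" | "g \<notin> S" "e' \<noteq> g" by blast
      then show "x \<in> dbl False f g (strings B r)"
      proof cases
        case 1
        have f: "f \<notin> S" "f \<noteq> e'" using S(4,5) B' 1 by auto
        define S0 where "S0 = insert f (S - {g})"
        have "insert f (insert e S - {g}) \<in> B" "insert f (insert e' S - {g}) \<in> B"
          using S(4,5) B' 1 by simp_all
        moreover have "insert f (insert e S - {g}) = insert e S0" "insert f (insert e' S - {g}) = insert e' S0"
          using ge 1 S(3) by (auto simp: S0_def)
        ultimately have "mark e' S0 \<in> strings B (Some e)"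
          using S(1-3) f fe by (intro strings_markI) (auto simp: S0_def)
        moreover have "x = (mark e' S0)(f := Some False, g := mark e' S0 f)"
          using S(3,6) f 1 assms(3) by (auto simp: mark_def S0_def)
        ultimately show ?thesis unfolding dbl_def Some by blast
      next
        case 2
        have "f \<notin> S" "insert f S \<in> B" "insert e S \<in> B"
          using S(4,5) B' 2 ge assms(3) by auto
        then have "mark f S \<in> strings B (Some e)" using S(2) fe by (intro strings_markI) auto
        moreover have "x = (mark f S)(f := Some False, g := mark f S f)"
          using S(6) 2 \<open>f \<notin> S\<close> assms(3) by (auto simp: mark_def)
        ultimately show ?thesis unfolding dbl_def Some by blast
      next
        case 3
        then have "insert e S \<in> B" "insert e' S \<in> B" using S(4,5) B' ge by auto
        then have "x \<in> strings B (Some e)" using S by (intro strings_markI) auto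
        moreover have "x = x(g := Some False)" using 3 S(6) by (auto simp: mark_def)
        ultimately show ?thesis unfolding dbl_def Some by blast
      qed
    qed
    show "dbl False f g (strings B r) \<subseteq> strings B' r"
    proof
      fix x assume "x \<in> dbl False f g (strings B r)"
      then obtain y where y: "y \<in> strings B (Some e)"
        "x = y(g := Some False) \<or> x = y(f := Some False, g := y f)"
        unfolding dbl_def Some by blast
      obtain e' S where S: "e' \<noteq> e" "e \<notin> S" "e' \<notin> S" "insert e S \<in> B" "insert e' S \<in> B"
        "y = mark e' S" using y(1) by auto
      have g: "g \<notin> S" "g \<noteq> e'" using B[OF S(5)] by auto
      have SB: "insert e S \<in> B'" "insert e' S \<in> B'" using S(4,5) B' g ge by auto
      have "y(g := Some False) = y" using S(6) g by (auto simp: mark_def)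
      then have y2: "x = y \<or> x = y(f := Some False, g := y f)" using y(2) by metis
      \<comment> \<open>Moving the value of \<open>f\<close> to \<open>g\<close> has an effect only
        if that value is the star or a 1; for a 0 it leaves \<open>y\<close> unchanged.\<close>
      consider "x = y" | "x \<noteq> y" "e' = f" | "x \<noteq> y" "e' \<noteq> f" "f \<in> S" | "x \<noteq> y" "e' \<noteq> f" "f \<notin> S" by blast
      then show "x \<in> strings B' r"
      proof cases
        case 1
        then show ?thesis unfolding Some using S SB by (intro strings_markI) auto
      next
        case 2
        have "insert g S \<in> B'"
          using B'[of "insert g S"] S(3,5) 2 g assms(3) by simp
        moreover have "x = mark g S" using 2 y2 S(3,6) g by (auto simp: mark_def fun_eq_iff)
        ultimately show ?thesis unfolding Some using S(2) SB(1) g ge by (intro strings_markI[of g]) auto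
      next
        case 3
        define S1 where "S1 = insert g (S - {f})"
        have "insert f (insert e S1 - {g}) = insert e S" "insert f (insert e' S1 - {g}) = insert e' S"
          using 3 g ge by (auto simp: S1_def)
        then have "insert e S1 \<in> B'" "insert e' S1 \<in> B'"
          using B'[of "insert e S1"] B'[of "insert e' S1"] S(4,5) fe 3 assms(3) by (auto simp: S1_def)
        moreover have "x = mark e' S1"
          using 3 y2 S(3,6) g assms(3) by (auto simp: mark_def fun_eq_iff S1_def)
        ultimately show ?thesis unfolding Some
          using S(1-3) g ge by (intro strings_markI[of e']) (auto simp: S1_def)
      next
        case 4
        then have "x = y" using y2 S(6) g by (auto simp: mark_def fun_eq_iff)
        then show ?thesis using 4 by blast
      qed
    qed
  qed
qed

text \<open>Every member of \<open>B\<close> extends by \<open>g\<close>, and also by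
  \<open>f\<close> if it avoids \<open>f\<close>; this produces all of \<open>B'\<close>. Hence one
  of the two edges carries a constant 1 and the other the value of \<open>f\<close>.\<close>

lemma strings_dbl_True:
  assumes B': "\<And>T. T \<in> B' \<longleftrightarrow> (f \<in> T \<or> g \<in> T) \<and> (if f \<in> T \<and> g \<in> T then T - {g} \<in> B else T - {f, g} \<in> B)"
    and B: "\<And>T. T \<in> B \<Longrightarrow> g \<notin> T" and "f \<noteq> g" "f \<notin> set_option r" "g \<notin> set_option r"
  shows "strings B' r = dbl True f g (strings B r)"
proof -
  have addg: "insert g T \<in> B'" if "T \<in> B" for T
  proof -
    have "insert g T - {g} = T" "f \<notin> T \<Longrightarrow> insert g T - {f, g} = T" using B[OF that] by auto
    then show ?thesis using B'[of "insert g T"] that assms(3) by auto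
  qed
  have addf: "insert f T \<in> B'" if "T \<in> B" "f \<notin> T" for T
  proof -
    have "insert f T - {f, g} = T" using B[OF that(1)] that(2) by auto
    then show ?thesis using B'[of "insert f T"] that B[OF that(1)] assms(3) by auto
  qed
  show ?thesis
  proof (cases r)
    case None
    show ?thesis
    proof
      show "strings B' r \<subseteq> dbl True f g (strings B r)"
      proof
        fix x assume "x \<in> strings B' r"
        then obtain T where T: "T \<in> B'" "x = (\<lambda>h. Some (h \<in> T))" using None by auto
        define T0 where "T0 = (if f \<in> T \<and> g \<in> T then T - {g} else T - {f, g})"
        define y where "y = (\<lambda>h. Some (h \<in> T0))"
        have "T0 \<in> B" using T(1) B'[of T] by (auto simp: T0_def)
        then have "y \<in> strings B r" unfolding None strings.simps y_def by (rule imageI)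
        moreover have "x = y(g := Some True) \<or> x = y(f := Some True, g := y f)"
          using T B'[of T] assms(3) by (cases "g \<in> T") (auto simp: y_def T0_def fun_eq_iff)
        ultimately show "x \<in> dbl True f g (strings B r)" unfolding dbl_def by blast
      qed
      show "dbl True f g (strings B r) \<subseteq> strings B' r"
      proof
        fix x assume "x \<in> dbl True f g (strings B r)"
        then obtain T y where T: "T \<in> B" "y = (\<lambda>h. Some (h \<in> T))"
          "x = y(g := Some True) \<or> x = y(f := Some True, g := y f)"
          using None by (auto simp: dbl_def)
        have "x = (\<lambda>h. Some (h \<in> insert g T)) \<or> f \<notin> T \<and> x = (\<lambda>h. Some (h \<in> insert f T))"
          using T(3)
        proof
          assume "x = y(g := Some True)"
          then show ?thesis using T(2) by (auto simp: fun_eq_iff)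
        next
          assume "x = y(f := Some True, g := y f)"
          then show ?thesis using T(2) B[OF T(1)] assms(3) by (cases "f \<in> T") (auto simp: fun_eq_iff)
        qed
        then show "x \<in> strings B' r" 
          unfolding None
          using strings_NoneI[OF addg[OF T(1)]] strings_NoneI[OF addf[OF T(1)]] by blast
      qed
    qed
  next
    case (Some e)
    then have fe: "f \<noteq> e" and ge: "g \<noteq> e" using assms(4,5) by auto
    show ?thesis
    proof
      show "strings B' r \<subseteq> dbl True f g (strings B r)"
      proof
        fix x assume "x \<in> strings B' r"
        then obtain e' S where S: "e' \<noteq> e" "e \<notin> S" "e' \<notin> S" "insert e S \<in> B'" "insert e' S \<in> B'"
          "x = mark e' S" using Some by auto
        \<comment> \<open>Every member of \<open>B'\<close> meets \<open>{f, g}\<close>, and the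
          root \<open>e\<close> is neither of the two.\<close>
        have fg: "f \<in> S \<or> g \<in> S" using S(4) B' fe ge by auto
        have in_dbl: "x \<in> dbl True f g (strings B r)"
          if "mark k R \<in> strings B (Some e)"
            "x = (mark k R)(g := Some True) \<or> x = (mark k R)(f := Some True, g := mark k R f)" for k R
          using that unfolding dbl_def Some by blast
        consider "g \<in> S" | "f \<in> S" "g \<notin> S" "e' = g" | "f \<in> S" "g \<notin> S" "e' \<noteq> g" using fg by blast
        then show "x \<in> dbl True f g (strings B r)"
        proof cases
          case 1
          have "insert k (S - {g}) \<in> B" if "insert k S \<in> B'" "k \<noteq> g" for k
          proof (cases "f \<in> insert k S")
            case True
            then have "insert k S - {g} \<in> B" using B' that 1 by auto
            then show ?thesis using that(2) by (simp add: insert_Diff_if)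
          next
            case False
            then have "insert k S - {f, g} \<in> B" using B' that 1 by auto
            moreover have "insert k S - {f, g} = insert k (S - {g})" using False that(2) by auto
            ultimately show ?thesis by simp
          qed
          then have "mark e' (S - {g}) \<in> strings B (Some e)"
            using S(1-5) ge 1 by (intro strings_markI) auto
          moreover have "x = (mark e' (S - {g}))(g := Some True)"
            using S(3,6) 1 by (auto simp: mark_def fun_eq_iff)
          ultimately show ?thesis using in_dbl by blast
        next
          case 2
          have "insert e S - {f, g} \<in> B" "insert g S - {g} \<in> B" using S(4,5) B' 2 ge by auto
          moreover have "insert e S - {f, g} = insert e (S - {f})" "insert g S - {g} = insert f (S - {f})"
            using 2 fe ge by auto
          ultimately have "mark f (S - {f}) \<in> strings B (Some e)"
            using S(2) fe by (intro strings_markI) auto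
          moreover have "x = (mark f (S - {f}))(f := Some True, g := mark f (S - {f}) f)"
            using S(6) 2 by (auto simp: mark_def fun_eq_iff)
          ultimately show ?thesis using in_dbl by blast
        next
          case 3
          have "insert e S - {f, g} \<in> B" "insert e' S - {f, g} \<in> B" using S(4,5) B' 3 ge by auto
          moreover have "insert e S - {f, g} = insert e (S - {f})" "insert e' S - {f, g} = insert e' (S - {f})"
            using 3 fe ge S(3) by auto
          ultimately have "mark e' (S - {f}) \<in> strings B (Some e)"
            using S(1-3) by (intro strings_markI) auto
          moreover have "x = (mark e' (S - {f}))(f := Some True, g := mark e' (S - {f}) f)"
            using S(3,6) 3 by (auto simp: mark_def fun_eq_iff)
          ultimately show ?thesis using in_dbl by blast
        qed
      qed
      show "dbl True f g (strings B r) \<subseteq> strings B' r"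
      proof
        fix x assume "x \<in> dbl True f g (strings B r)"
        then obtain y where y: "y \<in> strings B (Some e)"
          "x = y(g := Some True) \<or> x = y(f := Some True, g := y f)"
          unfolding dbl_def Some by blast
        obtain e' S where S: "e' \<noteq> e" "e \<notin> S" "e' \<notin> S" "insert e S \<in> B" "insert e' S \<in> B"
          "y = mark e' S" using y(1) by auto
        have g: "g \<notin> S" "g \<noteq> e'" using B[OF S(5)] by auto
        have SB: "insert e (insert g S) \<in> B'" "insert e' (insert g S) \<in> B'"
          using addg[OF S(4)] addg[OF S(5)] by (simp_all add: insert_commute)
        have eSf: "insert e (insert f S) \<in> B'" if "f \<notin> S"
          using addf[OF S(4)] that fe by (simp add: insert_commute)
        consider "x = y(g := Some True)" | "x = y(f := Some True, g := y f)" "e' = f"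
          | "x = y(f := Some True, g := y f)" "e' \<noteq> f" "f \<in> S"
          | "x = y(f := Some True, g := y f)" "e' \<noteq> f" "f \<notin> S" using y(2) by blast
        then show "x \<in> strings B' r"
        proof cases
          case 1
          then have "x = mark e' (insert g S)" using S(6) g by (auto simp: mark_def fun_eq_iff)
          then show ?thesis unfolding Some using S(1-3) SB g ge by (intro strings_markI) auto
        next
          case 2
          then have "x = mark g (insert f S)" using S(3,6) g by (auto simp: mark_def fun_eq_iff)
          moreover have "insert g (insert f S) \<in> B'" using SB(2) 2 by (simp add: insert_commute)
          ultimately show ?thesis unfolding Some
            using S(2,3) eSf 2 g ge fe assms(3) by (intro strings_markI[of g]) auto
        next
          case 3
          then have "x = mark e' (insert g S)" using S(6) g by (auto simp: mark_def fun_eq_iff)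
          then show ?thesis unfolding Some using S(1-3) SB g ge by (intro strings_markI) auto
        next
          case 4
          then have "x = mark e' (insert f S)" using S(6) g assms(3) by (auto simp: mark_def fun_eq_iff)
          moreover have "insert e' (insert f S) \<in> B'"
            using addf[OF S(5)] 4 by (simp add: insert_commute)
          ultimately show ?thesis unfolding Some
            using S(1-3) eSf 4 fe by (intro strings_markI) auto
        qed
      qed
    qed
  qed
qed

section \<open>Series-parallel reduction\<close>

text \<open>For \<open>r = Some e\<close> the last conjunct says in terms of cuts that the root is
  neither a loop nor a bridge.\<close>

definition admissible :: "'e option \<Rightarrow> ('v, 'e) mgraph \<Rightarrow> bool" where
  "admissible r G \<longleftrightarrow> multigraph G \<and> spans (ends G) (verts G) (edges G) \<and> \<not> has_minor G K4 \<and>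
     (\<forall>e\<in>set_option r. e \<in> edges G \<and> card (ends G e) = 2 \<and> spans (ends G) (verts G) (edges G - {e}))"

text \<open>The condition on \<open>s True\<close> records that a tree has one edge fewer than there
  are vertices and that, in the rooted case, one of its edges is turned into the star. The number of
  zeros is then fixed by \<open>fam_card\<close>.\<close>

definition derivable :: "'e option \<Rightarrow> ('v, 'e) mgraph \<Rightarrow> bool" where
  "derivable r G \<longleftrightarrow> (\<exists>s. fam (card (set_option r)) s (edges G - set_option r) (strings (trees G) r) \<and>
     s True + 1 + card (set_option r) = card (verts G))"

lemma trees_subset: "T \<in> trees G \<Longrightarrow> T \<subseteq> edges G"
  by (simp add: trees_def)

lemma reduce_loop:
  assumes "admissible r G" "f \<in> edges G" "card (ends G f) = 1"
  shows "admissible r (delete_edge f G)" "derivable r (delete_edge f G) \<Longrightarrow> derivable r G"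
proof -
  have m: "multigraph G" and sp: "spans (ends G) (verts G) (edges G)" and K4: "\<not> has_minor G K4"
    and r: "\<And>e. e \<in> set_option r \<Longrightarrow>
      e \<in> edges G \<and> card (ends G e) = 2 \<and> spans (ends G) (verts G) (edges G - {e})"
    using assms(1) by (auto simp: admissible_def)
  have fr: "f \<notin> set_option r" using r[of f] assms(3) by auto
  have "spans (ends G) (verts G) (edges G - {f} - {e})" if "e \<in> set_option r" for e
    using spans_remove_loop[of "ends G", OF assms(3), of _ "edges G - {e}"] r[OF that]
    by (metis Diff_insert Diff_insert2)
  then show "admissible r (delete_edge f G)"
    using multigraph_delete_edge[OF m] spans_remove_loop[of "ends G", OF assms(3) sp] r fr
      has_minor_step[OF del_edge[OF assms(2)]] K4
    unfolding admissible_def by auto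
  assume "derivable r (delete_edge f G)"
  then obtain s where s: "fam (card (set_option r)) s (edges G - {f} - set_option r) (strings (trees G) r)"
    "s True + 1 + card (set_option r) = card (verts G)"
    by (auto simp: derivable_def trees_loop[OF m assms(3)])
  have "f \<notin> T" if "T \<in> trees G" for T
    using trees_subset[of T "delete_edge f G"] that by (auto simp: trees_loop[OF m assms(3)])
  then have "ext False f (strings (trees G) r) = strings (trees G) r" by (rule strings_ext_False)
  moreover have "insert f (edges G - {f} - set_option r) = edges G - set_option r"
    using assms(2) fr by auto
  ultimately have "fam (card (set_option r)) (s(False := Suc (s False))) (edges G - set_option r) (strings (trees G) r)"
    using fam_ext[OF s(1), of f False] by simp
  then show "derivable r G" using s(2) unfolding derivable_def by (intro exI) auto
qed

lemma reduce_parallel: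
  assumes "admissible r G" "f \<in> edges G" "g \<in> edges G" "f \<noteq> g" "ends G f = ends G g"
    and fr: "f \<notin> set_option r" and gr: "g \<notin> set_option r"
  shows "admissible r (delete_edge g G)" "derivable r (delete_edge g G) \<Longrightarrow> derivable r G"
proof -
  have m: "multigraph G" and sp: "spans (ends G) (verts G) (edges G)" and K4: "\<not> has_minor G K4"
    and r: "\<And>e. e \<in> set_option r \<Longrightarrow>
      e \<in> edges G \<and> card (ends G e) = 2 \<and> spans (ends G) (verts G) (edges G - {e})"
    using assms(1) by (auto simp: admissible_def)
  have "spans (ends G) (verts G) (edges G - {g} - {e})" if "e \<in> set_option r" for e
  proof -
    have "f \<in> edges G - {e}" using that fr assms(2) by blast
    then have "spans (ends G) (verts G) (edges G - {e} - {g})"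
      using spans_remove_parallel[of f "edges G - {e}" g "ends G"] assms(4,5) r[OF that] by blast
    moreover have "edges G - {e} - {g} = edges G - {g} - {e}" by blast
    ultimately show ?thesis by simp
  qed
  then show "admissible r (delete_edge g G)"
    using multigraph_delete_edge[OF m] spans_remove_parallel[OF assms(2,4,5) sp] r gr
      has_minor_step[OF del_edge[OF assms(3)]] K4
    unfolding admissible_def by auto
  assume "derivable r (delete_edge g G)"
  then obtain s where s: "fam (card (set_option r)) s (edges G - {g} - set_option r) (strings (trees (delete_edge g G)) r)"
    "s True + 1 + card (set_option r) = card (verts G)"
    by (auto simp: derivable_def)
  have "strings (trees G) r = dbl False f g (strings (trees (delete_edge g G)) r)"
  proof (rule strings_dbl_False[OF trees_parallel[OF m assms(2-5)] _ assms(4) fr gr])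
    show "g \<notin> T" if "T \<in> trees (delete_edge g G)" for T using trees_subset[OF that] by auto
  qed
  moreover have "insert g (edges G - {g} - set_option r) = edges G - set_option r"
    using assms(3) gr by auto
  moreover have "f \<in> edges G - {g} - set_option r" "g \<notin> edges G - {g} - set_option r"
    using assms(2,4) fr by auto
  ultimately have "fam (card (set_option r)) (s(False := Suc (s False))) (edges G - set_option r) (strings (trees G) r)"
    using fam_dbl[OF s(1), of f g False] by simp
  then show "derivable r G" using s(2) unfolding derivable_def by (intro exI) auto
qed

lemma reduce_pendant:
  assumes "admissible r G" "f \<in> edges G" "ends G f = {u, v}" "u \<noteq> v"
    and only: "\<And>h. h \<in> edges G \<Longrightarrow> v \<in> ends G h \<Longrightarrow> h = f" and fr: "f \<notin> set_option r"
  shows "admissible r (delete_vertex v G)" "derivable r (delete_vertex v G) \<Longrightarrow> derivable r G"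
proof -
  have m: "multigraph G" and sp: "spans (ends G) (verts G) (edges G)" and K4: "\<not> has_minor G K4"
    and r: "\<And>e. e \<in> set_option r \<Longrightarrow>
      e \<in> edges G \<and> card (ends G e) = 2 \<and> spans (ends G) (verts G) (edges G - {e})"
    using assms(1) by (auto simp: admissible_def)
  have uv: "u \<in> verts G" "v \<in> verts G" using multigraphD(1)[OF m assms(2)] assms(3) by auto
  have E: "{h \<in> edges G. v \<notin> ends G h} = edges G - {f}" using only assms(3) by blast
  have sp': "spans (ends G) (verts G - {v}) (A - {f})"
    if "spans (ends G) (verts G) A" "A \<subseteq> edges G" "f \<in> A" for A
  proof -
    have "insert f (A - {f}) = A" using that(3) by blast
    moreover have "v \<notin> ends G h" if "h \<in> A - {f}" for h using only[of h] that \<open>A \<subseteq> edges G\<close> by blast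
    ultimately show ?thesis
      using spans_pendant[of "ends G", OF assms(3,4) uv, of "A - {f}"] that(1) by simp
  qed
  have "spans (ends G) (verts G - {v}) (edges G - {f} - {e}) \<and> e \<in> edges G - {f} \<and> card (ends G e) = 2"
    if "e \<in> set_option r" for e
  proof -
    have ef: "e \<noteq> f" using that fr by blast
    then have "spans (ends G) (verts G - {v}) (edges G - {e} - {f})"
      using sp'[of "edges G - {e}"] r[OF that] assms(2) by blast
    moreover have "edges G - {e} - {f} = edges G - {f} - {e}" by blast
    ultimately show ?thesis using r[OF that] ef by simp
  qed
  then show "admissible r (delete_vertex v G)"
    using multigraph_delete_vertex[OF m] sp'[OF sp order_refl assms(2)]
      has_minor_step[OF del_vertex[OF uv(2)]] K4
    unfolding admissible_def delete_vertex_simps E by blast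
  assume "derivable r (delete_vertex v G)"
  then obtain s where s: "fam (card (set_option r)) s (edges G - {f} - set_option r) (strings (trees (delete_vertex v G)) r)"
    "s True + 1 + card (set_option r) = card (verts G - {v})"
    unfolding derivable_def delete_vertex_simps E by blast
  have "strings (trees G) r = ext True f (strings (trees (delete_vertex v G)) r)"
  proof (rule strings_ext_True[OF trees_pendant[OF m assms(2-4) only] _ fr])
    show "f \<notin> T" if "T \<in> trees (delete_vertex v G)" for T using trees_subset[OF that] E by auto
  qed
  moreover have "insert f (edges G - {f} - set_option r) = edges G - set_option r"
    using assms(2) fr by auto
  ultimately have "fam (card (set_option r)) (s(True := Suc (s True))) (edges G - set_option r) (strings (trees G) r)"
    using fam_ext[OF s(1), of f True] by simp
  moreover have "card (verts G) = Suc (card (verts G - {v}))"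
    using uv finite_verts[OF m] by (metis card_Suc_Diff1)
  ultimately show "derivable r G" using s(2) unfolding derivable_def by (intro exI) auto
qed

lemma reduce_series:
  assumes "admissible r G" "f \<in> edges G" "g \<in> edges G" "f \<noteq> g"
    and f: "ends G f = {u', v}" "u' \<noteq> v" and g: "ends G g = {u, v}" "u \<noteq> v"
    and only: "\<And>h. h \<in> edges G \<Longrightarrow> v \<in> ends G h \<Longrightarrow> h = f \<or> h = g"
    and fr: "f \<notin> set_option r" and gr: "g \<notin> set_option r"
  shows "admissible r (contract_edge g u v G)" "derivable r (contract_edge g u v G) \<Longrightarrow> derivable r G"
proof -
  let ?H = "contract_edge g u v G"
  have m: "multigraph G" and sp: "spans (ends G) (verts G) (edges G)" and K4: "\<not> has_minor G K4"
    and r: "\<And>e. e \<in> set_option r \<Longrightarrow>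
      e \<in> edges G \<and> card (ends G e) = 2 \<and> spans (ends G) (verts G) (edges G - {e})"
    using assms(1) by (auto simp: admissible_def)
  have uv: "u \<in> verts G" "v \<in> verts G" using multigraphD(1)[OF m assms(3)] g by auto
  have sp': "spans (ends ?H) (verts ?H) (A - {g})" if "spans (ends G) (verts G) A" "g \<in> A" for A
  proof -
    have "insert g (A - {g}) = A" using that(2) by blast
    then show ?thesis
      using spans_contract[of "ends G", OF g uv, of "A - {g}"] that(1) by simp
  qed
  have "spans (ends ?H) (verts ?H) (edges ?H - {e}) \<and> e \<in> edges ?H \<and> card (ends ?H e) = 2"
    if "e \<in> set_option r" for e
  proof -
    have e: "e \<noteq> g" "e \<noteq> f" using that gr fr by blast+
    then have "spans (ends ?H) (verts ?H) (edges G - {e} - {g})"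
      using sp'[of "edges G - {e}"] r[OF that] assms(3) by blast
    moreover have "edges G - {e} - {g} = edges ?H - {e}" by auto
    \<comment> \<open>The edges at \<open>v\<close> are \<open>f\<close> and \<open>g\<close>, both
      different from the root, so the root keeps its ends.\<close>
    moreover have "v \<notin> ends G e" using only[of e] r[OF that] e by blast
    then have "ends ?H e = ends G e" by force
    ultimately show ?thesis using r[OF that] e by simp
  qed
  then show "admissible r ?H"
    using multigraph_contract_edge[OF m uv(1) g(2)] sp'[OF sp assms(3)]
      has_minor_step[OF contract[OF assms(3) g]] K4
    unfolding admissible_def by auto
  assume "derivable r ?H"
  then obtain s where s: "fam (card (set_option r)) s (edges G - {g} - set_option r) (strings (trees ?H) r)"
    "s True + 1 + card (set_option r) = card (verts G - {v})"
    by (auto simp: derivable_def)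
  have "strings (trees G) r = dbl True f g (strings (trees ?H) r)"
  proof (rule strings_dbl_True[OF trees_series[OF m assms(2-4) f g only] _ assms(4) fr gr])
    show "g \<notin> T" if "T \<in> trees ?H" for T using trees_subset[OF that] by auto
  qed
  moreover have "insert g (edges G - {g} - set_option r) = edges G - set_option r"
    using assms(3) gr by auto
  moreover have "f \<in> edges G - {g} - set_option r" "g \<notin> edges G - {g} - set_option r"
    using assms(2,4) fr by auto
  ultimately have "fam (card (set_option r)) (s(True := Suc (s True))) (edges G - set_option r) (strings (trees G) r)"
    using fam_dbl[OF s(1), of f g True] by simp
  moreover have "card (verts G) = Suc (card (verts G - {v}))"
    using uv finite_verts[OF m] by (metis card_Suc_Diff1)
  ultimately show "derivable r G" using s(2) unfolding derivable_def by (intro exI) auto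
qed

text \<open>The ends of \<open>e\<close> serve as the two roots. Degree means the number of distinct
  neighbours, so parallel edges may still be present.\<close>

lemma low_degree_vertex:
  assumes m: "multigraph G" and "\<not> has_minor G K4" and e: "e \<in> edges G" "verts G \<noteq> ends G e"
    and noloop: "\<And>f. f \<in> edges G \<Longrightarrow> card (ends G f) = 2"
  shows "\<exists>v\<in>verts G - ends G e. card (adj G `` {v}) \<le> 2"
proof (rule ccontr)
  assume deg: "\<not> ?thesis"
  obtain s t where st: "ends G e = {s, t}" "s \<noteq> t" using noloop[OF e(1)] by (auto simp: card_2_iff)
  have stV: "s \<in> verts G" "t \<in> verts G" using multigraphD(1)[OF m e(1)] st by auto
  define W where "W = verts G - {s, t}"
  have "\<exists>B. K4_model (adj G) (W \<union> {s} \<union> {t}) B"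
  proof (rule rooted_degree_three_K4_model[OF sym_adj])
    show "finite W" using finite_verts[OF m] by (simp add: W_def)
    show "W \<noteq> {}" using e(2) st stV by (auto simp: W_def)
    show "rconn (adj G) {s}" "rconn (adj G) {t}" by (rule rconn_singleton)+
    show "{s} \<inter> {t} = {}" "W \<inter> ({s} \<union> {t}) = {}" using st by (auto simp: W_def)
    show "joined (adj G) {s} {t}" using st e(1) by (auto simp: joined_def adj_def)
    fix w assume w: "w \<in> W"
    show "(w, w) \<notin> adj G" using noloop by (fastforce simp: adj_def)
    have "adj G `` {w} \<subseteq> verts G" using multigraphD(1)[OF m] by (fastforce simp: adj_def)
    then have "adj G `` {w} = (adj G `` {w} \<inter> W) \<union> (adj G `` {w} \<inter> {s}) \<union> (adj G `` {w} \<inter> {t})"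
      by (auto simp: W_def)
    then have "card (adj G `` {w}) \<le>
        card (adj G `` {w} \<inter> W) + card (adj G `` {w} \<inter> {s}) + card (adj G `` {w} \<inter> {t})"
      by (metis card_Un_le add_right_mono order_trans)
    moreover have nb: "card (adj G `` {w} \<inter> {x}) = of_bool (joined (adj G) {w} {x})" for x
      by (auto simp: joined_def)
    moreover have "\<not> card (adj G `` {w}) \<le> 2" using deg w st by (auto simp: W_def)
    ultimately show "3 \<le> card (adj G `` {w} \<inter> W) + of_bool (joined (adj G) {w} {s}) + of_bool (joined (adj G) {w} {t})"
      using nb[of s] nb[of t] by linarith
  qed
  moreover have "W \<union> {s} \<union> {t} = verts G" using stV by (auto simp: W_def)
  ultimately show False using K4_model_has_minor[OF m] assms(2) by auto
qed

text \<open>The vertex of low degree is not on \<open>e\<close>, so no two of its edges are parallel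
  and they are counted by its neighbours. This gives at most two edges, and connectivity gives at
  least one.\<close>

lemma degree_reduction_cases:
  assumes m: "multigraph G" and sp: "spans (ends G) (verts G) (edges G)" and "\<not> has_minor G K4"
    and e: "e \<in> edges G" "verts G \<noteq> ends G e"
    and noloop: "\<And>f. f \<in> edges G \<Longrightarrow> card (ends G f) = 2"
    and nopar: "\<And>f g. f \<in> edges G - {e} \<Longrightarrow> g \<in> edges G - {e} \<Longrightarrow> ends G f = ends G g \<Longrightarrow> f = g"
  obtains (pendant) f u v where "f \<in> edges G" "f \<noteq> e" "ends G f = {u, v}" "u \<noteq> v"
      "\<And>h. h \<in> edges G \<Longrightarrow> v \<in> ends G h \<Longrightarrow> h = f"
    | (series) f g u u' v where "f \<in> edges G" "g \<in> edges G" "f \<noteq> g" "f \<noteq> e" "g \<noteq> e"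
      "ends G f = {u', v}" "u' \<noteq> v" "ends G g = {u, v}" "u \<noteq> v"
      "\<And>h. h \<in> edges G \<Longrightarrow> v \<in> ends G h \<Longrightarrow> h = f \<or> h = g"
proof -
  obtain v where v: "v \<in> verts G" "v \<notin> ends G e" "card (adj G `` {v}) \<le> 2"
    using low_degree_vertex[OF assms(1,3-6)] by blast
  define D where "D = {f \<in> edges G. v \<in> ends G f}"
  have De: "f \<noteq> e" if "f \<in> D" for f using that v(2) by (auto simp: D_def)
  have ex: "\<exists>u. ends G f = {u, v} \<and> u \<noteq> v" if "f \<in> D" for f
    using noloop[of f] that by (auto simp: D_def card_2_iff)
  define w where "w f = (SOME u. ends G f = {u, v} \<and> u \<noteq> v)" for f
  have w: "ends G f = {w f, v} \<and> w f \<noteq> v" if "f \<in> D" for f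
    unfolding w_def by (rule someI_ex[OF ex[OF that]])
  have "inj_on w D"
  proof (rule inj_onI)
    fix f g assume fg: "f \<in> D" "g \<in> D" "w f = w g"
    then have "ends G f = ends G g" using w[of f] w[of g] by simp
    then show "f = g" using nopar[of f g] fg(1,2) De[OF fg(1)] De[OF fg(2)] by (simp add: D_def)
  qed
  moreover have "w ` D \<subseteq> adj G `` {v}"
  proof
    fix x assume "x \<in> w ` D"
    then obtain f where "f \<in> D" "x = w f" by blast
    then have "f \<in> edges G" "ends G f = {v, x}" using w[of f] by (auto simp: D_def)
    then show "x \<in> adj G `` {v}" by (auto simp: adj_def)
  qed
  moreover have "adj G `` {v} \<subseteq> verts G" using multigraphD(1)[OF m] by (fastforce simp: adj_def)
  then have "finite (adj G `` {v})" using finite_verts[OF m] by (rule finite_subset)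
  ultimately have "card D \<le> card (adj G `` {v})" by (rule card_inj_on_le)
  then have "card D \<le> 2" using v(3) by linarith
  moreover have "verts G \<noteq> {v}"
    using v(2) multigraphD(1)[OF m e(1)] noloop[OF e(1)] by (auto simp: card_2_iff)
  then obtain f where "f \<in> edges G" "v \<in> ends G f" by (rule spans_touch[OF sp v(1)])
  then have f: "f \<in> D" by (simp add: D_def)
  moreover have "finite D" using finite_edges[OF m] by (simp add: D_def)
  then have "card D \<noteq> 0" using f by auto
  ultimately have "card D = 1 \<or> card D = 2" by linarith
  then show ?thesis
  proof
    assume "card D = 1"
    then have "D = {f}" using f by (auto simp: card_1_singleton_iff)
    then have "h = f" if "h \<in> edges G" "v \<in> ends G h" for h using that unfolding D_def by blast
    moreover have "f \<in> edges G" using f by (simp add: D_def)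
    ultimately show ?thesis using pendant[of f "w f" v] w[OF f] De[OF f] by blast
  next
    assume "card D = 2"
    then obtain a b where ab: "D = {a, b}" "a \<noteq> b" by (auto simp: card_2_iff)
    then have D: "a \<in> D" "b \<in> D" by blast+
    have "h = a \<or> h = b" if "h \<in> edges G" "v \<in> ends G h" for h using that ab(1) unfolding D_def by blast
    moreover have "a \<in> edges G" "b \<in> edges G" using D by (simp_all add: D_def)
    ultimately show ?thesis
      using series[of a b "w a" v "w b"] w[OF D(1)] w[OF D(2)] De[OF D(1)] De[OF D(2)] ab(2) by blast
  qed
qed

text \<open>A reduction applies as long as there is a loop, a parallel pair off a protected edge
  \<open>e\<close>, or a vertex off \<open>e\<close>. What remains is a single vertex without edges,
  or two vertices joined by at most two edges.\<close>

lemma admissible_derivable: "admissible r G \<Longrightarrow> derivable r G"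
proof (induction "card (edges G)" arbitrary: G rule: less_induct)
  case less
  have m: "multigraph G" and sp: "spans (ends G) (verts G) (edges G)" and K4: "\<not> has_minor G K4"
    and r: "\<And>e. e \<in> set_option r \<Longrightarrow>
      e \<in> edges G \<and> card (ends G e) = 2 \<and> spans (ends G) (verts G) (edges G - {e})"
    using less.prems by (auto simp: admissible_def)
  have fin: "finite (edges G)" "finite (verts G)" using m finite_edges finite_verts by blast+
  have smaller: "card A < card (edges G)" if "f \<in> edges G" "A \<subseteq> edges G - {f}" for f A
    using that fin by (intro psubset_card_mono) auto
  have pendant: ?case if "f \<in> edges G" "ends G f = {u, v}" "u \<noteq> v" "f \<notin> set_option r"
    "\<And>h. h \<in> edges G \<Longrightarrow> v \<in> ends G h \<Longrightarrow> h = f" for f u v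
  proof -
    note red = reduce_pendant[OF less.prems that(1-3) that(5,4)]
    have "edges (delete_vertex v G) \<subseteq> edges G - {f}" using that(2) by auto
    then show ?thesis using red less.hyps[OF smaller[OF that(1)] red(1)] by blast
  qed
  have parallel: ?case if "f \<in> edges G" "g \<in> edges G" "f \<noteq> g" "ends G f = ends G g"
    "f \<notin> set_option r" "g \<notin> set_option r" for f g
  proof -
    note red = reduce_parallel[OF less.prems that]
    show ?thesis using red(2) less.hyps[OF smaller[OF that(2)] red(1)] by simp
  qed
  show ?case
  proof (cases "\<exists>f\<in>edges G. card (ends G f) = 1")
    case True
    then obtain f where f: "f \<in> edges G" "card (ends G f) = 1" by blast
    note red = reduce_loop[OF less.prems f]
    show ?thesis using red(2) less.hyps[OF smaller[OF f(1)] red(1)] by simp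
  next
    case False
    then have noloop: "card (ends G f) = 2" if "f \<in> edges G" for f
      using multigraphD(2)[OF m that] that by blast
    show ?thesis
    proof (cases "edges G = {}")
      case True
      then have "r = None" using r by (cases r) auto
      obtain v where v: "v \<in> verts G" using sp by (auto simp: spans_def)
      have "verts G = {v}" using spans_touch[OF sp v] True by blast
      then have "trees G = {{}}" using True by (auto simp: trees_def spans_def)
      then have "fam 0 (\<lambda>_. 0) (edges G) (strings (trees G) None)"
        using fam_base[of "{}" 0 "\<lambda>_. Some False"] True by simp
      then show ?thesis using \<open>r = None\<close> \<open>verts G = {v}\<close> unfolding derivable_def
        by (intro exI[of _ "\<lambda>_. 0"]) simp
    next
      case False
      \<comment> \<open>Without a root, an arbitrary edge is protected in its place until only its
        two ends are left.\<close>
      then obtain e where e: "e \<in> edges G" "set_option r \<subseteq> {e}"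
        using r by (cases r) auto
      show ?thesis
      proof (cases "\<exists>f\<in>edges G - {e}. \<exists>g\<in>edges G - {e}. f \<noteq> g \<and> ends G f = ends G g")
        case True
        then show ?thesis using parallel e(2) by blast
      next
        case nopar: False
        show ?thesis
        proof (cases "verts G = ends G e")
          case False
          show ?thesis
          proof (rule degree_reduction_cases[OF m sp K4 e(1) False])
            show "card (ends G f) = 2" if "f \<in> edges G" for f by (rule noloop[OF that])
            show "f = g" if "f \<in> edges G - {e}" "g \<in> edges G - {e}" "ends G f = ends G g" for f g
              using nopar that by blast
          next
            fix f u v assume "f \<in> edges G" "f \<noteq> e" "ends G f = {u, v}" "u \<noteq> v"
              "\<And>h. h \<in> edges G \<Longrightarrow> v \<in> ends G h \<Longrightarrow> h = f"
            then show ?thesis using pendant e(2) by blast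
          next
            fix f g u u' v assume s: "f \<in> edges G" "g \<in> edges G" "f \<noteq> g" "f \<noteq> e" "g \<noteq> e"
              "ends G f = {u', v}" "u' \<noteq> v" "ends G g = {u, v}" "u \<noteq> v"
              "\<And>h. h \<in> edges G \<Longrightarrow> v \<in> ends G h \<Longrightarrow> h = f \<or> h = g"
            have fr: "f \<notin> set_option r" "g \<notin> set_option r" using s(4,5) e(2) by blast+
            note red = reduce_series[OF less.prems s(1-3) s(6-10) fr]
            show ?thesis using red(2) less.hyps[OF smaller[OF s(2)] red(1)] by simp
          qed
        next
          case V: True
          have ends: "ends G f = verts G" if "f \<in> edges G" for f
            using multigraphD(1)[OF m that] noloop[OF that] noloop[OF e(1)] V fin
            by (metis card_subset_eq)
          have "f = g" if "f \<in> edges G - {e}" "g \<in> edges G - {e}" for f g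
            using nopar that ends by (metis DiffD1)
          then have E: "edges G = {e} \<or> (\<exists>f. f \<noteq> e \<and> edges G = {e, f})" using e(1) by blast
          obtain u v where uv: "verts G = {u, v}" "u \<noteq> v"
            using noloop[OF e(1)] V by (auto simp: card_2_iff)
          show ?thesis
          proof (cases r)
            \<comment> \<open>In the unrooted case \<open>e\<close> itself may now be reduced: a
              single edge is pendant, and two edges are parallel.\<close>
            case None
            show ?thesis
            proof (cases "edges G = {e}")
              case True
              have "ends G e = {u, v}" using V uv(1) by simp
              then show ?thesis by (rule pendant[OF e(1) _ uv(2)]) (use None True in auto)
            next
              case False
              then obtain f where "f \<noteq> e" "edges G = {e, f}" using E by blast
              then have f: "e \<noteq> f" "f \<in> edges G" by auto
              have "ends G e = ends G f" using ends e(1) f(2) by metis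
              then show ?thesis by (rule parallel[OF e(1) f(2,1)]) (simp_all add: None)
            qed
          next
            case (Some e1)
            then have "r = Some e" using e(2) by auto
            \<comment> \<open>The root is not a bridge, so a second edge \<open>f\<close> joins the
              two vertices. The trees are \<open>{e}\<close> and \<open>{f}\<close>, and the only
              string is a star at \<open>f\<close>: the base case with \<open>k = 1\<close>.\<close>
            have "edges G \<noteq> {e}"
            proof
              assume "edges G = {e}"
              then have "spans (ends G) (verts G) {}" using r[of e] \<open>r = Some e\<close> by auto
              then show False using spans_touch[of "ends G" "verts G" "{}" u] uv by auto
            qed
            then obtain f where f: "f \<noteq> e" "edges G = {e, f}" using E by blast
            have single: "{x} \<in> trees G" if "x \<in> edges G" for x
            proof -
              have "crosses (ends G) x U" if "U \<subset> verts G" "U \<noteq> {}" for U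
                using ends[OF \<open>x \<in> edges G\<close>] that by (auto simp: crosses_def)
              then show ?thesis using that uv by (auto simp: trees_def spans_def)
            qed
            have "T = {e} \<or> T = {f}" if T: "T \<in> trees G" for T
            proof -
              have "card T = 1" using T uv by (simp add: trees_def)
              then show ?thesis using trees_subset[OF T] f(2) by (auto simp: card_1_singleton_iff)
            qed
            then have "trees G = {{e}, {f}}" using single f(2) by blast
            then have "strings (trees G) r = {mark f {}}"
              using f(1) unfolding \<open>r = Some e\<close> by (auto simp: doubleton_eq_iff insert_eq_iff subset_singleton_iff)
            then have "fam 1 (\<lambda>_. 0) {f} (strings (trees G) r)"
              using fam_base[of "{f}" 1 "mark f {}"] by (simp add: mark_def)
            then show ?thesis unfolding derivable_def \<open>r = Some e\<close>
              using f uv \<open>r = Some e\<close> by (intro exI[of _ "\<lambda>_. 0"]) auto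
          qed
        qed
      qed
    qed
  qed
qed

theorem theorem3p9:
  shows "(\<forall>(G :: ('v, 'e) mgraph) es.
            connected_graph G \<longrightarrow> series_parallel G \<longrightarrow> ordering_of es (edges G) \<longrightarrow>
            X_strings G es \<subseteq> L (num_edges G + 1 - num_verts G) (num_verts G - 1) \<and>
            p_degenerate (num_edges G + 1 - num_verts G) (num_verts G - 1) (X_strings G es)) \<and>
         (\<forall>(G :: ('v, 'e) mgraph) e es.
            (G, e) \<in> rooted_sp \<longrightarrow> ordering_of es (edges G - {e}) \<longrightarrow>
            Y_strings G e es \<subseteq> L' (num_edges G - num_verts G) (num_verts G - 2) \<and>
            p_degenerate' (num_edges G - num_verts G) (num_verts G - 2) (Y_strings G e es))"
proof (intro conjI[of "\<forall>(G :: ('v, 'e) mgraph) es. _ G es"] allI impI)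
  fix G :: "('v, 'e) mgraph" and es
  assume conn: "connected_graph G" and SP: "series_parallel G" and es: "ordering_of es (edges G)"
  have m: "multigraph G" using SP by (simp add: series_parallel_def)
  have "admissible None G"
    using SP conn connected_graph_iff_spans[OF m] by (simp add: admissible_def series_parallel_def)
  then obtain s where s: "fam 0 s (edges G) (strings (trees G) None)" "s True + 1 = card (verts G)"
    using admissible_derivable[of None G] by (auto simp: derivable_def)
  have "map Some ` X_strings G es = (\<lambda>x. map x es) ` strings (trees G) None"
    by (auto simp: X_strings_def spanning_tree_edges_iff[OF m] image_image Setcompr_eq_image comp_def)
  \<comment> \<open>The coordinates split into \<open>v(G) - 1\<close> ones and the zeros; adding 1
    before subtracting keeps the subtraction of naturals exact.\<close>
  moreover have "s True = num_verts G - 1" "s False = num_edges G + 1 - num_verts G"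
    using s(2) fam_card[OF s(1)] by (auto simp: num_verts_def num_edges_def)
  ultimately show "X_strings G es \<subseteq> L (num_edges G + 1 - num_verts G) (num_verts G - 1) \<and>
      p_degenerate (num_edges G + 1 - num_verts G) (num_verts G - 1) (X_strings G es)"
    using fam_p_degenerate[OF s(1) es] by simp
next
  fix G :: "('v, 'e) mgraph" and e es
  assume G: "(G, e) \<in> rooted_sp" and es: "ordering_of es (edges G - {e})"
  have m: "multigraph G" and conn: "connected_graph G" and K4: "\<not> has_minor G K4" and e: "e \<in> edges G"
    and bridge: "\<not> is_bridge G e" and loop: "\<not> is_loop G e"
    using G by (auto simp: rooted_sp_def series_parallel_def)
  have "card (ends G e) = 2" using multigraphD(2)[OF m e] loop e by (auto simp: is_loop_def)
  moreover have "connected_graph (delete_edge e G)"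
    using conn bridge e by (auto simp: connected_graph_def is_bridge_def)
  then have "spans (ends G) (verts G) (edges G - {e})"
    using connected_graph_iff_spans[OF multigraph_delete_edge[OF m]] by fastforce
  ultimately have "admissible (Some e) G"
    using m K4 e conn connected_graph_iff_spans[OF m] by (simp add: admissible_def)
  then obtain s where s: "fam 1 s (edges G - {e}) (strings (trees G) (Some e))" "s True + 2 = card (verts G)"
    using admissible_derivable[of "Some e" G] by (auto simp: derivable_def)
  have "Y_strings G e es = (\<lambda>x. map x es) ` strings (trees G) (Some e)"
  proof -
    have "e' \<in> edges G - {e} \<and> S \<subseteq> edges G - {e, e'} \<and> insert e S \<in> trees G \<and> insert e' S \<in> trees G \<longleftrightarrow>
        e' \<noteq> e \<and> e \<notin> S \<and> e' \<notin> S \<and> insert e S \<in> trees G \<and> insert e' S \<in> trees G" for e' S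
      using trees_subset[of "insert e' S" G] by auto
    then show ?thesis
      unfolding Y_strings_def spanning_tree_edges_iff[OF m] strings.simps
      by (auto simp: mark_def[abs_def])
  qed
  \<comment> \<open>The star takes one of the \<open>e(G) - 1\<close> coordinates and stands for one
    of the \<open>v(G) - 1\<close> tree edges, which leaves \<open>v(G) - 2\<close> ones and
    \<open>e(G) - v(G)\<close> zeros.\<close>
  moreover have "card (edges G - {e}) = num_edges G - 1" using e by (simp add: num_edges_def)
  then have "s True = num_verts G - 2" "s False = num_edges G - num_verts G"
    using s(2) fam_card[OF s(1)] by (auto simp: num_verts_def)
  ultimately show "Y_strings G e es \<subseteq> L' (num_edges G - num_verts G) (num_verts G - 2) \<and>
      p_degenerate' (num_edges G - num_verts G) (num_verts G - 2) (Y_strings G e es)"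
    using fam_p_degenerate'[OF s(1) es] by simp
qed

end
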